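(* Let $\epsilon>0$ be a fixed, arbitrarily small number. Let $\Delta\in(0,1/6]$ and suppose there is a constant $A(\Delta)>0$ such that $$\Big|\sum_{a\le n<b} n^{it}\Big|<A(\Delta)\,\sqrt{a}\,t^{\Delta}$$ for all $t>0$ and all $a,b$ with $1\le a<b\le 2a$ and $b\le\sqrt{t/(2\pi)}$. For $\tau\in[-\pi,\pi]$ put $$F(\tau,T,H)=\sum_{T\le t_\nu\le T+H} Z[t_\nu(\tau)].$$ Then, as $T\to\infty$, for $H\in(0,T^{1/6+\epsilon}]$, $$F(\tau,T,H)-F(0,T,H)=\mathcal{O}(T^{\Delta}\ln T),$$ uniformly for $\tau\in[-\pi,\pi]$.
   Context: $Z(t)=e^{i\vartheta(t)}\zeta(\tfrac12+it)$ is the (real-valued) Riemann–Siegel (Hardy) function, where $\vartheta(t)=-\frac t2\ln\pi+\operatorname{Im}\ln\Gamma\left(\frac14+i\frac t2\right)$ (continuous branch with $\vartheta(0)=0$). For integers $\nu\ge\nu_0$ ($\nu_0$ a fixed sufficiently large integer) and $\tau\in[-\pi,\pi]$, $t_\nu(\tau)$ is the (large) solution of $\vartheta[t_\nu(\tau)]=\pi\nu+\tau$, and $t_\nu=t_\nu(0)$. Sums $\sum_{T\le t_\nu\le T+H}$ run over all integers $\nu$ with $t_\nu\in[T,T+H]$. The implied constants do not depend on $T$ or $H$. *)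

theory Defs
  imports "HOL-Complex_Analysis.Complex_Analysis"
begin

text \<open>
  The Riemann zeta function is the analytic continuation of its Dirichlet series to
  the complex plane without the point 1. The continuation determines
  all values except the one at 1, which is left arbitrary.
\<close>

definition is_zeta_continuation :: "(complex \<Rightarrow> complex) \<Rightarrow> bool" where
  "is_zeta_continuation f \<longleftrightarrow>
     f holomorphic_on (- {1}) \<and>
     (\<forall>s. Re s > 1 \<longrightarrow> (\<lambda>n. 1 / of_nat (Suc n) powr s) sums f s)"

definition riemann_zeta :: "complex \<Rightarrow> complex" where
  "riemann_zeta = (SOME f. is_zeta_continuation f)"

lemma is_zeta_continuation_unique:
  assumes f: "is_zeta_continuation f" and g: "is_zeta_continuation g" and "s \<noteq> 1"
  shows "f s = g s"
proof -
  have eq: "f z = g z" if "z \<in> {z. Re z > 1}" for z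
    using f g that sums_unique2 unfolding is_zeta_continuation_def by blast
  have "f s - g s = 0"
  proof (rule analytic_continuation_open[of "{z. Re z > 1}" "- {1}"
        "\<lambda>z. f z - g z" "\<lambda>_. 0"])
    show "open {z. Re z > 1}" by (rule open_halfspace_Re_gt)
    show "{z. Re z > 1} \<noteq> {}"
      using complex.sel(1)[of 2 0] by (metis empty_iff mem_Collect_eq one_less_numeral_iff semiring_norm(76))
    show "connected (- {1::complex})"
      by (rule connected_punctured_universe) simp
  qed (use f g eq \<open>s \<noteq> 1\<close> in
        \<open>auto simp: is_zeta_continuation_def intro!: holomorphic_intros\<close>)
  then show ?thesis by simp
qed

text \<open>
  \<^const>\<open>ln_Gamma\<close> on the complex numbers is the branch of the logarithm of the Gamma
  function that is holomorphic off the non-positive real axis and real on the positive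
  real axis; hence the function below is continuous and vanishes at 0.
\<close>

definition rs_theta :: "real \<Rightarrow> real" where
  "rs_theta t = - (t / 2) * ln pi + Im (ln_Gamma (1 / 4 + \<i> * of_real (t / 2)))"

lemma rs_theta_0: "rs_theta 0 = 0"
proof -
  have "ln_Gamma (complex_of_real (1 / 4)) = of_real (ln_Gamma (1 / 4))"
    by (rule ln_Gamma_complex_of_real) simp
  then show ?thesis by (simp add: rs_theta_def)
qed

lemma continuous_on_rs_theta: "continuous_on UNIV rs_theta"
proof -
  have *: "(\<lambda>t::real. 1 / 4 + \<i> * complex_of_real (t / 2)) ` UNIV \<inter> \<real>\<^sub>\<le>\<^sub>0 = {}"
    by (auto simp: complex_nonpos_Reals_iff)
  have "continuous_on UNIV (\<lambda>t::real. ln_Gamma (1 / 4 + \<i> * complex_of_real (t / 2)))"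
    by (rule continuous_on_compose2[OF continuous_on_ln_Gamma_complex[OF *]])
       (auto intro!: continuous_intros)
  then show ?thesis
    unfolding rs_theta_def by (intro continuous_intros) auto
qed

text \<open>The values of Hardy's function are real; they are kept as complex numbers here.\<close>

definition hardy_Z :: "real \<Rightarrow> complex" where
  "hardy_Z t = exp (\<i> * of_real (rs_theta t)) * riemann_zeta (1 / 2 + \<i> * of_real t)"

text \<open>
  \<^const>\<open>rs_theta\<close> is odd, tends to infinity, and is increasing beyond its minimum near
  6.29, so an equation \<open>rs_theta t = x\<close> may have several solutions; the large
  one is the greatest. It exists for every real \<open>x\<close>.
\<close>

definition gram_pt :: "int \<Rightarrow> real \<Rightarrow> real" where
  "gram_pt \<nu> \<tau> = (GREATEST t. rs_theta t = pi * of_int \<nu> + \<tau>)"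

text \<open>
  The range of summation is finite, and for large \<open>T\<close> it contains only large \<open>\<nu>\<close>, so no
  lower bound on \<open>\<nu>\<close> has to be imposed.
\<close>

definition gram_sum :: "real \<Rightarrow> real \<Rightarrow> real \<Rightarrow> complex" where
  "gram_sum \<tau> T H =
     (\<Sum>\<nu> | T \<le> gram_pt \<nu> 0 \<and> gram_pt \<nu> 0 \<le> T + H. hardy_Z (gram_pt \<nu> \<tau>))"

end

theory Submission
  imports Defs "HOL-Probability.Probability" "HOL-Real_Asymp.Real_Asymp"
begin

text \<open>
  Riemann's integral over the line of direction \<open>1 + \<i>\<close> through \<open>1 / 2\<close> gives
  \<open>\<zeta>(s) = R(s) + \<chi>(s) cnj (R (1 - cnj s))\<close>: evaluate a Mordell integral in closed form,
  multiply it by a power and integrate along a ray; this also yields the continuation of the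
  Dirichlet series. Hence \<open>Z(t) = 2 Re (e\<^sup>i\<^sup>\<theta> R(1/2 + \<i>t))\<close>, and moving the line to the
  saddle point \<open>sqrt (t / 2\<pi>)\<close> picks up the residues \<open>n\<^sup>-\<^sup>s\<close> and leaves \<open>O(t\<^sup>-\<^sup>1\<^sup>/\<^sup>4)\<close>.

  Since \<open>\<theta>' = ln (t / 2\<pi>) / 2 + O(1 / t)\<close>, the points \<open>t\<^sub>\<nu>(\<tau>)\<close> with \<open>t\<^sub>\<nu> \<in> [T, T + H]\<close> form an
  arithmetic progression of step \<open>\<pi> / \<omega>\<close>, \<open>\<omega> = ln (T / 2\<pi>) / 2\<close>, up to a negligible error. The sum over
  \<open>\<nu>\<close> is then geometric of ratio \<open>exp (\<i>\<pi>x)\<close>, \<open>x = 1 - ln n / \<omega>\<close>, and its poles at \<open>n\<close> close to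
  \<open>sqrt (T / 2\<pi>)\<close> are cancelled in the difference by the factor \<open>exp (\<i>\<tau>x) - 1\<close>. The quotient is of
  bounded variation, so partial summation over dyadic blocks reduces the difference to the
  exponential sums of the hypothesis.
\<close>

section \<open>Integrals over vertical and slanted lines\<close>

text \<open>All lines have direction 1 + \<i> because exp (\<i> pi x^2) is Gaussian along them: no
  power or linear exponential can then endanger absolute convergence.

  The geometric sum over \<nu> is available only if the main sum has the same length
  \<open>N\<close> at every point, which requires slack in the choice of \<open>N\<close>. Each
  point then suffers two losses. Truncation costs t^(-1/4). As \<theta>' varies by O(H / T), the
  points deviate from the progression by O(H^2 / T); multiplied by ln n and summed with n^(-1/2) up
  to n = O(T^(1/2)), this costs O(H^2 T^(-3/4) ln T). For H \<le> T^(1/4) both are T^(-1/4) up to a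
  logarithm, and there are O(H ln T) points, so the total is O((ln T)^2), which T^\<Delta> ln T
  absorbs. The length T^(1/4) is reached at \<epsilon> = 1/12.

  A geometric sum consists of its two ends, so the exponential sums are needed at two heights only.
  For x in [0, 1] the ratio exp (\<i> pi x) equals 1 at x = 0 alone, hence a single factor removes
  every small denominator.\<close>

lemma has_bochner_integral_gaussian:
  "has_bochner_integral lborel (\<lambda>x::real. exp (- x\<^sup>2)) (sqrt pi)"
  using has_bochner_integral_even_function[OF gaussian_moment_0] by simp

lemma integrable_gaussian: "integrable lborel (\<lambda>x::real. exp (- x\<^sup>2))"
  using has_bochner_integral_gaussian by (rule integrable.intros)

lemma integrable_gaussian_bound:
  fixes f :: "real \<Rightarrow> complex"
  assumes "f \<in> borel_measurable borel" "\<And>v. norm (f v) \<le> C * exp (- v\<^sup>2)"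
  shows "integrable lborel f"
proof (rule Bochner_Integration.integrable_bound)
  show "integrable lborel (\<lambda>v. C * exp (- v\<^sup>2))"
    by (intro integrable_mult_right integrable_gaussian)
  show "AE v in lborel. norm (f v) \<le> norm (C * exp (- v\<^sup>2))"
    using assms(2) by (intro AE_I2) (smt (verit) norm_ge_zero real_norm_def)
qed (use assms in auto)

lemma exp_linear_le_gaussian:
  fixes M v :: real
  shows "exp (M * \<bar>v\<bar> - 2 * v\<^sup>2) \<le> exp (M\<^sup>2 / 4) * exp (- v\<^sup>2)"
proof -
  have "0 \<le> (M / 2 - \<bar>v\<bar>)\<^sup>2" by simp
  then have "M * \<bar>v\<bar> - 2 * v\<^sup>2 \<le> M\<^sup>2 / 4 + (- v\<^sup>2)"
    by (simp add: power2_eq_square algebra_simps)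
  then show ?thesis by (simp flip: exp_add)
qed

text \<open>The vertical sides are kept apart from the horizontal ones because the latter vanish
  once \<open>n\<close> grows. The margins \<open>y1\<close> and \<open>y2\<close> provide an open
  convex strip around the closed rectangle, on which the residue theorem applies.\<close>

lemma rectangle_residue:
  assumes "y1 < x1" "x1 < Re p" "Re p < x2" "x2 < y2" "\<bar>Im p\<bar> < n"
    and holo: "g holomorphic_on {z. y1 < Re z \<and> Re z < y2} - {p}"
  shows "\<i> * integral {-n..n} (\<lambda>v. g (Complex x2 v)) - \<i> * integral {-n..n} (\<lambda>v. g (Complex x1 v))
    = 2 * pi * \<i> * residue g p
      + contour_integral (linepath (Complex x1 n) (Complex x2 n)) g
      - contour_integral (linepath (Complex x1 (-n)) (Complex x2 (-n))) g"
proof -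
  define S where "S = {z. y1 < Re z \<and> Re z < y2}"
  define a where "a = Complex x1 (-n)"
  define b where "b = Complex x2 n"
  define a2 where "a2 = Complex x2 (-n)"
  define b2 where "b2 = Complex x1 n"
  have n: "n > 0" and x: "x1 < x2" using assms by linarith+
  have S: "S = {z. y1 < Re z} \<inter> {z. Re z < y2}" by (auto simp: S_def)
  have opS: "open S" unfolding S by (intro open_Int open_halfspace_Re_gt open_halfspace_Re_lt)
  have coS: "convex S" unfolding S
    by (intro convex_Int convex_halfspace_Re_gt convex_halfspace_Re_lt)
  have pbox: "p \<in> box a b" using assms n by (auto simp: in_box_complex_iff a_def b_def)
  have "path_image (rectpath a b) \<subseteq> cbox a b - box a b"
    using n x by (subst path_image_rectpath_cbox_minus_box) (auto simp: a_def b_def)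
  moreover have cb: "cbox a b \<subseteq> S"
    using assms by (auto simp: in_cbox_complex_iff a_def b_def S_def)
  ultimately have pim: "path_image (rectpath a b) \<subseteq> S - {p}"
    using pbox by auto
  have seg: "closed_segment a a2 \<union> closed_segment a2 b \<union> closed_segment b b2 \<union> closed_segment b2 a
      \<subseteq> S - {p}"
    using pim by (simp add: rectpath_def Let_def path_image_join a_def b_def a2_def b2_def)
  have cont: "continuous_on (S - {p}) g"
    using holo holomorphic_on_imp_continuous_on by (auto simp: S_def)
  have int: "g contour_integrable_on linepath u v" if "closed_segment u v \<subseteq> S - {p}" for u v
    using cont that by (intro contour_integrable_continuous_linepath) (rule continuous_on_subset)
  have i: "g contour_integrable_on linepath a a2" "g contour_integrable_on linepath a2 b"
    "g contour_integrable_on linepath b b2" "g contour_integrable_on linepath b2 a"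
    using seg by (intro int; blast)+
  have "contour_integral (rectpath a b) g =
      2 * pi * \<i> * (\<Sum>p\<in>{p}. winding_number (rectpath a b) p * residue g p)"
  proof (rule Residue_theorem[OF opS])
    show "connected S" using coS by (rule convex_connected)
    show "\<forall>z. z \<notin> S \<longrightarrow> winding_number (rectpath a b) z = 0"
      using cb n x by (auto intro!: winding_number_rectpath_outside simp: a_def b_def)
  qed (use holo pim in \<open>auto simp: S_def\<close>)
  also have "\<dots> = 2 * pi * \<i> * residue g p"
    using winding_number_rectpath[OF pbox] by simp
  also have "contour_integral (rectpath a b) g =
      contour_integral (linepath a a2) g + contour_integral (linepath a2 b) g
      + contour_integral (linepath b b2) g + contour_integral (linepath b2 a) g"
    using i by (simp add: rectpath_def Let_def a_def b_def a2_def b2_def contour_integrable_join valid_path_join)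
  also have "contour_integral (linepath b b2) g = - contour_integral (linepath b2 b) g"
    using seg cont by (intro contour_integral_reverse_linepath continuous_on_subset[OF cont])
       (auto simp: closed_segment_commute)
  also have "contour_integral (linepath b2 a) g = - contour_integral (linepath a b2) g"
    using seg cont by (intro contour_integral_reverse_linepath continuous_on_subset[OF cont])
       (auto simp: closed_segment_commute)
  also have "contour_integral (linepath a b2) g = \<i> * integral {-n..n} (\<lambda>v. g (Complex x1 v))"
    using n by (intro contour_integral_linepath_same_Re) (auto simp: a_def b2_def)
  also have "contour_integral (linepath a2 b) g = \<i> * integral {-n..n} (\<lambda>v. g (Complex x2 v))"
    using n by (intro contour_integral_linepath_same_Re) (auto simp: b_def a2_def)
  finally show ?thesis
    by (simp add: a_def b_def a2_def b2_def algebra_simps)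
qed

text \<open>Contour integrals deliver gauge integrals over bounded intervals, everything else is
  done with Lebesgue integrals over the line; dominated convergence links the two.\<close>

lemma tendsto_integral_symmetric:
  fixes f :: "real \<Rightarrow> complex"
  assumes f: "integrable lborel f"
  shows "(\<lambda>n. integral {- real n..real n} f) \<longlonglongrightarrow> (\<integral>v. f v \<partial>lborel)"
proof -
  have set: "set_integrable lborel {- real n..real n} f" for n
    unfolding set_integrable_def using f by (intro integrable_mult_indicator) auto
  have "(\<lambda>n. \<integral>v. indicator {- real n..real n} v *\<^sub>R f v \<partial>lborel) \<longlonglongrightarrow> (\<integral>v. f v \<partial>lborel)"
  proof (rule integral_dominated_convergence[where w = "\<lambda>v. norm (f v)"])
    show "AE v in lborel. (\<lambda>n. indicator {- real n..real n} v *\<^sub>R f v) \<longlonglongrightarrow> f v"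
    proof (intro AE_I2 tendsto_eventually)
      fix v :: real
      obtain N :: nat where N: "\<bar>v\<bar> < real N" using reals_Archimedean2 by blast
      show "\<forall>\<^sub>F n in sequentially. indicator {- real n..real n} v *\<^sub>R f v = f v"
        using eventually_ge_at_top[of N] by eventually_elim (use N in \<open>auto simp: indicator_def\<close>)
    qed
  qed (use f in \<open>auto simp: indicator_def\<close>)
  then show ?thesis
    using set_borel_integral_eq_integral(2)[OF set] by (simp add: set_lebesgue_integral_def)
qed

text \<open>The rectangle of \<open>rectangle_residue\<close> grows to full height. The Gaussian
  bound serves the horizontal edges alone and is therefore requested only at a distance from the
  pole.\<close>

proposition vertical_line_integral_shift:
  assumes x: "y1 < x1" "x1 < Re p" "Re p < x2" "x2 < y2"
    and holo: "g holomorphic_on {z. y1 < Re z \<and> Re z < y2} - {p}"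
    and bound: "\<And>z. x1 \<le> Re z \<Longrightarrow> Re z \<le> x2 \<Longrightarrow> 1 + \<bar>Im p\<bar> \<le> \<bar>Im z\<bar> \<Longrightarrow> norm (g z) \<le> C * exp (- (Im z)\<^sup>2)"
    and int1: "integrable lborel (\<lambda>v. g (Complex x1 v))"
    and int2: "integrable lborel (\<lambda>v. g (Complex x2 v))"
  shows "(\<integral>v. g (Complex x2 v) \<partial>lborel) = (\<integral>v. g (Complex x1 v) \<partial>lborel) + 2 * pi * residue g p"
proof -
  have cont: "continuous_on ({z. y1 < Re z \<and> Re z < y2} - {p}) g"
    using holo by (rule holomorphic_on_imp_continuous_on)
  \<comment> \<open>The sign \<open>s\<close> treats the upper and the lower edge at once.\<close>
  have edge: "(\<lambda>k. contour_integral (linepath (Complex x1 (s * real k)) (Complex x2 (s * real k))) g) \<longlonglongrightarrow> 0"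
    if s: "\<bar>s\<bar> = 1" for s
  proof (rule Lim_null_comparison)
    show "(\<lambda>k. C * exp (- (real k)\<^sup>2) * (x2 - x1)) \<longlonglongrightarrow> 0"
      by real_asymp
    obtain K :: nat where K: "1 + \<bar>Im p\<bar> \<le> real K" using real_arch_simple by blast
    show "\<forall>\<^sub>F k in sequentially.
       norm (contour_integral (linepath (Complex x1 (s * real k)) (Complex x2 (s * real k))) g)
        \<le> C * exp (- (real k)\<^sup>2) * (x2 - x1)"
      using eventually_ge_at_top[of K]
    proof eventually_elim
      fix k assume "K \<le> k"
      then have k: "1 + \<bar>Im p\<bar> \<le> real k" using K by linarith
      let ?a = "Complex x1 (s * real k)" and ?b = "Complex x2 (s * real k)"
      have seg: "x1 \<le> Re z \<and> Re z \<le> x2 \<and> Im z = s * real k" if "z \<in> closed_segment ?a ?b" for z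
        using that x by (subst (asm) closed_segment_same_Im) (auto simp: closed_segment_eq_real_ivl)
      have sq: "(s * real k)\<^sup>2 = (real k)\<^sup>2" using s by (metis abs_mult abs_of_nat mult_1 power2_abs)
      have ab: "\<bar>s * real k\<bar> = real k" using s by (simp add: abs_mult)
      have B: "norm (g z) \<le> C * exp (- (real k)\<^sup>2)" if "z \<in> closed_segment ?a ?b" for z
        using bound[of z] seg[OF that] k ab sq by auto
      have "norm (contour_integral (linepath ?a ?b) g) \<le> (C * exp (- (real k)\<^sup>2)) * norm (?b - ?a)"
      proof (rule contour_integral_bound_linepath)
        show "g contour_integrable_on linepath ?a ?b"
          using seg x k ab
          by (intro contour_integrable_continuous_linepath continuous_on_subset[OF cont]) force
        show "0 \<le> C * exp (- (real k)\<^sup>2)"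
          using B[of ?a] norm_ge_zero order_trans by (metis ends_in_segment(1))
      qed (use B in auto)
      also have "norm (?b - ?a) = x2 - x1"
        using x by (simp add: cmod_def)
      finally show "norm (contour_integral (linepath ?a ?b) g) \<le> C * exp (- (real k)\<^sup>2) * (x2 - x1)" .
    qed
  qed
  let ?E = "\<lambda>k. 2 * pi * \<i> * residue g p
      + contour_integral (linepath (Complex x1 (1 * real k)) (Complex x2 (1 * real k))) g
      - contour_integral (linepath (Complex x1 (- 1 * real k)) (Complex x2 (- 1 * real k))) g"
  have lim1: "?E \<longlonglongrightarrow> 2 * pi * \<i> * residue g p + 0 - 0"
    by (intro tendsto_intros edge) auto
  have "(\<lambda>k. \<i> * integral {- real k..real k} (\<lambda>v. g (Complex x2 v)) - \<i> * integral {- real k..real k} (\<lambda>v. g (Complex x1 v)))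
      \<longlonglongrightarrow> \<i> * (\<integral>v. g (Complex x2 v) \<partial>lborel) - \<i> * (\<integral>v. g (Complex x1 v) \<partial>lborel)"
    by (intro tendsto_intros tendsto_integral_symmetric int1 int2)
  moreover have "\<forall>\<^sub>F k in sequentially. \<i> * integral {- real k..real k} (\<lambda>v. g (Complex x2 v)) - \<i> * integral {- real k..real k} (\<lambda>v. g (Complex x1 v)) = ?E k"
  proof -
    obtain K :: nat where K: "\<bar>Im p\<bar> < real K" using reals_Archimedean2 by blast
    show ?thesis using eventually_ge_at_top[of K]
      by eventually_elim (use rectangle_residue[OF x _ holo] K in auto)
  qed
  ultimately have "?E \<longlonglongrightarrow> \<i> * (\<integral>v. g (Complex x2 v) \<partial>lborel) - \<i> * (\<integral>v. g (Complex x1 v) \<partial>lborel)"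
    using tendsto_cong by force
  from LIMSEQ_unique[OF this lim1]
  have "\<i> * ((\<integral>v. g (Complex x2 v) \<partial>lborel) - (\<integral>v. g (Complex x1 v) \<partial>lborel) - 2 * pi * residue g p) = 0"
    by (simp add: algebra_simps)
  then show ?thesis by (simp only: mult_eq_0_iff) (simp add: algebra_simps)
qed

section \<open>Elementary bounds for sine, logarithm and powers\<close>

text \<open>In this form the square is a sum of two nonnegative parts, so either coordinate alone
  yields a lower bound for the sine.\<close>

lemma norm_sin_squared_sinh: "(norm (sin z))\<^sup>2 = (sin (Re z))\<^sup>2 + (sinh (Im z))\<^sup>2" for z :: complex
proof -
  have "(sinh (Im z))\<^sup>2 = (exp (2 * Im z) + inverse (exp (2 * Im z)) - 2) / 4"
    by (simp add: sinh_field_def exp_minus exp_double power2_eq_square divide_simps) algebra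
  moreover have "(sin (Re z))\<^sup>2 = (1 - cos (2 * Re z)) / 2"
    by (simp add: cos_double_sin)
  ultimately show ?thesis using norm_sin_squared[of z]
    by (simp only: add_divide_distrib diff_divide_distrib)
qed

lemma norm_sin_ge_Im: "\<bar>Im z\<bar> \<le> norm (sin z)" for z :: complex
proof -
  have "(sinh (Im z))\<^sup>2 \<le> (norm (sin z))\<^sup>2"
    unfolding norm_sin_squared_sinh by simp
  then have "\<bar>sinh (Im z)\<bar> \<le> norm (sin z)" by (rule abs_le_square_iff[THEN iffD2, of _ "norm (sin z)", simplified])
  moreover have "\<bar>Im z\<bar> \<le> \<bar>sinh (Im z)\<bar>" using real_le_abs_sinh[of "Im z"] by (simp add: sinh_field_def exp_minus)
  ultimately show ?thesis by linarith
qed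

lemma norm_sin_pi_ge_1:
  assumes "1 / 2 \<le> \<bar>Im x\<bar>"
  shows "1 \<le> norm (sin (of_real pi * x))"
proof -
  have "1 \<le> \<bar>Im (of_real pi * x)\<bar>"
    using assms pi_gt3 mult_mono[of 2 pi "1 / 2" "\<bar>Im x\<bar>"] by (simp add: abs_mult)
  then show ?thesis using norm_sin_ge_Im order_trans by blast
qed

text \<open>Jordan's inequality: by concavity on [0, pi] the sine lies above its chord from 0 to pi
  / 2.\<close>

lemma sin_pi_half_mult_ge:
  assumes "0 \<le> x" "x \<le> 1"
  shows "x \<le> sin (pi / 2 * x)"
proof -
  have "convex_on {0..pi} (\<lambda>x. - sin x :: real)"
  proof (rule f''_ge0_imp_convex[where f' = "\<lambda>x. - cos x" and f'' = sin])
    show "0 \<le> sin x" if "x \<in> {0..pi}" for x using that by (auto intro: sin_ge_zero)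
  qed (auto intro!: derivative_eq_intros)
  then have "- sin ((1 - x) *\<^sub>R 0 + x *\<^sub>R (pi / 2)) \<le> (1 - x) * (- sin 0) + x * (- sin (pi / 2))"
    using assms by (intro convex_onD) auto
  then show ?thesis by (simp add: mult.commute)
qed

text \<open>Deliberately crude: it makes a power grow at most exponentially along a line that stays
  away from 0, and the Gaussian factor absorbs any such growth.\<close>

lemma norm_ln_le:
  fixes x :: complex
  assumes "x \<noteq> 0"
  shows "norm (ln x) \<le> pi + norm x + 1 / norm x"
proof -
  have "ln (norm x) \<le> norm x" "- ln (norm x) \<le> 1 / norm x"
    using assms ln_le_minus_one[of "norm x"] ln_le_minus_one[of "1 / norm x"]
    by (auto simp: ln_div)
  then have "\<bar>ln (norm x)\<bar> \<le> norm x + 1 / norm x"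
    by (smt (verit) norm_ge_zero zero_le_divide_1_iff)
  moreover have "\<bar>Im (ln x)\<bar> \<le> pi"
    using mpi_less_Im_Ln[OF assms] Im_Ln_le_pi[OF assms] by linarith
  moreover have "norm (ln x) \<le> \<bar>Re (ln x)\<bar> + \<bar>Im (ln x)\<bar>" by (rule cmod_le)
  ultimately show ?thesis using assms by simp
qed

lemma norm_powr_le_exp:
  fixes x w :: complex
  assumes "x \<noteq> 0"
  shows "norm (x powr w) \<le> exp (norm w * (pi + norm x + 1 / norm x))"
proof -
  have "norm w * norm (ln x) \<le> norm w * (pi + norm x + 1 / norm x)"
    using norm_ln_le[OF assms] by (intro mult_left_mono) auto
  moreover have "norm (x powr w) \<le> exp (norm (w * ln x))"
    using assms complex_Re_le_cmod[of "w * ln x"] by (simp add: powr_def del: Re_Ln times_complex.sel)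
  ultimately show ?thesis by (simp add: norm_mult) (meson exp_le_cancel_iff order_trans)
qed

section \<open>Lines of direction 1 + \<i>\<close>

text \<open>\<open>Re x - Im x\<close> tells on which of the parallel lines \<open>x\<close> lies,
  and \<open>Im x\<close> where on it; strips between two lines are therefore described by
  \<open>Re x - Im x\<close>. Since dx = (1 + \<i>) dv, contour integrals carry an extra factor 1 +
  \<i>.\<close>

definition slant :: "real \<Rightarrow> real \<Rightarrow> complex" where
  "slant a v = of_real a + of_real v * (1 + \<i>)"

lemma Re_slant [simp]: "Re (slant a v) = a + v" and Im_slant [simp]: "Im (slant a v) = v"
  by (simp_all add: slant_def)

lemma continuous_on_slant [continuous_intros]:
  "continuous_on S f \<Longrightarrow> continuous_on S (\<lambda>v. slant a (f v))"
  unfolding slant_def by (intro continuous_intros)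

text \<open>Near the real axis continuity alone bounds \<open>f\<close>. A pointwise bound is asked
  for only where 1 / sin is at most 1 on every line alike.\<close>

lemma integrable_tail_bound:
  fixes f :: "real \<Rightarrow> complex"
  assumes cont: "continuous_on UNIV f"
    and tail: "\<And>v. \<bar>v\<bar> \<ge> 1 / 2 \<Longrightarrow> norm (f v) \<le> C * exp (- 2 * v\<^sup>2)"
  shows "integrable lborel f"
proof -
  have "compact (f ` {-1..1})"
    using cont by (intro compact_continuous_image) (auto intro: continuous_on_subset)
  then obtain M where M: "\<And>v. v \<in> {-1..1} \<Longrightarrow> norm (f v) \<le> M"
    using compact_imp_bounded bounded_iff by (metis imageI)
  have M0: "M \<ge> 0" using order_trans[OF norm_ge_zero M[of 0]] by simp
  have "0 \<le> C * exp (- 2 * 1\<^sup>2)"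
    using tail[of 1] by (intro order_trans[OF norm_ge_zero]) auto
  then have C0: "C \<ge> 0" by (simp add: zero_le_mult_iff)
  show ?thesis
  proof (rule integrable_gaussian_bound)
    show "f \<in> borel_measurable borel" using cont by (rule borel_measurable_continuous_onI)
    fix v :: real
    show "norm (f v) \<le> (C + M * exp 1) * exp (- v\<^sup>2)"
    proof (cases "\<bar>v\<bar> \<le> 1")
      case True
      then have "v\<^sup>2 \<le> 1" by (metis abs_le_square_iff abs_one one_power2)
      then have "M * 1 \<le> M * (exp 1 * exp (- v\<^sup>2))"
        using M0 by (intro mult_left_mono) (auto simp flip: exp_add)
      then have "norm (f v) \<le> M * exp 1 * exp (- v\<^sup>2)" using M[of v] True by (simp add: mult.assoc abs_le_iff)
      also have "\<dots> \<le> (C + M * exp 1) * exp (- v\<^sup>2)" using C0 by (simp add: distrib_right)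
      finally show ?thesis .
    next
      case False
      then have "norm (f v) \<le> C * exp (- 2 * v\<^sup>2)" by (intro tail) auto
      also have "\<dots> \<le> (C + M * exp 1) * exp (- v\<^sup>2)"
        using C0 M0 by (intro mult_mono) auto
      finally show ?thesis .
    qed
  qed
qed

lemma integrable_slant:
  assumes holo: "f holomorphic_on S" and sub: "\<And>v. slant a v \<in> S"
    and bound: "\<And>x. Re x - Im x = a \<Longrightarrow> 1 / 2 \<le> \<bar>Im x\<bar> \<Longrightarrow> norm (f x) \<le> C * exp (- 2 * (Im x)\<^sup>2)"
  shows "integrable lborel (\<lambda>v. f (slant a v))"
proof (rule integrable_tail_bound[where C = C])
  have "continuous_on S f" using holo by (rule holomorphic_on_imp_continuous_on)
  then show "continuous_on UNIV (\<lambda>v. f (slant a v))"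
    by (rule continuous_on_compose2) (use sub in \<open>auto intro!: continuous_intros\<close>)
  show "norm (f (slant a v)) \<le> C * exp (- 2 * v\<^sup>2)" if "1 / 2 \<le> \<bar>v\<bar>" for v
    using bound[of "slant a v"] that by simp
qed

text \<open>In the coordinate \<open>z = x / (1 - \<i>)\<close> the slanted line through \<open>a\<close> becomes the vertical
  line \<open>Re z = a / 2\<close>.\<close>

lemma slant_conv_vertical: "(1 - \<i>) * Complex (a / 2) t = slant a (t - a / 2)"
  by (simp add: complex_eq_iff)

lemma integral_slant_conv_vertical:
  "(\<integral>v. f (slant a v) \<partial>lborel) = (\<integral>t. f ((1 - \<i>) * Complex (a / 2) t) \<partial>lborel)"
  for f :: "complex \<Rightarrow> complex"
  using lborel_integral_real_affine[of 1 "\<lambda>v. f (slant a v)" "- a / 2"]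
  by (simp add: slant_conv_vertical add.commute[of "- (a / 2)"])

lemma integrable_slant_conv_vertical:
  "integrable lborel (\<lambda>v. f (slant a v)) \<longleftrightarrow> integrable lborel (\<lambda>t. f ((1 - \<i>) * Complex (a / 2) t))"
  for f :: "complex \<Rightarrow> complex"
  using lborel_integrable_real_affine_iff[of 1 "\<lambda>v. f (slant a v)" "- a / 2"]
  by (simp add: slant_conv_vertical add.commute[of "- (a / 2)"])

text \<open>The residue is left in the rotated coordinate, where the lines are vertical and
  \<open>vertical_line_integral_shift\<close> applies; the pole \<open>c\<close> sits there at c (1
  + \<i>) / 2.\<close>

lemma slant_shift_aux:
  fixes c y1 y2 a1 a2 :: real
  assumes y: "y1 < a1" "a1 < c" "c < a2" "a2 < y2" and c0: "c \<ge> 0" "- 1 \<le> a1"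
    and holo: "f holomorphic_on {x. y1 < Re x - Im x \<and> Re x - Im x < y2} - {of_real c}"
    and bound: "\<And>x. a1 \<le> Re x - Im x \<Longrightarrow> Re x - Im x \<le> a2 \<Longrightarrow> 1 / 2 \<le> \<bar>Im x\<bar> \<Longrightarrow> norm (f x) \<le> C * exp (- 2 * (Im x)\<^sup>2)"
    and a: "a2 - c \<le> 1"
  shows "(\<integral>v. f (slant a2 v) \<partial>lborel) = (\<integral>v. f (slant a1 v) \<partial>lborel)
     + 2 * pi * residue (\<lambda>z. f ((1 - \<i>) * z)) (of_real (c / 2) * (1 + \<i>))"
proof -
  define p where "p = of_real (c / 2) * (1 + \<i>)"
  define S where "S = {x. y1 < Re x - Im x \<and> Re x - Im x < y2} - {of_real c}"
  have Rp: "Re p = c / 2" "Im p = c / 2" by (auto simp: p_def)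
  have pc: "(1 - \<i>) * p = of_real c" by (simp add: p_def complex_eq_iff)
  have Re2: "Re ((1 - \<i>) * z) - Im ((1 - \<i>) * z) = 2 * Re z" for z by simp
  have int: "integrable lborel (\<lambda>v. f (slant a v))" if "a = a1 \<or> a = a2" for a
  proof (rule integrable_slant)
    show "f holomorphic_on S" using holo by (simp add: S_def)
    show "slant a v \<in> S" for v
      using that y by (auto simp: S_def complex_eq_iff)
    show "norm (f x) \<le> C * exp (- 2 * (Im x)\<^sup>2)" if "Re x - Im x = a" "1 / 2 \<le> \<bar>Im x\<bar>" for x
      using that \<open>a = a1 \<or> a = a2\<close> y by (intro bound) auto
  qed
  have "0 \<le> C * exp (- 2 * (Im (slant a1 1))\<^sup>2)"
    using bound[of "slant a1 1"] y by (intro order_trans[OF norm_ge_zero]) auto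
  then have C0: "C \<ge> 0"
    by (simp add: zero_le_mult_iff)
  define A where "A = \<bar>a1\<bar> + \<bar>a2\<bar>"
  have "(\<integral>v. f ((1 - \<i>) * Complex (a2 / 2) v) \<partial>lborel) = (\<integral>v. f ((1 - \<i>) * Complex (a1 / 2) v) \<partial>lborel)
      + 2 * pi * residue (\<lambda>z. f ((1 - \<i>) * z)) p"
  proof (rule vertical_line_integral_shift[where C = "C * exp (2 * A\<^sup>2)"])
    have "f \<circ> (\<lambda>z. (1 - \<i>) * z) holomorphic_on {z. y1 / 2 < Re z \<and> Re z < y2 / 2} - {p}"
    proof (rule holomorphic_on_compose_gen)
      show "f holomorphic_on S" using holo by (simp add: S_def)
      show "(*) (1 - \<i>) ` ({z. y1 / 2 < Re z \<and> Re z < y2 / 2} - {p}) \<subseteq> S"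
      proof
        fix x assume "x \<in> (*) (1 - \<i>) ` ({z. y1 / 2 < Re z \<and> Re z < y2 / 2} - {p})"
        then obtain z where z: "x = (1 - \<i>) * z" "y1 / 2 < Re z" "Re z < y2 / 2" "z \<noteq> p" by auto
        have "(1 - \<i>) \<noteq> 0" by (simp add: complex_eq_iff)
        then have "x \<noteq> of_real c" using z(1,4) pc by (metis mult_left_cancel)
        then show "x \<in> S" using z Re2[of z] unfolding S_def by auto
      qed
    qed (auto intro!: holomorphic_intros)
    then show "(\<lambda>z. f ((1 - \<i>) * z)) holomorphic_on {z. y1 / 2 < Re z \<and> Re z < y2 / 2} - {p}"
      by (simp add: o_def)
  next
    fix z assume z: "a1 / 2 \<le> Re z" "Re z \<le> a2 / 2" "1 + \<bar>Im p\<bar> \<le> \<bar>Im z\<bar>"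
    define v where "v = Im ((1 - \<i>) * z)"
    have v: "v = Im z - Re z" by (simp add: v_def)
    \<comment> \<open>As Im p = c / 2 and Re z lies in [a1 / 2, a2 / 2], a height of at least 1 + c
      / 2 leaves a distance of 1 / 2 between Im z and Re z: upwards by a2 - c \<le> 1, downwards by
      a1 \<ge> -1.\<close>
    have "1 / 2 \<le> \<bar>v\<bar>"
      using z y a c0 unfolding v Rp by linarith
    then have "norm (f ((1 - \<i>) * z)) \<le> C * exp (- 2 * v\<^sup>2)"
      unfolding v_def using z Re2[of z] by (intro bound) auto
    also have "\<dots> \<le> C * (exp (2 * A\<^sup>2) * exp (- (Im z)\<^sup>2))"
    proof -
      have "Im z = v + Re z" by (simp add: v)
      \<comment> \<open>Passing from \<open>v\<close> to \<open>Im z\<close> halves the exponent,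
        which is why the decay is assumed with the factor 2.\<close>
      then have "(Im z)\<^sup>2 \<le> 2 * v\<^sup>2 + 2 * (Re z)\<^sup>2"
        using sum_squares_bound[of v "Re z"] by (simp add: power2_eq_square algebra_simps)
      moreover have "(Re z)\<^sup>2 \<le> A\<^sup>2"
        using z by (intro abs_le_square_iff[THEN iffD1]) (auto simp: A_def)
      ultimately show ?thesis using C0 by (intro mult_left_mono) (auto simp flip: exp_add)
    qed
    finally show "norm (f ((1 - \<i>) * z)) \<le> C * exp (2 * A\<^sup>2) * exp (- (Im z)\<^sup>2)" by (simp add: mult.assoc)
  qed (use y int Rp in \<open>auto simp flip: integrable_slant_conv_vertical\<close>)
  then show ?thesis by (simp add: integral_slant_conv_vertical p_def)
qed

text \<open>An artificial puncture at the midpoint brings the situation under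
  \<open>slant_shift_aux\<close>; the residue there is 0.\<close>

lemma slant_shift_holomorphic:
  assumes y: "y1 < a1" "a1 < a2" "a2 < y2" "0 \<le> a1" "a2 \<le> a1 + 1"
    and holo: "f holomorphic_on {x. y1 < Re x - Im x \<and> Re x - Im x < y2}"
    and bound: "\<And>x. a1 \<le> Re x - Im x \<Longrightarrow> Re x - Im x \<le> a2 \<Longrightarrow> 1 / 2 \<le> \<bar>Im x\<bar> \<Longrightarrow> norm (f x) \<le> C * exp (- 2 * (Im x)\<^sup>2)"
  shows "(\<integral>v. f (slant a2 v) \<partial>lborel) = (\<integral>v. f (slant a1 v) \<partial>lborel)"
proof -
  define S where "S = {x. y1 < Re x - Im x \<and> Re x - Im x < y2}"
  define c where "c = (a1 + a2) / 2"
  define p where "p = of_real (c / 2) * (1 + \<i>)"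
  have "residue (\<lambda>z. f ((1 - \<i>) * z)) p = 0"
  proof (rule residue_holo)
    have "{z. y1 / 2 < Re z \<and> Re z < y2 / 2} = {z. y1 / 2 < Re z} \<inter> {z. Re z < y2 / 2}" by auto
    then show "open {z. y1 / 2 < Re z \<and> Re z < y2 / 2}"
      by (metis open_Int open_halfspace_Re_gt open_halfspace_Re_lt)
    have "f \<circ> (\<lambda>z. (1 - \<i>) * z) holomorphic_on {z. y1 / 2 < Re z \<and> Re z < y2 / 2}"
      by (rule holomorphic_on_compose_gen[OF _ holo]) (auto intro!: holomorphic_intros)
    then show "(\<lambda>z. f ((1 - \<i>) * z)) holomorphic_on {z. y1 / 2 < Re z \<and> Re z < y2 / 2}"
      by (simp add: o_def)
    show "p \<in> {z. y1 / 2 < Re z \<and> Re z < y2 / 2}" using y by (auto simp: p_def c_def)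
  qed
  moreover have "(\<integral>v. f (slant a2 v) \<partial>lborel) = (\<integral>v. f (slant a1 v) \<partial>lborel)
     + 2 * pi * residue (\<lambda>z. f ((1 - \<i>) * z)) (of_real (c / 2) * (1 + \<i>))"
    using y holo bound
    by (intro slant_shift_aux[of y1 a1 c a2 y2 f C])
       (auto simp: c_def field_simps intro: holomorphic_on_subset)
  ultimately show ?thesis by (simp add: p_def)
qed

section \<open>Crossing a pole of 1 / sin\<close>

lemma sin_slant_nonzero:
  fixes x :: complex
  assumes "real n - 1 < Re x - Im x" "Re x - Im x < real n + 1" "x \<noteq> of_nat n"
  shows "sin (of_real pi * x) \<noteq> 0"
proof
  assume "sin (of_real pi * x) = 0"
  then obtain k :: int where "of_real pi * x = of_real (of_int k * pi)"
    by (auto simp: sin_eq_0)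
  then have "of_real pi * x = of_real pi * of_int k" by (simp add: mult.commute)
  then have x: "x = of_int k" by (subst (asm) mult_left_cancel) auto
  then have "real n - 1 < of_int k" "of_int k < real n + 1" using assms by auto
  then have "k = int n" by linarith
  then show False using assms x by simp
qed

text \<open>The residue of 1 / sin (pi x) at \<open>n\<close> is (-1)^n / pi. The rotated coordinate
  divides it by 1 - \<i>, and 2 / (1 - \<i>) = 1 + \<i>.\<close>

lemma slant_shift_sin:
  assumes holo: "h holomorphic_on {x. real n - 1 < Re x - Im x \<and> Re x - Im x < real n + 1}"
    and bound: "\<And>x. real n - 1 / 2 \<le> Re x - Im x \<Longrightarrow> Re x - Im x \<le> real n + 1 / 2 \<Longrightarrow> 1 / 2 \<le> \<bar>Im x\<bar>
       \<Longrightarrow> norm (h x) \<le> C * exp (- 2 * (Im x)\<^sup>2)"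
  shows "(\<integral>v. h (slant (real n + 1 / 2) v) / sin (of_real pi * slant (real n + 1 / 2) v) \<partial>lborel)
       = (\<integral>v. h (slant (real n - 1 / 2) v) / sin (of_real pi * slant (real n - 1 / 2) v) \<partial>lborel)
         + (1 + \<i>) * (- 1) ^ n * h (of_nat n)"
proof -
  define f where "f = (\<lambda>x. h x / sin (of_real pi * x))"
  define S where "S = {x. real n - 1 < Re x - Im x \<and> Re x - Im x < real n + 1}"
  define p :: complex where "p = of_real (real n / 2) * (1 + \<i>)"
  define U where "U = {z. (real n - 1) / 2 < Re z \<and> Re z < (real n + 1) / 2}"
  have "U = {z. (real n - 1) / 2 < Re z} \<inter> {z. Re z < (real n + 1) / 2}" by (auto simp: U_def)
  then have opU: "open U" by (metis open_Int open_halfspace_Re_gt open_halfspace_Re_lt)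
  have pU: "p \<in> U" by (auto simp: p_def U_def)
  have pn: "(1 - \<i>) * p = of_nat n" by (simp add: p_def complex_eq_iff)
  have i0: "(1 - \<i>) \<noteq> 0" by (simp add: complex_eq_iff)
  have fS: "f holomorphic_on S - {of_real (real n)}"
    unfolding f_def
  proof (rule holomorphic_on_divide)
    show "h holomorphic_on S - {of_real (real n)}"
      by (rule holomorphic_on_subset[OF holo]) (auto simp: S_def)
  qed (use sin_slant_nonzero in \<open>auto simp: S_def intro!: holomorphic_intros\<close>)
  have hU: "(\<lambda>z. h ((1 - \<i>) * z)) holomorphic_on U"
  proof -
    have "h \<circ> (\<lambda>z. (1 - \<i>) * z) holomorphic_on U"
      by (rule holomorphic_on_compose_gen[OF _ holo]) (auto intro!: holomorphic_intros simp: U_def)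
    then show ?thesis by (simp add: o_def)
  qed
  have "residue (\<lambda>z. f ((1 - \<i>) * z)) p = h (of_nat n) * (1 / ((1 - \<i>) * pi * (- 1) ^ n))"
  proof (rule residue_simple'[OF opU pU])
    have "f \<circ> (\<lambda>z. (1 - \<i>) * z) holomorphic_on U - {p}"
    proof (rule holomorphic_on_compose_gen[OF _ fS])
      show "(*) (1 - \<i>) ` (U - {p}) \<subseteq> S - {of_real (real n)}"
      proof
        fix x assume "x \<in> (*) (1 - \<i>) ` (U - {p})"
        then obtain z where z: "x = (1 - \<i>) * z" "z \<in> U" "z \<noteq> p" by auto
        then have "x \<noteq> of_nat n" using i0 pn by (metis mult_left_cancel)
        then show "x \<in> S - {of_real (real n)}" using z unfolding S_def U_def by auto
      qed
    qed (auto intro!: holomorphic_intros)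
    then show "(\<lambda>z. f ((1 - \<i>) * z)) holomorphic_on U - {p}" by (simp add: o_def)
    have "isCont (\<lambda>z. h ((1 - \<i>) * z)) p"
      using hU opU pU by (meson continuous_on_eq_continuous_at holomorphic_on_imp_continuous_on)
    then have l1: "(\<lambda>z. h ((1 - \<i>) * z)) \<midarrow>p\<rightarrow> h (of_nat n)"
      using pn by (simp add: isCont_def)
    have s0: "sin (of_real pi * ((1 - \<i>) * p)) = 0"
      unfolding pn by (metis mult.commute of_real_mult of_real_of_nat_eq sin_npi2 sin_of_real of_real_0)
    have cn: "cos (of_real pi * ((1 - \<i>) * p)) = (- 1) ^ n"
      unfolding pn by (metis cos_npi2 cos_of_real of_real_1 of_real_minus of_real_mult of_real_of_nat_eq of_real_power)
    have "((\<lambda>z. sin (of_real pi * ((1 - \<i>) * z))) has_field_derivative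
        cos (of_real pi * ((1 - \<i>) * p)) * (of_real pi * (1 - \<i>))) (at p)"
      by (auto intro!: derivative_eq_intros)
    then have "(\<lambda>z. sin (of_real pi * ((1 - \<i>) * z)) / (z - p)) \<midarrow>p\<rightarrow> (1 - \<i>) * pi * (- 1) ^ n"
      unfolding has_field_derivative_iff s0 cn by (simp add: mult_ac)
    then have "(\<lambda>z. 1 / (sin (of_real pi * ((1 - \<i>) * z)) / (z - p))) \<midarrow>p\<rightarrow> 1 / ((1 - \<i>) * pi * (- 1) ^ n)"
      using i0 by (intro tendsto_intros) auto
    from tendsto_mult[OF l1 this]
    show "(\<lambda>z. f ((1 - \<i>) * z) * (z - p)) \<midarrow>p\<rightarrow> h (of_nat n) * (1 / ((1 - \<i>) * pi * (- 1) ^ n))"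
      by (simp add: f_def)
  qed
  moreover have "(\<integral>v. f (slant (real n + 1 / 2) v) \<partial>lborel) = (\<integral>v. f (slant (real n - 1 / 2) v) \<partial>lborel)
     + 2 * pi * residue (\<lambda>z. f ((1 - \<i>) * z)) (of_real (real n / 2) * (1 + \<i>))"
  proof (rule slant_shift_aux)
    show "f holomorphic_on {x. real n - 1 < Re x - Im x \<and> Re x - Im x < real n + 1} - {complex_of_real (real n)}"
      using fS by (simp add: S_def)
    fix x assume x: "real n - 1 / 2 \<le> Re x - Im x" "Re x - Im x \<le> real n + 1 / 2" "1 / 2 \<le> \<bar>Im x\<bar>"
    have "1 \<le> norm (sin (of_real pi * x))" using x(3) by (rule norm_sin_pi_ge_1)
    then have "norm (f x) \<le> norm (h x)"
      unfolding f_def norm_divide by (metis div_by_1 frac_le norm_ge_zero order_refl zero_less_one)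
    also have "\<dots> \<le> C * exp (- 2 * (Im x)\<^sup>2)" using x by (rule bound)
    finally show "norm (f x) \<le> C * exp (- 2 * (Im x)\<^sup>2)" .
  qed auto
  moreover have "2 * pi * (h (of_nat n) * (1 / ((1 - \<i>) * pi * (- 1) ^ n))) = (1 + \<i>) * (- 1) ^ n * h (of_nat n)"
  proof -
    have "1 / (1 - \<i>) = (1 + \<i>) / 2" by (simp add: complex_eq_iff Re_divide Im_divide)
    moreover have "1 / (- 1 :: complex) ^ n = (- 1) ^ n" by (cases "even n") auto
    moreover have "2 * pi * (h (of_nat n) * (1 / ((1 - \<i>) * pi * (- 1) ^ n)))
        = 2 * (1 / (1 - \<i>)) * (1 / (- 1) ^ n) * h (of_nat n)"
      by simp
    ultimately show ?thesis by simp
  qed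
  ultimately show ?thesis by (simp add: f_def p_def)
qed

section \<open>Riemann's integral and the Mordell integral\<close>

lemma norm_exp_pi_i_square:
  "norm (exp (\<i> * of_real pi * x\<^sup>2)) = exp (- 2 * pi * (Re x - Im x) * Im x - 2 * pi * (Im x)\<^sup>2)"
  by (simp add: power2_eq_square algebra_simps)

text \<open>Of the 2 pi v^2 \<ge> 6 v^2 in the exponent, 2 v^2 are kept and 4 v^2 absorb the linear
  terms of slope \<open>2 * pi * A + M\<close>. The factor
  \<open>exp (M * (1 + \<bar>Im x\<bar>))\<close> stands for the power or exponential that
  accompanies the Gaussian.\<close>

lemma gaussian_kernel_bound:
  assumes "0 \<le> Re x - Im x" "Re x - Im x \<le> A" "0 \<le> M"
  shows "exp (M * (1 + \<bar>Im x\<bar>)) * norm (exp (\<i> * of_real pi * x\<^sup>2))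
     \<le> exp (M + (2 * pi * A + M)\<^sup>2) * exp (- 2 * (Im x)\<^sup>2)"
proof -
  define v where "v = Im x"
  define K where "K = 2 * pi * A + M"
  have "- ((Re x - Im x) * v) \<le> A * \<bar>v\<bar>"
    using assms mult_mono[of "Re x - Im x" A "\<bar>v\<bar>" "\<bar>v\<bar>"]
    by (smt (verit) abs_ge_zero minus_mult_right mult_left_mono)
  then have "2 * pi * (- ((Re x - Im x) * v)) \<le> 2 * pi * (A * \<bar>v\<bar>)"
    by (intro mult_left_mono) auto
  moreover have "6 * v\<^sup>2 \<le> 2 * pi * v\<^sup>2" using pi_gt3 by (intro mult_right_mono) auto
  moreover have "K * \<bar>v\<bar> - 4 * v\<^sup>2 \<le> K\<^sup>2"
  proof -
    have "0 \<le> (K / 2 - \<bar>v\<bar>)\<^sup>2" by simp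
    then have "K * \<bar>v\<bar> - v\<^sup>2 \<le> K\<^sup>2 / 4" by (simp add: power2_eq_square algebra_simps)
    moreover have "K\<^sup>2 / 4 \<le> K\<^sup>2" "0 \<le> v\<^sup>2" by auto
    ultimately show ?thesis by linarith
  qed
  ultimately have "M * (1 + \<bar>v\<bar>) + (- 2 * pi * (Re x - Im x) * v - 2 * pi * v\<^sup>2) \<le> M + K\<^sup>2 + - 2 * v\<^sup>2"
    by (simp add: K_def algebra_simps)
  then show ?thesis unfolding norm_exp_pi_i_square
    by (simp add: v_def K_def flip: exp_add)
qed

lemma norm_le_slant: "norm x \<le> \<bar>Re x - Im x\<bar> + 2 * \<bar>Im x\<bar>" for x :: complex
  using cmod_le[of x] by linarith

lemma norm_powr_slant_bound:
  assumes "0 \<le> Re x - Im x" "Re x - Im x \<le> A" "1 / 2 \<le> \<bar>Im x\<bar>"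
  shows "norm (x powr w) \<le> exp (norm w * (pi + A + 2) * (1 + \<bar>Im x\<bar>))"
proof -
  have x0: "x \<noteq> 0" using assms by auto
  have "1 / 2 \<le> norm x" using assms abs_Im_le_cmod[of x] by linarith
  then have "1 / norm x \<le> 2" using x0 by (simp add: divide_le_eq mult.commute)
  then have "pi + norm x + 1 / norm x \<le> pi + A + 2 + 2 * \<bar>Im x\<bar>"
    using norm_le_slant[of x] assms by linarith
  also have "\<dots> \<le> (pi + A + 2) * (1 + \<bar>Im x\<bar>)"
    using assms mult_right_mono[of 2 "pi + A + 2" "\<bar>Im x\<bar>"] pi_gt_zero by (simp add: algebra_simps)
  finally have "norm w * (pi + norm x + 1 / norm x) \<le> norm w * ((pi + A + 2) * (1 + \<bar>Im x\<bar>))"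
    by (intro mult_left_mono) auto
  then show ?thesis
    using norm_powr_le_exp[OF x0, of w] by (simp add: mult.assoc) (meson exp_le_cancel_iff order_trans)
qed

text \<open>Riemann's integral of x^(-w) exp (\<i> pi x^2) / (exp (\<i> pi x) - exp (- \<i> pi x)),
  whose denominator is 2 \<i> sin (pi x). The function R of the overview is
  \<open>- rs_line (1 / 2)\<close>.\<close>

definition rs_line :: "real \<Rightarrow> complex \<Rightarrow> complex" where
  "rs_line a w = (1 + \<i>) * (\<integral>v. slant a v powr (- w) * exp (\<i> * of_real pi * (slant a v)\<^sup>2) / (2 * \<i>)
      / sin (of_real pi * slant a v) \<partial>lborel)"

lemma slant_not_nonpos: "0 < Re x - Im x \<Longrightarrow> x \<notin> \<real>\<^sub>\<le>\<^sub>0"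
  by (auto simp: complex_nonpos_Reals_iff)

lemma exp_pi_i_square_nat: "exp (\<i> * of_real pi * (of_nat n)\<^sup>2) = (- 1) ^ n"
proof -
  have "exp (\<i> * of_real pi * (of_nat n)\<^sup>2) = exp (of_nat (n\<^sup>2) * (\<i> * of_real pi))"
    by (simp add: mult_ac)
  also have "\<dots> = (- 1) ^ (n\<^sup>2)" unfolding exp_of_nat_mult by simp
  also have "\<dots> = (- 1) ^ n" by (cases "even n") auto
  finally show ?thesis .
qed

lemma rs_kernel_bound:
  assumes "0 \<le> A"
  obtains C where "\<And>x. 0 \<le> Re x - Im x \<Longrightarrow> Re x - Im x \<le> A \<Longrightarrow> 1 / 2 \<le> \<bar>Im x\<bar>
    \<Longrightarrow> norm (x powr w * exp (\<i> * of_real pi * x\<^sup>2)) \<le> C * exp (- 2 * (Im x)\<^sup>2)"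
proof
  define M where "M = norm w * (pi + A + 2)"
  have M: "0 \<le> M" using assms pi_gt_zero by (simp add: M_def)
  fix x :: complex assume x: "0 \<le> Re x - Im x" "Re x - Im x \<le> A" "1 / 2 \<le> \<bar>Im x\<bar>"
  have "norm (x powr w * exp (\<i> * of_real pi * x\<^sup>2)) \<le> exp (M * (1 + \<bar>Im x\<bar>)) * norm (exp (\<i> * of_real pi * x\<^sup>2))"
    unfolding norm_mult M_def using norm_powr_slant_bound[OF x, of w] by (intro mult_right_mono) auto
  also have "\<dots> \<le> exp (M + (2 * pi * A + M)\<^sup>2) * exp (- 2 * (Im x)\<^sup>2)"
    using x M by (intro gaussian_kernel_bound) auto
  finally show "norm (x powr w * exp (\<i> * of_real pi * x\<^sup>2)) \<le> exp (M + (2 * pi * A + M)\<^sup>2) * exp (- 2 * (Im x)\<^sup>2)" .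
qed

text \<open>The sign (-1)^n of the residue of 1 / sin meets exp (\<i> pi n^2) = (-1)^n, so a pole
  contributes a term of the Dirichlet series without a sign.\<close>

lemma rs_line_Suc:
  assumes "n \<ge> 1"
  shows "rs_line (real n + 1 / 2) w = rs_line (real n - 1 / 2) w + of_nat n powr (- w)"
proof -
  define h where "h = (\<lambda>x::complex. x powr (- w) * exp (\<i> * of_real pi * x\<^sup>2) / (2 * \<i>))"
  obtain C where C: "\<And>x. 0 \<le> Re x - Im x \<Longrightarrow> Re x - Im x \<le> real n + 1 \<Longrightarrow> 1 / 2 \<le> \<bar>Im x\<bar>
    \<Longrightarrow> norm (x powr (- w) * exp (\<i> * of_real pi * x\<^sup>2)) \<le> C * exp (- 2 * (Im x)\<^sup>2)"
    using rs_kernel_bound[of "real n + 1" "- w"] by auto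
  have "(\<integral>v. h (slant (real n + 1 / 2) v) / sin (of_real pi * slant (real n + 1 / 2) v) \<partial>lborel)
       = (\<integral>v. h (slant (real n - 1 / 2) v) / sin (of_real pi * slant (real n - 1 / 2) v) \<partial>lborel)
         + (1 + \<i>) * (- 1) ^ n * h (of_nat n)"
  proof (rule slant_shift_sin[where C = "C / 2"])
    show "h holomorphic_on {x. real n - 1 < Re x - Im x \<and> Re x - Im x < real n + 1}"
      unfolding h_def using assms slant_not_nonpos
      by (intro holomorphic_intros) auto
    show "norm (h x) \<le> C / 2 * exp (- 2 * (Im x)\<^sup>2)"
      if "real n - 1 / 2 \<le> Re x - Im x" "Re x - Im x \<le> real n + 1 / 2" "1 / 2 \<le> \<bar>Im x\<bar>" for x
      using C[of x] that assms by (simp add: h_def norm_divide norm_mult)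
  qed
  moreover have "(1 + \<i>) * ((1 + \<i>) * (- 1) ^ n * h (of_nat n)) = of_nat n powr (- w)"
  proof -
    have "(1 + \<i>) * (1 + \<i>) = 2 * \<i>" by (simp add: complex_eq_iff)
    moreover have "(- 1) ^ n * (- 1) ^ n = (1 :: complex)" by (simp flip: power_mult_distrib)
    moreover have "(1 + \<i>) * ((1 + \<i>) * (- 1) ^ n * h (of_nat n))
       = ((1 + \<i>) * (1 + \<i>)) * ((- 1) ^ n * (- 1) ^ n) * of_nat n powr (- w) / (2 * \<i>)"
      by (simp add: h_def exp_pi_i_square_nat)
    ultimately show ?thesis by simp
  qed
  ultimately show ?thesis
    unfolding rs_line_def h_def by (simp add: ring_distribs)
qed

lemma rs_line_half_conv:
  "- rs_line (1 / 2) w = (\<Sum>n = 1..N. of_nat n powr (- w)) - rs_line (real N + 1 / 2) w"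
proof (induction N)
  case (Suc N)
  show ?case using rs_line_Suc[of "Suc N" w] Suc by (simp add: algebra_simps)
qed simp

section \<open>Gaussian and Mordell integrals in closed form\<close>

text \<open>The substitution v = p / (4 pi) + x / (2 sqrt pi) completes the square for the real part
  of \<open>\<beta>\<close> and turns the rest into the characteristic function of the standard
  normal distribution at q / (2 sqrt pi).\<close>

lemma integral_complex_gaussian:
  fixes \<beta> :: complex
  shows "(\<integral>v. exp (- 2 * of_real (pi * v\<^sup>2) + \<beta> * of_real v) \<partial>lborel) = exp (\<beta>\<^sup>2 / (8 * of_real pi)) / of_real (sqrt 2)"
proof -
  define p q where "p = Re \<beta>" and "q = Im \<beta>"
  define t where "t = q / (2 * sqrt pi)"
  have sp: "sqrt pi * sqrt pi = pi" "sqrt pi > 0" by auto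
  have "of_real (exp (- (t\<^sup>2) / 2)) = char std_normal_distribution t"
    by (simp add: char_std_normal_distribution)
  also have "\<dots> = (\<integral>x. std_normal_density x *\<^sub>R iexp (t * x) \<partial>lborel)"
    unfolding char_def by (subst integral_density) auto
  also have "\<dots> = (\<integral>x. of_real (1 / sqrt (2 * pi)) * (exp (of_real (- x\<^sup>2 / 2)) * iexp (t * x)) \<partial>lborel)"
    by (intro Bochner_Integration.integral_cong refl)
       (simp add: std_normal_density_def scaleR_conv_of_real flip: exp_of_real)
  also have "\<dots> = of_real (1 / sqrt (2 * pi)) * (\<integral>x. exp (of_real (- x\<^sup>2 / 2)) * iexp (t * x) \<partial>lborel)"
    by (rule integral_mult_right_zero)
  finally have char: "(\<integral>x. exp (of_real (- x\<^sup>2 / 2)) * iexp (t * x) \<partial>lborel) = of_real (sqrt (2 * pi)) * of_real (exp (- (t\<^sup>2) / 2))"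
    by (simp add: field_simps)
  have "(\<integral>v. exp (- 2 * of_real (pi * v\<^sup>2) + \<beta> * of_real v) \<partial>lborel) =
      (1 / (2 * sqrt pi)) *\<^sub>R (\<integral>x. exp (- 2 * of_real (pi * (p / (4 * pi) + 1 / (2 * sqrt pi) * x)\<^sup>2)
         + \<beta> * of_real (p / (4 * pi) + 1 / (2 * sqrt pi) * x)) \<partial>lborel)"
    using sp by (subst lborel_integral_real_affine[of "1 / (2 * sqrt pi)" _ "p / (4 * pi)"]) auto
  also have "(\<lambda>x::real. exp (- 2 * of_real (pi * (p / (4 * pi) + 1 / (2 * sqrt pi) * x)\<^sup>2)
         + \<beta> * of_real (p / (4 * pi) + 1 / (2 * sqrt pi) * x)))
      = (\<lambda>x. exp (of_real (p\<^sup>2 / (8 * pi)) + \<i> * of_real (q * p / (4 * pi))) * (exp (of_real (- x\<^sup>2 / 2)) * iexp (t * x)))"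
  proof (rule ext)
    fix x :: real
    have "\<beta> = Complex p q" by (simp add: p_def q_def)
    then have "- 2 * of_real (pi * (p / (4 * pi) + 1 / (2 * sqrt pi) * x)\<^sup>2)
         + \<beta> * of_real (p / (4 * pi) + 1 / (2 * sqrt pi) * x)
        = (of_real (p\<^sup>2 / (8 * pi)) + \<i> * of_real (q * p / (4 * pi))) + (of_real (- x\<^sup>2 / 2) + \<i> * of_real (t * x))"
    proof -
      have quad: "r\<^sup>2 * (p / (4 * r\<^sup>2) + 1 / (2 * r) * x)\<^sup>2 = p\<^sup>2 / (16 * r\<^sup>2) + p * x / (4 * r) + x\<^sup>2 / 4"
        if "r > 0" for r :: real
        using that by (simp add: field_simps power2_eq_square)
      have "pi * (p / (4 * pi) + 1 / (2 * sqrt pi) * x)\<^sup>2 = p\<^sup>2 / (16 * pi) + p * x / (4 * sqrt pi) + x\<^sup>2 / 4"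
        using quad[of "sqrt pi"] by simp
      then show ?thesis
        using \<open>\<beta> = Complex p q\<close> sp
        by (simp only:) (simp add: complex_eq_iff t_def power2_eq_square field_simps)
    qed
    then show "exp (- 2 * of_real (pi * (p / (4 * pi) + 1 / (2 * sqrt pi) * x)\<^sup>2)
         + \<beta> * of_real (p / (4 * pi) + 1 / (2 * sqrt pi) * x))
       = exp (of_real (p\<^sup>2 / (8 * pi)) + \<i> * of_real (q * p / (4 * pi))) * (exp (of_real (- x\<^sup>2 / 2)) * iexp (t * x))"
      by (simp only: exp_add)
  qed
  also have "(\<integral>x. exp (of_real (p\<^sup>2 / (8 * pi)) + \<i> * of_real (q * p / (4 * pi))) * (exp (of_real (- x\<^sup>2 / 2)) * iexp (t * x)) \<partial>lborel)
     = exp (of_real (p\<^sup>2 / (8 * pi)) + \<i> * of_real (q * p / (4 * pi))) * (of_real (sqrt (2 * pi)) * of_real (exp (- (t\<^sup>2) / 2)))"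
    unfolding char[symmetric] by (rule integral_mult_right_zero)
  also have "(1 / (2 * sqrt pi)) *\<^sub>R \<dots> = exp (of_real (p\<^sup>2 / (8 * pi)) + \<i> * of_real (q * p / (4 * pi)) + of_real (- (t\<^sup>2) / 2)) / of_real (sqrt 2)"
  proof -
    have "1 / (2 * sqrt pi) * sqrt (2 * pi) = 1 / sqrt 2"
      using sp by (simp add: real_sqrt_mult field_simps)
    then have sq: "complex_of_real (1 / (2 * sqrt pi)) * of_real (sqrt (2 * pi)) = 1 / of_real (sqrt 2)"
      by (metis of_real_1 of_real_divide of_real_mult)
    have comm: "c1 * (e * (c2 * d)) = (c1 * c2) * (e * d)" for c1 c2 d e :: complex by simp
    show ?thesis unfolding scaleR_conv_of_real exp_add exp_of_real comm sq by simp
  qed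
  also have "of_real (p\<^sup>2 / (8 * pi)) + \<i> * of_real (q * p / (4 * pi)) + of_real (- (t\<^sup>2) / 2) = \<beta>\<^sup>2 / (8 * of_real pi)"
  proof -
    have "t\<^sup>2 = q\<^sup>2 / (4 * pi)" using sp by (simp add: t_def power_divide power_mult_distrib)
    moreover have "\<beta> = Complex p q" by (simp add: p_def q_def)
    ultimately show ?thesis by (simp add: complex_eq_iff power2_eq_square field_simps Re_divide Im_divide)
  qed
  finally show ?thesis .
qed

text \<open>The integrand is entire, so the value cannot depend on \<open>a\<close>; here this comes
  out of the computation. The constant exp (\<i> pi / 4) = (1 + \<i>) / sqrt 2 is the normalised
  direction of the line.\<close>

lemma integral_gaussian_slant:
  "(1 + \<i>) * (\<integral>v. exp (\<i> * of_real pi * (slant a v)\<^sup>2 + 2 * of_real pi * \<i> * b * slant a v) \<partial>lborel)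
     = exp (\<i> * of_real pi * (1 / 4 - b\<^sup>2))"
proof -
  define \<beta> where "\<beta> = 2 * of_real pi * \<i> * (1 + \<i>) * (of_real a + b)"
  define \<gamma> where "\<gamma> = \<i> * of_real pi * (of_real a)\<^sup>2 + 2 * of_real pi * \<i> * of_real a * b"
  have i2: "(1 + \<i>)\<^sup>2 = 2 * \<i>" by (simp add: complex_eq_iff power2_eq_square)
  have "\<i> * of_real pi * (slant a v)\<^sup>2 + 2 * of_real pi * \<i> * b * slant a v
      = \<gamma> + (- 2 * of_real (pi * v\<^sup>2) + \<beta> * of_real v)" for v
  proof -
    have "\<i> * of_real pi * (slant a v)\<^sup>2 = \<i> * of_real pi * (of_real a)\<^sup>2
       + 2 * of_real pi * \<i> * (1 + \<i>) * of_real a * of_real v + \<i> * of_real pi * (of_real v)\<^sup>2 * (1 + \<i>)\<^sup>2"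
      by (simp add: slant_def power2_eq_square algebra_simps)
    then show ?thesis unfolding i2
      by (simp add: \<gamma>_def \<beta>_def slant_def algebra_simps)
  qed
  then have "(\<integral>v. exp (\<i> * of_real pi * (slant a v)\<^sup>2 + 2 * of_real pi * \<i> * b * slant a v) \<partial>lborel)
     = (\<integral>v. exp \<gamma> * exp (- 2 * of_real (pi * v\<^sup>2) + \<beta> * of_real v) \<partial>lborel)"
    by (simp add: exp_add)
  also have "\<dots> = exp \<gamma> * (exp (\<beta>\<^sup>2 / (8 * of_real pi)) / of_real (sqrt 2))"
    by (subst integral_mult_right_zero, subst integral_complex_gaussian) simp
  also have "\<dots> = exp (\<gamma> + \<beta>\<^sup>2 / (8 * of_real pi)) / of_real (sqrt 2)"
    by (simp add: exp_add)
  also have "\<gamma> + \<beta>\<^sup>2 / (8 * of_real pi) = - \<i> * of_real pi * b\<^sup>2"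
  proof -
    have "\<beta>\<^sup>2 = 4 * (of_real pi)\<^sup>2 * \<i>\<^sup>2 * (1 + \<i>)\<^sup>2 * (of_real a + b)\<^sup>2"
      unfolding \<beta>_def by (simp add: power_mult_distrib)
    then have "\<beta>\<^sup>2 = - 8 * \<i> * of_real pi * of_real pi * (of_real a + b)\<^sup>2"
      unfolding i2 by (simp add: power2_eq_square)
    then have "\<beta>\<^sup>2 / (8 * of_real pi) = - \<i> * of_real pi * (of_real a + b)\<^sup>2"
      by simp
    then show ?thesis by (simp add: \<gamma>_def power2_eq_square algebra_simps)
  qed
  also have "(1 + \<i>) * (exp (- \<i> * of_real pi * b\<^sup>2) / of_real (sqrt 2)) = exp (\<i> * of_real pi * (1 / 4 - b\<^sup>2))"
  proof -
    have "exp (\<i> * of_real (pi / 4)) = (1 + \<i>) / of_real (sqrt 2)"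
    proof -
      have "cis (pi / 4) = (1 + \<i>) / of_real (sqrt 2)"
        by (simp add: complex_eq_iff cos_45 sin_45 field_simps)
      then show ?thesis by (simp only: cis_conv_exp)
    qed
    moreover have "\<i> * of_real pi * (1 / 4 - b\<^sup>2) = \<i> * of_real (pi / 4) + - \<i> * of_real pi * b\<^sup>2"
      by (simp add: algebra_simps)
    ultimately show ?thesis by (simp only: exp_add) simp
  qed
  finally show ?thesis .
qed

lemma exp_linear_slant_bound:
  assumes "0 \<le> Re x - Im x" "Re x - Im x \<le> A"
  shows "norm (exp (c * x)) \<le> exp (norm c * (A + 2) * (1 + \<bar>Im x\<bar>))"
proof -
  have "norm (exp (c * x)) \<le> exp (norm (c * x))" by (rule norm_exp)
  moreover have "norm x \<le> (A + 2) * (1 + \<bar>Im x\<bar>)"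
  proof -
    have "0 \<le> A * \<bar>Im x\<bar>" using assms by (intro mult_nonneg_nonneg) auto
    then have "(A + 2) * (1 + \<bar>Im x\<bar>) \<ge> A + 2 * \<bar>Im x\<bar>" by (simp add: algebra_simps)
    then show ?thesis using norm_le_slant[of x] assms by linarith
  qed
  then have "norm (c * x) \<le> norm c * (A + 2) * (1 + \<bar>Im x\<bar>)"
    by (simp add: norm_mult mult_left_mono mult.assoc)
  ultimately show ?thesis by (meson exp_le_cancel_iff order_trans)
qed

lemma mordell_kernel_bound:
  assumes "0 \<le> A"
  obtains C where "\<And>x. 0 \<le> Re x - Im x \<Longrightarrow> Re x - Im x \<le> A
    \<Longrightarrow> norm (exp (\<i> * of_real pi * x\<^sup>2 + c * x)) \<le> C * exp (- 2 * (Im x)\<^sup>2)"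
proof
  define M where "M = norm c * (A + 2)"
  have M: "0 \<le> M" using assms by (simp add: M_def)
  fix x :: complex assume x: "0 \<le> Re x - Im x" "Re x - Im x \<le> A"
  have "norm (exp (\<i> * of_real pi * x\<^sup>2 + c * x)) = norm (exp (c * x)) * norm (exp (\<i> * of_real pi * x\<^sup>2))"
    by (metis exp_add mult.commute norm_mult)
  also have "\<dots> \<le> exp (M * (1 + \<bar>Im x\<bar>)) * norm (exp (\<i> * of_real pi * x\<^sup>2))"
    unfolding M_def using exp_linear_slant_bound[OF x, of c] by (intro mult_right_mono) auto
  also have "\<dots> \<le> exp (M + (2 * pi * A + M)\<^sup>2) * exp (- 2 * (Im x)\<^sup>2)"
    using x M by (intro gaussian_kernel_bound) auto
  finally show "norm (exp (\<i> * of_real pi * x\<^sup>2 + c * x)) \<le> exp (M + (2 * pi * A + M)\<^sup>2) * exp (- 2 * (Im x)\<^sup>2)" .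
qed

lemma norm_sin_half_line:
  "1 \<le> norm (sin (of_real pi * slant (real n + 1 / 2) v))"
proof -
  have "sin (pi * (real n + 1 / 2 + v)) = cos (pi * real n + pi * v)"
    using sin_add[of "pi * real n + pi * v" "pi / 2"] by (simp add: algebra_simps)
  also have "\<dots> = (- 1) ^ n * cos (pi * v)"
    by (simp add: cos_add mult.commute)
  finally have s: "(sin (pi * (real n + 1 / 2 + v)))\<^sup>2 = (cos (pi * v))\<^sup>2"
    by (simp add: power_mult_distrib flip: power_mult)
  have "(sin (pi * v))\<^sup>2 \<le> (pi * v)\<^sup>2"
    by (metis abs_le_square_iff abs_sin_le_one abs_sin_x_le_abs_x)
  also have "\<dots> \<le> (sinh (pi * v))\<^sup>2"
    using real_le_abs_sinh[of "pi * v"] by (intro abs_le_square_iff[THEN iffD1]) (simp add: sinh_field_def exp_minus)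
  finally have "1 \<le> (cos (pi * v))\<^sup>2 + (sinh (pi * v))\<^sup>2"
    using sin_cos_squared_add[of "pi * v"] by linarith
  then have "1\<^sup>2 \<le> (norm (sin (of_real pi * slant (real n + 1 / 2) v)))\<^sup>2"
    unfolding norm_sin_squared_sinh by (simp add: s)
  then show ?thesis by (rule power2_le_imp_le) auto
qed

text \<open>The integral over the line through 3 / 2 is computed twice. Crossing the pole at 1 gives
  \<open>P + e\<close>; translating by 1 gives \<open>e\<close> times the sum of \<open>P\<close>
  and a pure Gaussian integral. The linear equation for \<open>P\<close> is left undivided because
  \<open>e\<close> may be 1.\<close>

lemma mordell_integral:
  fixes u :: complex
  defines "P \<equiv> (1 + \<i>) * (\<integral>v. exp (\<i> * of_real pi * (slant (1 / 2) v)\<^sup>2 - 2 * of_real pi * \<i> * u * slant (1 / 2) v) / (2 * \<i>)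
      / sin (of_real pi * slant (1 / 2) v) \<partial>lborel)"
  shows "P * (exp (- 2 * of_real pi * \<i> * u) - 1)
     = exp (- 2 * of_real pi * \<i> * u) * (1 - exp (\<i> * of_real pi * (u - u\<^sup>2)))"
proof -
  define E where "E = (\<lambda>x::complex. exp (\<i> * of_real pi * x\<^sup>2 + (- 2 * of_real pi * \<i> * u) * x))"
  define h where "h = (\<lambda>x. E x / (2 * \<i>))"
  define f where "f = (\<lambda>x. h x / sin (of_real pi * x))"
  define e where "e = exp (- 2 * of_real pi * \<i> * u)"
  define F where "F = (\<lambda>x. exp (\<i> * of_real pi * x) * E x)"
  have P: "P = (1 + \<i>) * (\<integral>v. f (slant (1 / 2) v) \<partial>lborel)"
    by (simp add: P_def f_def h_def E_def)
  obtain C where C: "\<And>x. 0 \<le> Re x - Im x \<Longrightarrow> Re x - Im x \<le> 2 \<Longrightarrow> norm (E x) \<le> C * exp (- 2 * (Im x)\<^sup>2)"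
    using mordell_kernel_bound[of 2 "- 2 * of_real pi * \<i> * u"] unfolding E_def by auto
  have hb: "norm (h x) \<le> C / 2 * exp (- 2 * (Im x)\<^sup>2)" if "0 \<le> Re x - Im x" "Re x - Im x \<le> 2" for x
    using C[OF that] by (simp add: h_def norm_divide norm_mult)
  have shift: "(\<integral>v. f (slant (real 1 + 1 / 2) v) \<partial>lborel) = (\<integral>v. f (slant (real 1 - 1 / 2) v) \<partial>lborel)
         + (1 + \<i>) * (- 1) ^ 1 * h (of_nat 1)"
    unfolding f_def
  proof (rule slant_shift_sin[where C = "C / 2"])
    show "h holomorphic_on {x. real 1 - 1 < Re x - Im x \<and> Re x - Im x < real 1 + 1}"
      unfolding h_def E_def by (intro holomorphic_intros) auto
  qed (use hb in auto)
  have E1: "E 1 = - e"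
    unfolding E_def e_def by (simp only: exp_add mult_1_right one_power2) simp
  have i2: "(1 + \<i>) * (1 + \<i>) = 2 * \<i>" by (simp add: complex_eq_iff)
  have sh: "(1 + \<i>) * (\<integral>v. f (slant (3 / 2) v) \<partial>lborel) = P + e"
  proof -
    have "(1 + \<i>) * (\<integral>v. f (slant (3 / 2) v) \<partial>lborel) = P + ((1 + \<i>) * (1 + \<i>)) * (- (h 1))"
    proof -
      have "(\<integral>v. f (slant (3 / 2) v) \<partial>lborel) = (\<integral>v. f (slant (1 / 2) v) \<partial>lborel) + (1 + \<i>) * (- (h 1))"
        using shift by (simp add: algebra_simps)
      moreover have "a * (S + a * t) = a * S + (a * a) * t" for a S t :: complex
        by (simp add: algebra_simps)
      ultimately show ?thesis unfolding P by (simp only:)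
    qed
    also have "((1 + \<i>) * (1 + \<i>)) * (- (h 1)) = e"
      unfolding i2 h_def E1 by simp
    finally show ?thesis .
  qed
  \<comment> \<open>Translation multiplies \<open>E\<close> by - e exp (2 pi \<i> x) and changes the
    sign of the sine. Since exp (2 pi \<i> x) - 1 = 2 \<i> sin (pi x) exp (\<i> pi x), the excess
    over \<open>e * f\<close> has no denominator left.\<close>
  have step: "f (slant (3 / 2) v) = e * (f (slant (1 / 2) v) + F (slant (1 / 2) v))" for v
  proof -
    define x where "x = slant (1 / 2) v"
    have x1: "slant (3 / 2) v = x + 1" by (simp add: x_def slant_def)
    have sn: "sin (of_real pi * x) \<noteq> 0"
      using norm_sin_half_line[of 0 v] by (auto simp: x_def)
    define s where "s = sin (of_real pi * x)"
    have s1: "sin (of_real pi * (x + 1)) = - s"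
      by (simp add: s_def distrib_left sin_add)
    have ei: "exp (\<i> * of_real pi) = - 1" by simp
    have "E (x + 1) = exp ((\<i> * of_real pi * x\<^sup>2 + (- 2 * of_real pi * \<i> * u) * x) + (\<i> * of_real pi * x + \<i> * of_real pi * x) + \<i> * of_real pi + (- 2 * of_real pi * \<i> * u))"
      unfolding E_def by (rule arg_cong[of _ _ exp]) (simp add: power2_eq_square algebra_simps)
    also have "\<dots> = - (E x * (exp (\<i> * of_real pi * x) * exp (\<i> * of_real pi * x)) * e)"
      unfolding exp_add ei E_def e_def by simp
    finally have E: "E (x + 1) = - (E x * (exp (\<i> * of_real pi * x) * exp (\<i> * of_real pi * x)) * e)" .
    have "s = (exp (\<i> * of_real pi * x) - exp (- (\<i> * of_real pi * x))) / (2 * \<i>)"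
      unfolding s_def sin_exp_eq by (simp add: mult.assoc)
    then have "2 * \<i> * s * exp (\<i> * of_real pi * x) = exp (\<i> * of_real pi * x) * exp (\<i> * of_real pi * x) - 1"
      by (simp add: field_simps exp_minus)
    then have sq: "exp (\<i> * of_real pi * x) * exp (\<i> * of_real pi * x) = 1 + 2 * \<i> * s * exp (\<i> * of_real pi * x)"
      by (simp add: algebra_simps)
    have "f (x + 1) = e * (f x + F x)"
    proof -
      have s0: "s \<noteq> 0" using sn by (simp add: s_def)
      have fx: "f (x + 1) = E (x + 1) / (2 * \<i>) / (- s)" "f x = E x / (2 * \<i>) / s"
        unfolding f_def h_def s1 s_def by (rule refl)+
      show ?thesis unfolding fx E sq F_def using s0 by (simp add: field_simps)
    qed
    then show ?thesis unfolding x1 x_def .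
  qed
  have intf: "integrable lborel (\<lambda>v. f (slant (1 / 2) v))"
  proof (rule integrable_slant[where C = "C / 2" and S = "{x. sin (of_real pi * x) \<noteq> 0}"])
    show "f holomorphic_on {x. sin (of_real pi * x) \<noteq> 0}"
      unfolding f_def h_def E_def by (intro holomorphic_intros) auto
    show "slant (1 / 2) v \<in> {x. sin (of_real pi * x) \<noteq> 0}" for v
      using norm_sin_half_line[of 0 v] by auto
    fix x assume x: "Re x - Im x = 1 / 2" "1 / 2 \<le> \<bar>Im x\<bar>"
    have "norm (f x) \<le> norm (h x)"
      unfolding f_def norm_divide using norm_sin_pi_ge_1[OF x(2)]
      by (metis div_by_1 frac_le norm_ge_zero order_refl zero_less_one)
    also have "\<dots> \<le> C / 2 * exp (- 2 * (Im x)\<^sup>2)" using x by (intro hb) auto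
    finally show "norm (f x) \<le> C / 2 * exp (- 2 * (Im x)\<^sup>2)" .
  qed
  have F: "F x = exp (\<i> * of_real pi * x\<^sup>2 + 2 * of_real pi * \<i> * (1 / 2 - u) * x)" for x
    unfolding F_def E_def exp_add[symmetric] by (rule arg_cong[of _ _ exp]) (simp add: algebra_simps)
  obtain C' where C': "\<And>x. 0 \<le> Re x - Im x \<Longrightarrow> Re x - Im x \<le> 2 \<Longrightarrow> norm (F x) \<le> C' * exp (- 2 * (Im x)\<^sup>2)"
    using mordell_kernel_bound[of 2 "2 * of_real pi * \<i> * (1 / 2 - u)"] unfolding F by auto
  have intF: "integrable lborel (\<lambda>v. F (slant (1 / 2) v))"
    by (rule integrable_slant[where C = C' and S = UNIV])
       (use C' in \<open>auto simp: F_def E_def intro!: holomorphic_intros\<close>)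
  have "P + e = e * (P + (1 + \<i>) * (\<integral>v. F (slant (1 / 2) v) \<partial>lborel))"
  proof -
    have "P + e = (1 + \<i>) * (\<integral>v. e * (f (slant (1 / 2) v) + F (slant (1 / 2) v)) \<partial>lborel)"
      unfolding sh[symmetric] step by (rule refl)
    also have "\<dots> = (1 + \<i>) * (e * ((\<integral>v. f (slant (1 / 2) v) \<partial>lborel) + (\<integral>v. F (slant (1 / 2) v) \<partial>lborel)))"
      using intf intF by simp
    finally show ?thesis unfolding P by (simp only: distrib_left mult.left_commute)
  qed
  also have "(1 + \<i>) * (\<integral>v. F (slant (1 / 2) v) \<partial>lborel) = exp (\<i> * of_real pi * (1 / 4 - (1 / 2 - u)\<^sup>2))"
    unfolding F by (rule integral_gaussian_slant)
  also have "1 / 4 - (1 / 2 - u)\<^sup>2 = u - u\<^sup>2"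
    by (simp add: power2_eq_square algebra_simps)
  finally show ?thesis unfolding e_def[symmetric] by (simp add: algebra_simps)
qed

section \<open>Mellin transforms\<close>

lemma norm_exp_minus_1_minus_le: "norm (exp z - 1 - z) \<le> exp (norm z) * (norm z)\<^sup>2" for z :: complex
  using Taylor_exp_field[of z 1] by (simp add: power2_eq_square algebra_simps)

lemma square_le_exp: "x\<^sup>2 \<le> 2 * exp x" if "0 \<le> x" for x :: real
  using exp_lower_Taylor_quadratic[OF that] that by simp

text \<open>The margin exp (d \<bar>L\<bar>) in the hypothesis dominates both the derivative under
  the integral and the second-order remainder of the exponential, so the error of the difference
  quotient is O(\<bar>h\<bar>). It will be used with a logarithm for \<open>L\<close>, where the
  integral is of Mellin type, and with \<open>L\<close> linear, where it is a Laplace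
  transform.\<close>

proposition holomorphic_on_exp_integral:
  fixes L k :: "real \<Rightarrow> complex"
  assumes [measurable]: "L \<in> borel_measurable borel" "k \<in> borel_measurable borel"
    and U: "open U"
    and int: "\<And>w. w \<in> U \<Longrightarrow> \<exists>d>0. integrable lborel (\<lambda>v. exp (d * norm (L v)) * norm (exp (w * L v) * k v))"
  shows "(\<lambda>w. \<integral>v. exp (w * L v) * k v \<partial>lborel) holomorphic_on U"
proof -
  define F where "F = (\<lambda>w. \<integral>v. exp (w * L v) * k v \<partial>lborel)"
  have intF: "integrable lborel (\<lambda>v. exp (w * L v) * k v)" if w: "w \<in> U" for w
  proof -
    obtain d where d: "d > 0" "integrable lborel (\<lambda>v. exp (d * norm (L v)) * norm (exp (w * L v) * k v))"
      using int[OF w] by auto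
    show ?thesis
    proof (rule Bochner_Integration.integrable_bound[OF d(2)])
      show "AE v in lborel. norm (exp (w * L v) * k v) \<le> norm (exp (d * norm (L v)) * norm (exp (w * L v) * k v))"
      proof (rule AE_I2)
        fix v
        have "1 * norm (exp (w * L v) * k v) \<le> exp (d * norm (L v)) * norm (exp (w * L v) * k v)"
          using d(1) by (intro mult_right_mono) auto
        then show "norm (exp (w * L v) * k v) \<le> norm (exp (d * norm (L v)) * norm (exp (w * L v) * k v))" by simp
      qed
    qed simp
  qed
  have "(F has_field_derivative (\<integral>v. L v * (exp (w * L v) * k v) \<partial>lborel)) (at w)" if w: "w \<in> U" for w
  proof -
    obtain d where d: "d > 0" "integrable lborel (\<lambda>v. exp (d * norm (L v)) * norm (exp (w * L v) * k v))"
      using int[OF w] by auto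
    define g where "g = (\<lambda>v. exp (d * norm (L v)) * norm (exp (w * L v) * k v))"
    define D where "D = (\<integral>v. L v * (exp (w * L v) * k v) \<partial>lborel)"
    \<comment> \<open>For \<bar>h\<bar> < d / 2 half of the margin bounds exp (\<bar>h L\<bar>); the
      other half bounds \<bar>L\<bar>^2 through (d a / 2)^2 \<le> 2 exp (d a / 2), which gives 8 /
      d^2.\<close>
    define K where "K = (8 / d\<^sup>2) * (\<integral>v. g v \<partial>lborel)"
    obtain e where e: "e > 0" "ball w e \<subseteq> U" using U w open_contains_ball by blast
    have poly: "norm (L v) * norm (exp (w * L v) * k v) \<le> (1 / d) * g v" for v
    proof -
      have "d * norm (L v) \<le> exp (d * norm (L v))"
        using exp_ge_add_one_self[of "d * norm (L v)"] by linarith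
      then have "norm (L v) \<le> (1 / d) * exp (d * norm (L v))" using d by (simp add: field_simps)
      then have "norm (L v) * norm (exp (w * L v) * k v) \<le> ((1 / d) * exp (d * norm (L v))) * norm (exp (w * L v) * k v)"
        by (rule mult_right_mono) simp
      then show ?thesis by (simp add: g_def)
    qed
    have intD: "integrable lborel (\<lambda>v. L v * (exp (w * L v) * k v))"
    proof (rule Bochner_Integration.integrable_bound)
      show "integrable lborel (\<lambda>v. (1 / d) * g v)" using d(2) by (simp add: g_def)
      show "AE v in lborel. norm (L v * (exp (w * L v) * k v)) \<le> norm ((1 / d) * g v)"
      proof (rule AE_I2)
        fix v
        show "norm (L v * (exp (w * L v) * k v)) \<le> norm ((1 / d) * g v)"
          unfolding norm_mult[of "L v"] using poly[of v] by (smt (verit) real_norm_def)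
      qed
    qed simp
    have bound: "norm ((F (w + h) - F w) / h - D) \<le> norm h * K" if h: "h \<noteq> 0" "norm h < e" "norm h < d / 2" for h
    proof -
      have wh: "w + h \<in> U" using e(2) h(2) by (auto simp: dist_norm)
      have "norm (F (w + h) - F w - h * D) = norm (\<integral>v. exp ((w + h) * L v) * k v - exp (w * L v) * k v - h * (L v * (exp (w * L v) * k v)) \<partial>lborel)"
        unfolding F_def D_def using intF[OF wh] intF[OF w] intD by simp
      also have "\<dots> \<le> (\<integral>v. norm (exp ((w + h) * L v) * k v - exp (w * L v) * k v - h * (L v * (exp (w * L v) * k v))) \<partial>lborel)"
        by (rule integral_norm_bound)
      also have "\<dots> \<le> (\<integral>v. (norm h)\<^sup>2 * (8 / d\<^sup>2) * g v \<partial>lborel)"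
      proof (rule integral_mono)
        fix v
        define a where "a = norm (L v)"
        have "norm (exp ((w + h) * L v) * k v - exp (w * L v) * k v - h * (L v * (exp (w * L v) * k v)))
            = norm ((exp (h * L v) - 1 - h * L v) * (exp (w * L v) * k v))"
          by (simp add: exp_add algebra_simps)
        also have "\<dots> \<le> (exp (norm (h * L v)) * (norm (h * L v))\<^sup>2) * norm (exp (w * L v) * k v)"
          unfolding norm_mult[of "exp (h * L v) - 1 - h * L v"]
          by (intro mult_right_mono norm_exp_minus_1_minus_le) auto
        also have "exp (norm (h * L v)) * (norm (h * L v))\<^sup>2 \<le> (norm h)\<^sup>2 * (8 / d\<^sup>2) * exp (d * a)"
        proof -
          have "norm h * a \<le> d / 2 * a" using h(3) by (intro mult_right_mono) (auto simp: a_def)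
          then have 1: "exp (norm (h * L v)) \<le> exp (d / 2 * a)" by (simp add: norm_mult a_def)
          have "(d / 2 * a)\<^sup>2 \<le> 2 * exp (d / 2 * a)" using d by (intro square_le_exp) (auto simp: a_def)
          then have "a\<^sup>2 \<le> 8 / d\<^sup>2 * exp (d / 2 * a)" using d by (simp add: field_simps power_mult_distrib)
          then have 2: "(norm (h * L v))\<^sup>2 \<le> (norm h)\<^sup>2 * (8 / d\<^sup>2 * exp (d / 2 * a))"
            unfolding norm_mult power_mult_distrib a_def by (intro mult_left_mono) auto
          have "exp (norm (h * L v)) * (norm (h * L v))\<^sup>2 \<le> exp (d / 2 * a) * ((norm h)\<^sup>2 * (8 / d\<^sup>2 * exp (d / 2 * a)))"
            by (intro mult_mono 1 2) auto
          also have "\<dots> = (norm h)\<^sup>2 * (8 / d\<^sup>2) * (exp (d / 2 * a) * exp (d / 2 * a))" by simp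
          also have "exp (d / 2 * a) * exp (d / 2 * a) = exp (d * a)" by (simp flip: exp_add)
          finally show ?thesis .
        qed
        finally show "norm (exp ((w + h) * L v) * k v - exp (w * L v) * k v - h * (L v * (exp (w * L v) * k v)))
            \<le> (norm h)\<^sup>2 * (8 / d\<^sup>2) * g v"
          by (simp add: g_def a_def mult_right_mono mult.assoc)
      qed (use intF[OF wh] intF[OF w] intD d in \<open>auto simp: g_def\<close>)
      also have "\<dots> = (norm h)\<^sup>2 * K" by (simp add: K_def)
      finally have "norm (F (w + h) - F w - h * D) / norm h \<le> (norm h)\<^sup>2 * K / norm h"
        by (intro divide_right_mono) auto
      then have "norm ((F (w + h) - F w - h * D) / h) \<le> norm h * K"
        using h(1) by (simp add: norm_divide power2_eq_square)
      moreover have "(F (w + h) - F w - h * D) / h = (F (w + h) - F w) / h - D"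
        using h(1) by (simp add: diff_divide_distrib)
      ultimately show ?thesis by simp
    qed
    have "((\<lambda>h. (F (w + h) - F w) / h - D) \<longlongrightarrow> 0) (at 0)"
    proof (rule Lim_null_comparison)
      show "((\<lambda>h. norm h * K) \<longlongrightarrow> 0) (at (0 :: complex))"
        by (auto intro!: tendsto_eq_intros)
      have "\<forall>\<^sub>F h in at (0 :: complex). h \<noteq> 0 \<and> norm h < min e (d / 2)"
        unfolding eventually_at using e d by (intro exI[of _ "min e (d / 2)"]) auto
      then show "\<forall>\<^sub>F h in at 0. norm ((F (w + h) - F w) / h - D) \<le> norm h * K"
        by eventually_elim (use bound in auto)
    qed
    then show ?thesis unfolding DERIV_def D_def[symmetric] LIM_zero_iff .
  qed
  then show ?thesis
    unfolding F_def[symmetric] holomorphic_on_open[OF U] by blast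
qed

lemma sin_slant_nonzero_half: "sin (of_real pi * slant (1 / 2) v) \<noteq> 0"
  using norm_sin_half_line[of 0 v] by auto

text \<open>Writing x^(-w) = exp (w (- ln x)) puts the line integral in the form of
  \<open>holomorphic_on_exp_integral\<close>; the line through 1 / 2 avoids the branch cut.\<close>

lemma rs_line_holomorphic: "rs_line (1 / 2) holomorphic_on UNIV"
proof -
  define L where "L = (\<lambda>v. - ln (slant (1 / 2) v))"
  define k where "k = (\<lambda>v. exp (\<i> * of_real pi * (slant (1 / 2) v)\<^sup>2) / (2 * \<i>) / sin (of_real pi * slant (1 / 2) v))"
  have sl: "slant (1 / 2) v \<notin> \<real>\<^sub>\<le>\<^sub>0" for v by (intro slant_not_nonpos) auto
  then have sl0: "slant (1 / 2) v \<noteq> 0" for v by (metis complex_nonpos_Reals_iff order_refl zero_complex.sel)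
  have contL: "continuous_on UNIV L"
    unfolding L_def using sl by (intro continuous_intros) auto
  have contk: "continuous_on UNIV k"
    unfolding k_def using sin_slant_nonzero_half by (intro continuous_intros) auto
  have "(\<lambda>w. (1 + \<i>) * (\<integral>v. exp (w * L v) * k v \<partial>lborel)) holomorphic_on UNIV"
  proof (intro holomorphic_on_mult holomorphic_on_const holomorphic_on_exp_integral)
    show "L \<in> borel_measurable borel" "k \<in> borel_measurable borel"
      using contL contk by (auto intro: borel_measurable_continuous_onI)
    fix w :: complex
    \<comment> \<open>The summand 1 pays for the margin \<open>d = 1\<close>, the other one for
      \<open>exp (w * L v)\<close>.\<close>
    define c where "c = 1 + norm w"
    define M where "M = c * (pi + 1 / 2 + 2)"
    have M: "0 \<le> M" using pi_gt_zero by (simp add: M_def c_def)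
    have "integrable lborel (\<lambda>v. of_real (exp (1 * norm (L v)) * norm (exp (w * L v) * k v)) :: complex)"
    proof (rule integrable_tail_bound)
      show "continuous_on UNIV (\<lambda>v. of_real (exp (1 * norm (L v)) * norm (exp (w * L v) * k v)) :: complex)"
        using contL contk by (intro continuous_intros)
      fix v :: real assume v: "1 / 2 \<le> \<bar>v\<bar>"
      define x where "x = slant (1 / 2) v"
      have x: "Re x - Im x = 1 / 2" "Im x = v" "x \<noteq> 0" using sl0 by (auto simp: x_def)
      have "1 / 2 \<le> norm x" using v x(2) abs_Im_le_cmod[of x] by linarith
      then have "1 / norm x \<le> 2" using x(3) by (simp add: divide_le_eq mult.commute)
      then have "norm (ln x) \<le> pi + 1 / 2 + 2 + 2 * \<bar>v\<bar>"
        using norm_ln_le[OF x(3)] norm_le_slant[of x] x by simp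
      also have "\<dots> \<le> (pi + 1 / 2 + 2) * (1 + \<bar>v\<bar>)"
        using mult_right_mono[of 2 "pi + 1 / 2 + 2" "\<bar>v\<bar>"] pi_gt_zero by (simp add: distrib_left)
      finally have "c * norm (ln x) \<le> c * ((pi + 1 / 2 + 2) * (1 + \<bar>v\<bar>))"
        by (intro mult_left_mono) (auto simp: c_def)
      then have "exp (c * norm (ln x)) \<le> exp (M * (1 + \<bar>v\<bar>))" by (simp add: M_def mult.assoc)
      moreover have "norm (exp (w * L v)) \<le> exp (norm w * norm (ln x))"
        using norm_exp[of "w * L v"] by (simp add: norm_mult L_def x_def)
      then have "exp (norm (L v)) * norm (exp (w * L v)) \<le> exp (norm (ln x)) * exp (norm w * norm (ln x))"
        by (simp add: L_def x_def)
      then have "exp (norm (L v)) * norm (exp (w * L v)) \<le> exp (c * norm (ln x))"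
        by (simp add: c_def distrib_right exp_add)
      ultimately have 1: "exp (norm (L v)) * norm (exp (w * L v)) \<le> exp (M * (1 + \<bar>v\<bar>))" by linarith
      have "norm (k v) \<le> norm (exp (\<i> * of_real pi * x\<^sup>2))"
      proof -
        have "1 \<le> norm (sin (of_real pi * x))" using norm_sin_half_line[of 0 v] by (simp add: x_def)
        then have "norm (exp (\<i> * of_real pi * x\<^sup>2)) / 2 / norm (sin (of_real pi * x)) \<le> norm (exp (\<i> * of_real pi * x\<^sup>2)) / 2 / 1"
          by (intro divide_left_mono) auto
        also have "\<dots> \<le> norm (exp (\<i> * of_real pi * x\<^sup>2))" by simp
        finally show ?thesis unfolding k_def x_def[symmetric] norm_divide norm_mult by simp
      qed
      then have "exp (norm (L v)) * norm (exp (w * L v)) * norm (k v) \<le> exp (M * (1 + \<bar>v\<bar>)) * norm (exp (\<i> * of_real pi * x\<^sup>2))"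
        using 1 by (intro mult_mono) auto
      also have "\<dots> \<le> exp (M + (2 * pi * (1 / 2) + M)\<^sup>2) * exp (- 2 * v\<^sup>2)"
        using gaussian_kernel_bound[of x "1 / 2" M] M x by simp
      finally show "norm (of_real (exp (1 * norm (L v)) * norm (exp (w * L v) * k v)) :: complex)
          \<le> exp (M + (2 * pi * (1 / 2) + M)\<^sup>2) * exp (- 2 * v\<^sup>2)"
        by (simp add: norm_mult mult.assoc)
    qed
    then have "integrable lborel (\<lambda>v. exp (1 * norm (L v)) * norm (exp (w * L v) * k v))"
      by (simp only: complex_of_real_integrable_eq)
    then show "\<exists>d>0. integrable lborel (\<lambda>v. exp (d * norm (L v)) * norm (exp (w * L v) * k v))"
      by (intro exI[of _ 1]) auto
  qed auto
  also have "(\<lambda>w. (1 + \<i>) * (\<integral>v. exp (w * L v) * k v \<partial>lborel)) = rs_line (1 / 2)"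
    unfolding rs_line_def L_def k_def using sl0 by (simp add: powr_def mult_ac)
  finally show ?thesis .
qed

section \<open>Gamma integrals with a complex parameter\<close>

lemma measurable_mellin_kernel [measurable]:
  "(\<lambda>r::real. indicator {0<..} r *\<^sub>R (of_real r powr s :: complex)) \<in> borel_measurable borel"
  by (rule borel_measurable_continuous_on_indicator) (auto intro!: continuous_intros)

lemma norm_mellin_kernel:
  "norm (indicator {0<..} r *\<^sub>R (of_real r powr s :: complex)) = indicator {0<..} r * r powr Re s"
  by (auto simp: indicator_def norm_powr_real_powr)

lemma integrable_mellin_exp:
  assumes "0 < Re s" "0 < a"
  shows "integrable lborel (\<lambda>r::real. indicator {0<..} r * r powr (Re s - 1) * exp (- a * r))"
proof -
  have "integrable lebesgue (\<lambda>r::real. indicator {0<..} r *\<^sub>R (complex_of_real r powr (s - 1) / of_real (exp (a * r))))"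
    using absolutely_integrable_Gamma_integral[OF assms] by (simp add: set_integrable_def)
  then have "integrable lborel (\<lambda>r::real. indicator {0<..} r *\<^sub>R (complex_of_real r powr (s - 1) / of_real (exp (a * r))))"
    by (subst (asm) integrable_completion)
       (auto intro!: borel_measurable_continuous_on_indicator continuous_intros)
  then have "integrable lborel (\<lambda>r::real. norm (indicator {0<..} r *\<^sub>R (complex_of_real r powr (s - 1) / of_real (exp (a * r)))))"
    by (rule integrable_norm)
  also have "(\<lambda>r::real. norm (indicator {0<..} r *\<^sub>R (complex_of_real r powr (s - 1) / of_real (exp (a * r)))))
     = (\<lambda>r::real. indicator {0<..} r * r powr (Re s - 1) * exp (- a * r))"
    by (auto simp: fun_eq_iff norm_divide norm_mult norm_powr_real_powr exp_minus indicator_def divide_inverse norm_inverse)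
  finally show ?thesis .
qed

lemma integral_mellin_exp_real:
  assumes "0 < Re s" "0 < a"
  shows "(\<integral>r. exp (of_real a * of_real (- r)) * (indicator {0<..} r *\<^sub>R (of_real r powr (s - 1))) \<partial>lborel)
     = Gamma s * of_real a powr (- s)"
proof -
  have int: "set_integrable lborel {0<..} (\<lambda>t. complex_of_real t powr (s - 1) / of_real (exp t))"
  proof -
    have "integrable lebesgue (\<lambda>r::real. indicator {0<..} r *\<^sub>R (complex_of_real r powr (s - 1) / of_real (exp r)))"
      using absolutely_integrable_Gamma_integral'[OF assms(1)] by (simp add: set_integrable_def)
    then show ?thesis unfolding set_integrable_def
      by (subst (asm) integrable_completion)
         (auto intro!: borel_measurable_continuous_on_indicator continuous_intros)
  qed
  have pw: "(of_real (a * r) :: complex) powr z = of_real a powr z * of_real r powr z" if "r > 0" for r z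
    using that assms by (simp add: powr_times_real)
  have "Gamma s = (\<integral>t. indicator {0<..} t *\<^sub>R (complex_of_real t powr (s - 1) / of_real (exp t)) \<partial>lborel)"
    using set_borel_integral_eq_integral(2)[OF int] Gamma_integral_complex'[OF assms(1)]
    by (simp add: set_lebesgue_integral_def integral_unique)
  also have "\<dots> = \<bar>a\<bar> *\<^sub>R (\<integral>r. indicator {0<..} (0 + a * r) *\<^sub>R (complex_of_real (0 + a * r) powr (s - 1) / of_real (exp (0 + a * r))) \<partial>lborel)"
    using assms by (intro lborel_integral_real_affine) auto
  also have "(\<lambda>r. indicator {0<..} (0 + a * r) *\<^sub>R (complex_of_real (0 + a * r) powr (s - 1) / of_real (exp (0 + a * r))))
     = (\<lambda>r. of_real a powr (s - 1) * (exp (of_real a * of_real (- r)) * (indicator {0<..} r *\<^sub>R (of_real r powr (s - 1)))))"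
    using assms by (auto simp: fun_eq_iff indicator_def pw zero_less_mult_iff exp_minus divide_inverse exp_of_real simp del: of_real_mult simp flip: of_real_mult exp_of_real)
  also have "(\<integral>r. of_real a powr (s - 1) * (exp (of_real a * of_real (- r)) * (indicator {0<..} r *\<^sub>R (of_real r powr (s - 1)))) \<partial>lborel)
     = of_real a powr (s - 1) * (\<integral>r. exp (of_real a * of_real (- r)) * (indicator {0<..} r *\<^sub>R (of_real r powr (s - 1))) \<partial>lborel)"
    by (rule integral_mult_right_zero)
  finally have "Gamma s = of_real a * of_real a powr (s - 1) * (\<integral>r. exp (of_real a * of_real (- r)) * (indicator {0<..} r *\<^sub>R (of_real r powr (s - 1))) \<partial>lborel)"
    using assms by (simp add: scaleR_conv_of_real)
  also have "of_real a * of_real a powr (s - 1) = (of_real a powr s :: complex)"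
    using assms by (simp add: powr_diff)
  finally show ?thesis using assms by (simp add: powr_minus field_simps)
qed

text \<open>Both sides are holomorphic in \<open>c\<close> on the right half-plane and agree on the
  positive reals, which accumulate at 1 inside it.\<close>

proposition integral_mellin_exp:
  fixes c s :: complex
  assumes s: "0 < Re s" and c: "0 < Re c"
  shows "(\<integral>r. exp (c * of_real (- r)) * (indicator {0<..} r *\<^sub>R (of_real r powr (s - 1))) \<partial>lborel)
     = Gamma s * c powr (- s)"
proof -
  define F where "F = (\<lambda>c. \<integral>r. exp (c * of_real (- r)) * (indicator {0<..} r *\<^sub>R (of_real r powr (s - 1))) \<partial>lborel)"
  define S where "S = {c. 0 < Re c}"
  have "F c - Gamma s * c powr (- s) = 0"
  proof (rule analytic_continuation[where f = "\<lambda>c. F c - Gamma s * c powr (- s)" and w = c and S = S and U = "of_real ` {0<..}" and \<xi> = 1])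
    have "F holomorphic_on S"
      unfolding F_def
    proof (rule holomorphic_on_exp_integral)
      show "open S" unfolding S_def by (rule open_halfspace_Re_gt)
      fix c assume c: "c \<in> S"
      define d where "d = Re c / 2"
      have d: "d > 0" using c by (simp add: d_def S_def)
      have "integrable lborel (\<lambda>r::real. indicator {0<..} r * r powr (Re s - 1) * exp (- d * r))"
        using s d by (rule integrable_mellin_exp)
      also have "(\<lambda>r::real. indicator {0<..} r * r powr (Re s - 1) * exp (- d * r))
         = (\<lambda>r. exp (d * norm (complex_of_real (- r))) * norm (exp (c * of_real (- r)) * (indicator {0<..} r *\<^sub>R (of_real r powr (s - 1)))))"
        by (auto simp: fun_eq_iff norm_mult norm_powr_real_powr indicator_def d_def simp flip: exp_add)
      finally show "\<exists>d>0. integrable lborel (\<lambda>r. exp (d * norm (complex_of_real (- r))) * norm (exp (c * of_real (- r)) * (indicator {0<..} r *\<^sub>R (of_real r powr (s - 1)))))"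
        using d by auto
    qed auto
    then show "(\<lambda>c. F c - Gamma s * c powr (- s)) holomorphic_on S"
      by (auto intro!: holomorphic_intros simp: S_def complex_nonpos_Reals_iff)
    show "open S" unfolding S_def by (rule open_halfspace_Re_gt)
    show "connected S" unfolding S_def by (intro convex_connected convex_halfspace_Re_gt)
    show "1 islimpt complex_of_real ` {0<..}"
      unfolding islimpt_approachable
    proof (intro allI impI)
      fix e :: real assume "e > 0"
      then show "\<exists>x'\<in>complex_of_real ` {0<..}. x' \<noteq> 1 \<and> dist x' 1 < e"
        by (intro bexI[OF _ imageI[of "1 + e / 2"]]) (auto simp: dist_norm)
    qed
    fix z assume "z \<in> complex_of_real ` {0<..}"
    then show "F z - Gamma s * z powr (- s) = 0"
      using integral_mellin_exp_real[OF s] by (auto simp: F_def)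
  qed (use c in \<open>auto simp: S_def\<close>)
  then show ?thesis by (simp add: F_def)
qed

text \<open>Powers are multiplicative here because arguments do not wrap around: that of 1 + \<i>
  lies in (0, pi / 2), and below the diagonal that of \<open>x\<close> lies in (- pi, pi /
  2).\<close>

lemma two_pi_slant_powr:
  assumes "0 < Re x - Im x"
  shows "(2 * of_real pi * (1 + \<i>) * x) powr w = (2 * of_real pi * (1 + \<i>)) powr w * x powr w"
proof -
  have x0: "x \<noteq> 0" using assms by auto
  have i0: "1 + \<i> \<noteq> 0" by (simp add: complex_eq_iff)
  have Li: "Im (ln (1 + \<i>)) < pi / 2" "0 < Im (ln (1 + \<i>))"
    using Re_Ln_pos_lt[OF i0] Im_Ln_pos_lt[OF i0] by (auto simp: abs_less_iff)
  have Lx: "- pi < Im (ln x)" "Im (ln x) < pi / 2"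
  proof -
    show "- pi < Im (ln x)" using mpi_less_Im_Ln[OF x0] .
    show "Im (ln x) < pi / 2"
    proof (cases "Im x \<ge> 0")
      case True
      then have "0 < Re x" using assms by linarith
      then show ?thesis using Re_Ln_pos_lt[OF x0] by (auto simp: abs_less_iff)
    next
      case False
      then have "\<not> 0 < Im (ln x) \<or> Im (ln x) = pi"
        using Im_Ln_pos_lt[OF x0] Im_Ln_le_pi[OF x0] by linarith
      moreover have "Im (ln x) \<noteq> pi" using Im_Ln_eq_pi[OF x0] False by auto
      ultimately have "Im (ln x) \<le> 0" by auto
      then show ?thesis using pi_gt_zero by linarith
    qed
  qed
  have "ln ((1 + \<i>) * x) = ln (1 + \<i>) + ln x"
    using i0 x0 Li Lx pi_gt_zero by (intro Ln_times_simple) auto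
  then have "((1 + \<i>) * x) powr w = (1 + \<i>) powr w * x powr w"
    using i0 x0 by (simp add: powr_def exp_add distrib_left)
  moreover have "(2 * of_real pi * (1 + \<i>) * x) powr w = (2 * of_real pi) powr w * ((1 + \<i>) * x) powr w"
    using powr_times_real_left[of "2 * of_real pi" "(1 + \<i>) * x" w] by (simp add: mult.assoc)
  moreover have "(2 * of_real pi * (1 + \<i>)) powr w = (2 * of_real pi) powr w * (1 + \<i>) powr w"
    using powr_times_real_left[of "2 * of_real pi" "1 + \<i>" w] by simp
  ultimately show ?thesis by simp
qed

section \<open>Mellin transform of the Mordell integral\<close>

definition mellin_kernel :: "complex \<Rightarrow> real \<Rightarrow> complex" where
  "mellin_kernel s r = indicator {0<..} r *\<^sub>R (of_real r powr (s - 1))"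

lemma measurable_mellin_kernel' [measurable]: "mellin_kernel s \<in> borel_measurable borel"
  unfolding mellin_kernel_def by (rule measurable_mellin_kernel)

definition rs_half_kernel :: "real \<Rightarrow> complex" where
  "rs_half_kernel v = exp (\<i> * of_real pi * (slant (1 / 2) v)\<^sup>2) / (2 * \<i>) / sin (of_real pi * slant (1 / 2) v)"

lemma continuous_rs_half_kernel: "continuous_on UNIV rs_half_kernel"
  unfolding rs_half_kernel_def using sin_slant_nonzero_half by (intro continuous_intros) auto

lemma measurable_rs_half_kernel [measurable]: "rs_half_kernel \<in> borel_measurable borel"
  using continuous_rs_half_kernel by (rule borel_measurable_continuous_onI)

lemma integrable_rs_half_kernel: "integrable lborel rs_half_kernel"
proof -
  obtain C where C: "\<And>x. 0 \<le> Re x - Im x \<Longrightarrow> Re x - Im x \<le> 1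
    \<Longrightarrow> norm (exp (\<i> * of_real pi * x\<^sup>2 + 0 * x)) \<le> C * exp (- 2 * (Im x)\<^sup>2)"
    using mordell_kernel_bound[of 1 0] by auto
  have "norm (rs_half_kernel v) \<le> C * exp (- 2 * v\<^sup>2)" for v
  proof -
    define x where "x = slant (1 / 2) v"
    have "1 \<le> norm (sin (of_real pi * x))" using norm_sin_half_line[of 0 v] by (simp add: x_def)
    then have "norm (exp (\<i> * of_real pi * x\<^sup>2)) / 2 / norm (sin (of_real pi * x)) \<le> norm (exp (\<i> * of_real pi * x\<^sup>2)) / 2 / 1"
      by (intro divide_left_mono) auto
    also have "\<dots> \<le> norm (exp (\<i> * of_real pi * x\<^sup>2))" by simp
    also have "\<dots> \<le> C * exp (- 2 * v\<^sup>2)" using C[of x] by (simp add: x_def)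
    finally show ?thesis unfolding rs_half_kernel_def x_def[symmetric] norm_divide norm_mult by simp
  qed
  then show ?thesis by (intro integrable_tail_bound[OF continuous_rs_half_kernel])
qed

text \<open>On the line through 1 / 2 the number 2 pi (1 + \<i>) x has constant real part pi, so the
  modulus of the double integrand is a function of \<open>r\<close> times a function of
  \<open>v\<close>, and Fubini's theorem applies. The integral over \<open>r\<close> turns the
  exponential into the power x^(-s) of Riemann's integral.\<close>

lemma mellin_mordell_fubini:
  assumes s: "0 < Re s"
  shows "(\<integral>r. mellin_kernel s r * (\<integral>v. rs_half_kernel v * exp (2 * of_real pi * (1 + \<i>) * slant (1 / 2) v * of_real (- r)) \<partial>lborel) \<partial>lborel)
     = Gamma s * (2 * of_real pi * (1 + \<i>)) powr (- s) * (rs_line (1 / 2) s / (1 + \<i>))"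
proof -
  define c where "c = (\<lambda>v. 2 * of_real pi * (1 + \<i>) * slant (1 / 2) v)"
  define f where "f = (\<lambda>r v. mellin_kernel s r * (rs_half_kernel v * exp (c v * of_real (- r))))"
  have Rec: "Re (c v) = pi" for v by (simp add: c_def algebra_simps)
  have cont_c: "continuous_on UNIV c" unfolding c_def by (intro continuous_intros)
  have [measurable]: "c \<in> borel_measurable borel" using cont_c by (rule borel_measurable_continuous_onI)
  have nf: "norm (f r v) = indicator {0<..} r * r powr (Re s - 1) * exp (- pi * r) * norm (rs_half_kernel v)" for r v
    unfolding f_def mellin_kernel_def norm_mult norm_mellin_kernel norm_exp_eq_Re by (simp add: Rec)
  have "integrable (lborel \<Otimes>\<^sub>M lborel) (case_prod f)"
  proof (rule lborel_pair.Fubini_integrable)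
    show "case_prod f \<in> borel_measurable (lborel \<Otimes>\<^sub>M lborel)"
      unfolding f_def by measurable
    have "(\<integral>v. norm (f r v) \<partial>lborel) = indicator {0<..} r * r powr (Re s - 1) * exp (- pi * r) * (\<integral>v. norm (rs_half_kernel v) \<partial>lborel)" for r
      unfolding nf by simp
    then show "integrable lborel (\<lambda>r. \<integral>v. norm (case_prod f (r, v)) \<partial>lborel)"
      using integrable_mellin_exp[OF s pi_gt_zero] by simp
    show "AE r in lborel. integrable lborel (\<lambda>v. case_prod f (r, v))"
    proof (rule AE_I2)
      fix r
      have "integrable lborel (\<lambda>v. norm (f r v))"
        unfolding nf using integrable_rs_half_kernel by simp
      then show "integrable lborel (\<lambda>v. case_prod f (r, v))"
        by (subst (asm) integrable_norm_iff) (auto simp: f_def)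
    qed
  qed
  then have "(\<integral>r. (\<integral>v. f r v \<partial>lborel) \<partial>lborel) = (\<integral>v. (\<integral>r. f r v \<partial>lborel) \<partial>lborel)"
    by (rule lborel_pair.Fubini_integral[symmetric])
  also have "(\<lambda>r. (\<integral>v. f r v \<partial>lborel)) = (\<lambda>r. mellin_kernel s r * (\<integral>v. rs_half_kernel v * exp (c v * of_real (- r)) \<partial>lborel))"
    unfolding f_def by simp
  also have "(\<lambda>v. (\<integral>r. f r v \<partial>lborel)) = (\<lambda>v. Gamma s * (2 * of_real pi * (1 + \<i>)) powr (- s) * (slant (1 / 2) v powr (- s) * rs_half_kernel v))"
  proof
    fix v
    have "(\<integral>r. f r v \<partial>lborel) = (\<integral>r. rs_half_kernel v * (exp (c v * of_real (- r)) * mellin_kernel s r) \<partial>lborel)"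
      unfolding f_def by (simp add: mult_ac)
    also have "\<dots> = rs_half_kernel v * (Gamma s * c v powr (- s))"
      unfolding integral_mult_right_zero mellin_kernel_def
      using s Rec[of v] by (subst integral_mellin_exp) auto
    also have "c v powr (- s) = (2 * of_real pi * (1 + \<i>)) powr (- s) * slant (1 / 2) v powr (- s)"
      unfolding c_def by (rule two_pi_slant_powr) simp
    finally show "(\<integral>r. f r v \<partial>lborel) = Gamma s * (2 * of_real pi * (1 + \<i>)) powr (- s) * (slant (1 / 2) v powr (- s) * rs_half_kernel v)"
      by (simp add: mult_ac)
  qed
  also have "(\<integral>v. Gamma s * (2 * of_real pi * (1 + \<i>)) powr (- s) * (slant (1 / 2) v powr (- s) * rs_half_kernel v) \<partial>lborel)
     = Gamma s * (2 * of_real pi * (1 + \<i>)) powr (- s) * (\<integral>v. slant (1 / 2) v powr (- s) * rs_half_kernel v \<partial>lborel)"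
    by (rule integral_mult_right_zero)
  also have "(\<integral>v. slant (1 / 2) v powr (- s) * rs_half_kernel v \<partial>lborel) = rs_line (1 / 2) s / (1 + \<i>)"
  proof -
    have "1 + \<i> \<noteq> 0" by (simp add: complex_eq_iff)
    then show ?thesis unfolding rs_line_def rs_half_kernel_def by (simp add: mult_ac)
  qed
  finally show ?thesis unfolding c_def .
qed

text \<open>On the ray x = (1 + \<i>) r one has exp (\<i> pi x^2) = exp (-2 pi r^2): this is
  Riemann's integrand with x^(s-1) along that ray, except that the power is taken of
  \<open>r\<close>, so that powers of the direction remain to be multiplied in.\<close>

definition rs_ray :: "complex \<Rightarrow> complex" where
  "rs_ray s = (\<integral>r. mellin_kernel s r * (exp (of_real (- 2 * pi * r\<^sup>2)) / (2 * \<i>) / sin (of_real pi * ((1 + \<i>) * of_real r))) \<partial>lborel)"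

lemma cnj_rs_ray:
  "cnj (rs_ray (cnj s)) = - (\<integral>r. mellin_kernel s r * (exp (of_real (- 2 * pi * r\<^sup>2)) / (2 * \<i>) / sin (of_real pi * ((1 - \<i>) * of_real r))) \<partial>lborel)"
proof -
  have pw: "cnj (of_real r powr (cnj s - 1)) = of_real r powr (s - 1)" if "r > 0" for r :: real
    using that by (subst cnj_powr) auto
  have "cnj (mellin_kernel (cnj s) r) = mellin_kernel s r" for r
    unfolding mellin_kernel_def by (auto simp: indicator_def pw)
  moreover have "cnj (exp (of_real (- 2 * pi * r\<^sup>2)) / (2 * \<i>) / sin (of_real pi * ((1 + \<i>) * of_real r)))
      = - (exp (of_real (- 2 * pi * r\<^sup>2)) / (2 * \<i>) / sin (of_real pi * ((1 - \<i>) * of_real r)))" for r :: real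
    by (simp add: exp_cnj cnj_sin)
  ultimately have E: "cnj (mellin_kernel (cnj s) r * (exp (of_real (- 2 * pi * r\<^sup>2)) / (2 * \<i>) / sin (of_real pi * ((1 + \<i>) * of_real r))))
     = - (mellin_kernel s r * (exp (of_real (- 2 * pi * r\<^sup>2)) / (2 * \<i>) / sin (of_real pi * ((1 - \<i>) * of_real r))))" for r
    by (simp only: complex_cnj_mult mult_minus_right)
  show ?thesis
    unfolding rs_ray_def Bochner_Integration.integral_cnj[symmetric] E by (rule Bochner_Integration.integral_minus)
qed

text \<open>The simple pole of 1 / sin at 0 costs one power of \<open>r\<close>, which accounts for
  1 < Re s. The sign \<open>e\<close> covers the conjugate ray as well.\<close>

lemma integrable_rs_ray:
  assumes s: "1 < Re s" and e: "e = 1 \<or> e = - 1"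
  shows "integrable lborel (\<lambda>r. mellin_kernel s r * (exp (of_real (- 2 * pi * r\<^sup>2)) / (2 * \<i>) / sin (of_real pi * ((1 + of_real e * \<i>) * of_real r))))"
proof (rule Bochner_Integration.integrable_bound)
  show "integrable lborel (\<lambda>r::real. exp 1 * (indicator {0<..} r * r powr (Re (s - 1) - 1) * exp (- 1 * r)))"
    using s by (intro integrable_mult_right integrable_mellin_exp) auto
  have "(\<lambda>r. mellin_kernel s r * (exp (of_real (- 2 * pi * r\<^sup>2)) / (2 * \<i>) / sin (of_real pi * ((1 + of_real e * \<i>) * of_real r)))) \<in> borel_measurable borel"
    by measurable
  then show "(\<lambda>r. mellin_kernel s r * (exp (of_real (- 2 * pi * r\<^sup>2)) / (2 * \<i>) / sin (of_real pi * ((1 + of_real e * \<i>) * of_real r)))) \<in> borel_measurable lborel"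
    by simp
  show "AE r in lborel. norm (mellin_kernel s r * (exp (of_real (- 2 * pi * r\<^sup>2)) / (2 * \<i>) / sin (of_real pi * ((1 + of_real e * \<i>) * of_real r))))
     \<le> norm (exp 1 * (indicator {0<..} r * r powr (Re (s - 1) - 1) * exp (- 1 * r)))"
  proof (rule AE_I2)
    fix r :: real
    define S where "S = sin (of_real pi * ((1 + of_real e * \<i>) * of_real r))"
    show "norm (mellin_kernel s r * (exp (of_real (- 2 * pi * r\<^sup>2)) / (2 * \<i>) / sin (of_real pi * ((1 + of_real e * \<i>) * of_real r))))
     \<le> norm (exp 1 * (indicator {0<..} r * r powr (Re (s - 1) - 1) * exp (- 1 * r)))"
    proof (cases "r > 0")
      case True
      have "\<bar>Im (of_real pi * ((1 + of_real e * \<i>) * of_real r))\<bar> = pi * r"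
        using e True by (auto simp: abs_mult)
      then have "pi * r \<le> norm S" using norm_sin_ge_Im[of "of_real pi * ((1 + of_real e * \<i>) * of_real r)"] by (simp add: S_def)
      moreover have "r \<le> pi * r" using True pi_gt3 by simp
      ultimately have S: "r \<le> norm S" by linarith
      have ex: "exp (- 2 * pi * r\<^sup>2) \<le> exp 1 * exp (- r)"
      proof -
        have "0 \<le> (r - 1 / 2)\<^sup>2" by simp
        then have "r - 1 \<le> 2 * r\<^sup>2" by (simp add: power2_eq_square algebra_simps) (use zero_le_square[of r] in linarith)
        also have "\<dots> \<le> 2 * pi * r\<^sup>2" using pi_gt3 by (intro mult_right_mono) auto
        finally show ?thesis by (simp flip: exp_add)
      qed
      have "norm (mellin_kernel s r * (exp (of_real (- 2 * pi * r\<^sup>2)) / (2 * \<i>) / S))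
          = r powr (Re s - 1) * (exp (- 2 * pi * r\<^sup>2) / 2 / norm S)"
        using True by (simp add: mellin_kernel_def norm_mult norm_divide norm_powr_real_powr)
      also have "\<dots> \<le> r powr (Re s - 1) * (exp 1 * exp (- r) / 1 / r)"
        using S True ex by (intro mult_left_mono frac_le) auto
      also have "\<dots> = exp 1 * (r powr (Re s - 1 - 1) * exp (- r))"
        using True powr_add[of r "Re s - 2" 1] by (simp add: field_simps)
      finally show ?thesis using True by (simp add: S_def)
    qed (simp add: mellin_kernel_def)
  qed
qed

text \<open>For u = (1 - \<i>) r one has \<i> u = (1 + \<i>) r, and \<open>mordell_integral\<close>
  splits into a geometric series in \<open>q\<close>, from which the Dirichlet series will come, and
  the integrand of \<open>rs_ray\<close> on the conjugate ray.\<close>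

lemma mordell_on_ray:
  assumes r: "r > 0"
  defines "q \<equiv> exp (2 * of_real pi * (1 + \<i>) * of_real (- r))"
  shows "(1 + \<i>) * (\<integral>v. rs_half_kernel v * exp (2 * of_real pi * (1 + \<i>) * slant (1 / 2) v * of_real (- r)) \<partial>lborel)
    = - q / (1 - q) + exp (of_real (- 2 * pi * r\<^sup>2)) / (2 * \<i>) / sin (of_real pi * ((1 - \<i>) * of_real r))"
proof -
  define u where "u = (1 - \<i>) * of_real r"
  define S where "S = sin (of_real pi * u)"
  have iu: "\<i> * u = (1 + \<i>) * of_real r" by (simp add: u_def complex_eq_iff)
  have qu: "q = exp (- 2 * of_real pi * \<i> * u)"
    unfolding q_def by (rule arg_cong[of _ _ exp]) (simp add: iu mult.assoc)
  have nq: "norm q < 1" unfolding q_def norm_exp_eq_Re using r by simp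
  then have q1: "1 - q \<noteq> 0" by auto
  have P: "(1 + \<i>) * (\<integral>v. rs_half_kernel v * exp (2 * of_real pi * (1 + \<i>) * slant (1 / 2) v * of_real (- r)) \<partial>lborel)
     = (1 + \<i>) * (\<integral>v. exp (\<i> * of_real pi * (slant (1 / 2) v)\<^sup>2 - 2 * of_real pi * \<i> * u * slant (1 / 2) v) / (2 * \<i>)
      / sin (of_real pi * slant (1 / 2) v) \<partial>lborel)"
  proof -
    have E: "exp (\<i> * of_real pi * x\<^sup>2 - 2 * of_real pi * \<i> * u * x) = exp (\<i> * of_real pi * x\<^sup>2) * exp (2 * of_real pi * (1 + \<i>) * x * of_real (- r))" for x
    proof -
      have "\<i> * of_real pi * x\<^sup>2 - 2 * of_real pi * \<i> * u * x = \<i> * of_real pi * x\<^sup>2 - 2 * of_real pi * (\<i> * u) * x"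
        by (simp add: mult_ac)
      also have "\<dots> = \<i> * of_real pi * x\<^sup>2 + 2 * of_real pi * (1 + \<i>) * x * of_real (- r)"
        unfolding iu by (simp add: mult_ac)
      finally show ?thesis by (simp only: exp_add)
    qed
    show ?thesis unfolding rs_half_kernel_def E by (simp only: times_divide_eq_left)
  qed
  have e1: "exp (- (\<i> * of_real pi * u)) * exp (- (\<i> * of_real pi * u)) = q"
    unfolding qu exp_add[symmetric] by (rule arg_cong[of _ _ exp]) simp
  define p where "p = exp (- (\<i> * of_real pi * u))"
  have p0: "p \<noteq> 0" by (simp add: p_def)
  have ip: "exp (\<i> * of_real pi * u) = 1 / p" by (simp add: p_def exp_minus divide_inverse)
  have S: "2 * \<i> * S = (1 - q) / p"
  proof -
    have "2 * \<i> * S = exp (\<i> * of_real pi * u) - exp (- (\<i> * of_real pi * u))"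
      unfolding S_def sin_exp_eq by (simp add: mult.assoc field_simps)
    also have "\<dots> = (1 - q) / p"
      using p0 e1 unfolding ip p_def[symmetric] by (simp add: field_simps)
    finally show ?thesis .
  qed
  have S0: "S \<noteq> 0" using S q1 p0 by auto
  have u2: "u\<^sup>2 = - 2 * \<i> * (of_real r)\<^sup>2"
    by (simp add: u_def power_mult_distrib) (simp add: power2_eq_square algebra_simps)
  have "exp (\<i> * of_real pi * (u - u\<^sup>2)) = exp (\<i> * of_real pi * u) * exp (of_real (- 2 * pi * r\<^sup>2))"
    unfolding exp_add[symmetric] by (rule arg_cong[of _ _ exp]) (simp add: u2 algebra_simps)
  then have ex: "exp (\<i> * of_real pi * (u - u\<^sup>2)) = exp (of_real (- 2 * pi * r\<^sup>2)) / p"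
    by (simp add: ip)
  define X where "X = (1 + \<i>) * (\<integral>v. rs_half_kernel v * exp (2 * of_real pi * (1 + \<i>) * slant (1 / 2) v * of_real (- r)) \<partial>lborel)"
  define g where "g = exp (complex_of_real (- 2 * pi * r\<^sup>2))"
  have "X * (q - 1) = q * (1 - g / p)"
    using mordell_integral[of u] unfolding P[symmetric] X_def[symmetric] qu[symmetric] ex g_def[symmetric] .
  then have "X = - q * (1 - g / p) / (1 - q)" using q1 by (simp add: field_simps)
  also have "\<dots> = - q / (1 - q) + g * (q / p / (1 - q))"
  proof -
    have "- q * (1 - g / p) = - q + g * (q / p)" by (simp add: algebra_simps)
    then show ?thesis by (simp add: add_divide_distrib diff_divide_distrib)
  qed
  also have "q / p = p" using e1 p0 unfolding p_def[symmetric] by (simp add: field_simps)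
  also have "p / (1 - q) = 1 / (2 * \<i> * S)" unfolding S using p0 q1 by simp
  also have "g * (1 / (2 * \<i> * S)) = g / (2 * \<i>) / S"
    by (simp only: divide_divide_eq_left times_divide_eq_right mult_1_right)
  finally show ?thesis unfolding X_def g_def S_def u_def .
qed

lemma summable_norm_zeta_series:
  assumes "1 < Re s"
  shows "summable (\<lambda>n. norm (1 / of_nat (Suc n) powr s))"
proof -
  have "summable (\<lambda>n. real (Suc n) powr (- Re s))"
    using assms by (subst summable_Suc_iff) (simp add: summable_real_powr_iff)
  then show ?thesis
    by (simp add: norm_divide norm_powr_real_powr powr_minus field_simps del: of_nat_Suc)
qed

text \<open>Expanding in powers of \<open>q\<close> and integrating term by term gives Gamma (s) (2
  pi (1 + \<i>) n)^(-s) for n = 1, 2, ..., which is absolutely summable for Re s > 1.\<close>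

lemma mellin_geometric:
  assumes s: "1 < Re s"
  defines "q \<equiv> \<lambda>r. exp (2 * of_real pi * (1 + \<i>) * of_real (- r))"
  shows "integrable lborel (\<lambda>r. mellin_kernel s r * (q r / (1 - q r)))"
    and "(\<integral>r. mellin_kernel s r * (q r / (1 - q r)) \<partial>lborel)
      = Gamma s * (2 * of_real pi * (1 + \<i>)) powr (- s) * (\<Sum>n. 1 / of_nat (Suc n) powr s)"
proof -
  define c where "c = (\<lambda>n. of_nat (Suc n) * (2 * of_real pi * (1 + \<i>)))"
  define f where "f = (\<lambda>n r. exp (c n * of_real (- r)) * mellin_kernel s r)"
  have Rec: "Re (c n) = 2 * pi * real (Suc n)" for n by (simp add: c_def)
  have nf: "norm (f n r) = indicator {0<..} r * r powr (Re s - 1) * exp (- (2 * pi * real (Suc n)) * r)" for n r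
    unfolding f_def mellin_kernel_def norm_mult norm_mellin_kernel norm_exp_eq_Re by (simp add: Rec del: of_nat_Suc)
  have [measurable]: "f n \<in> borel_measurable borel" for n unfolding f_def by measurable
  have int: "integrable lborel (f n)" for n
  proof -
    have "integrable lborel (\<lambda>r. norm (f n r))"
      unfolding nf using s by (intro integrable_mellin_exp) auto
    then show ?thesis by (subst (asm) integrable_norm_iff) auto
  qed
  have fq: "f n r = mellin_kernel s r * (q r * q r ^ n)" for n r
  proof -
    have "exp (c n * of_real (- r)) = q r ^ Suc n"
      unfolding q_def exp_of_nat_mult[symmetric] by (rule arg_cong[of _ _ exp]) (simp add: c_def mult_ac del: of_nat_Suc)
    then show ?thesis by (simp add: f_def)
  qed
  have nq: "norm (q r) < 1" if "r > 0" for r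
    unfolding q_def norm_exp_eq_Re using that by simp
  have sm: "summable (\<lambda>n. norm (f n r))" for r
  proof (cases "r > 0")
    case True
    then show ?thesis unfolding fq norm_mult norm_power
      by (intro summable_mult summable_geometric) (use nq in auto)
  qed (simp add: f_def mellin_kernel_def)
  have sum_f: "(\<Sum>n. f n r) = mellin_kernel s r * (q r / (1 - q r))" for r
  proof (cases "r > 0")
    case True
    have "(\<lambda>n. mellin_kernel s r * (q r * q r ^ n)) sums (mellin_kernel s r * (q r * (1 / (1 - q r))))"
      using nq[OF True] by (intro sums_mult geometric_sums)
    then show ?thesis unfolding fq by (simp add: sums_iff)
  qed (simp add: f_def mellin_kernel_def)
  have If: "(\<integral>r. f n r \<partial>lborel) = Gamma s * (2 * of_real pi * (1 + \<i>)) powr (- s) * (1 / of_nat (Suc n) powr s)" for n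
  proof -
    have "(\<integral>r. f n r \<partial>lborel) = Gamma s * c n powr (- s)"
      unfolding f_def mellin_kernel_def using s by (intro integral_mellin_exp) (auto simp: Rec simp del: of_nat_Suc)
    also have "c n powr (- s) = of_nat (Suc n) powr (- s) * (2 * of_real pi * (1 + \<i>)) powr (- s)"
      unfolding c_def by (rule powr_times_real_left) auto
    finally show ?thesis by (simp add: powr_minus divide_inverse mult_ac del: of_nat_Suc)
  qed
  \<comment> \<open>The modulus of the integrand is the integrand for the real exponent Re s and the
    real parameter 2 pi (n + 1), so its integral is evaluated instead of estimated.\<close>
  have Inf: "(\<integral>r. norm (f n r) \<partial>lborel) = norm (Gamma (complex_of_real (Re s)) * of_real (2 * pi) powr (- of_real (Re s))) * norm (1 / of_nat (Suc n) powr s)" for n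
  proof -
    have pos: "0 < Re (complex_of_real (Re s))" "0 < 2 * pi * real (Suc n)" using s by auto
    have "complex_of_real (\<integral>r. norm (f n r) \<partial>lborel) = (\<integral>r. of_real (norm (f n r)) \<partial>lborel)"
      by simp
    also have "\<dots> = (\<integral>r. exp (of_real (2 * pi * real (Suc n)) * of_real (- r)) * (indicator {0<..} r *\<^sub>R (of_real r powr (of_real (Re s) - 1))) \<partial>lborel)"
    proof (rule Bochner_Integration.integral_cong[OF refl])
      fix r :: real
      show "complex_of_real (norm (f n r)) = exp (of_real (2 * pi * real (Suc n)) * of_real (- r)) * (indicator {0<..} r *\<^sub>R (of_real r powr (of_real (Re s) - 1)))"
      proof (cases "r > 0")
        case True
        have "of_real r powr (complex_of_real (Re s) - 1) = of_real (r powr (Re s - 1))"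
          using True powr_of_real[of r "Re s - 1"] by simp
        then show ?thesis unfolding nf using True
          by (simp del: of_nat_Suc add: exp_of_real flip: of_real_mult of_real_minus)
      qed (simp add: nf)
    qed
    also have "\<dots> = Gamma (of_real (Re s)) * of_real (2 * pi * real (Suc n)) powr (- of_real (Re s))"
      by (rule integral_mellin_exp_real[OF pos])
    also have "of_real (2 * pi * real (Suc n)) powr (- complex_of_real (Re s)) = of_real (2 * pi) powr (- of_real (Re s)) * of_real (real (Suc n)) powr (- of_real (Re s))"
      unfolding of_real_mult[of "2 * pi"] by (rule powr_times_real) auto
    finally have "norm (complex_of_real (\<integral>r. norm (f n r) \<partial>lborel)) = norm (Gamma (of_real (Re s)) * of_real (2 * pi) powr (- of_real (Re s)) * of_real (real (Suc n)) powr (- of_real (Re s)) :: complex)"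
      by (simp only: mult.assoc)
    moreover have "norm (of_real (real (Suc n)) powr (- of_real (Re s)) :: complex) = norm (1 / of_nat (Suc n) powr s)"
      by (simp add: norm_divide norm_inverse norm_powr_real_powr powr_minus divide_inverse del: of_nat_Suc)
    moreover have "norm (complex_of_real (\<integral>r. norm (f n r) \<partial>lborel)) = (\<integral>r. norm (f n r) \<partial>lborel)"
      by (simp add: integral_nonneg_AE)
    ultimately show ?thesis by (simp only: norm_mult)
  qed
  have sI: "summable (\<lambda>n. \<integral>r. norm (f n r) \<partial>lborel)"
    unfolding Inf by (rule summable_mult[OF summable_norm_zeta_series[OF s]])
  show "integrable lborel (\<lambda>r. mellin_kernel s r * (q r / (1 - q r)))"
    unfolding sum_f[symmetric] using int sm sI by (intro integrable_suminf) auto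
  have "(\<integral>r. (\<Sum>n. f n r) \<partial>lborel) = (\<Sum>n. \<integral>r. f n r \<partial>lborel)"
    using int sm sI by (intro integral_suminf) auto
  also have "\<dots> = Gamma s * (2 * of_real pi * (1 + \<i>)) powr (- s) * (\<Sum>n. 1 / of_nat (Suc n) powr s)"
    unfolding If by (rule suminf_mult[OF summable_norm_cancel[OF summable_norm_zeta_series[OF s]]])
  finally show "(\<integral>r. mellin_kernel s r * (q r / (1 - q r)) \<partial>lborel)
      = Gamma s * (2 * of_real pi * (1 + \<i>)) powr (- s) * (\<Sum>n. 1 / of_nat (Suc n) powr s)"
    unfolding sum_f .
qed

text \<open>Mellin transform of \<open>mordell_on_ray\<close>: the integral over the line produces
  \<open>rs_line\<close>, the geometric part the Dirichlet series, and what remains is the conjugate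
  ray.\<close>

proposition rs_line_plus_zeta:
  assumes s: "1 < Re s"
  shows "Gamma s * (2 * of_real pi * (1 + \<i>)) powr (- s) * (rs_line (1 / 2) s + (\<Sum>n. 1 / of_nat (Suc n) powr s))
     = - cnj (rs_ray (cnj s))"
proof -
  define q where "q = (\<lambda>r::real. exp (2 * of_real pi * (1 + \<i>) * of_real (- r)))"
  define J where "J = (\<lambda>r. exp (of_real (- 2 * pi * r\<^sup>2)) / (2 * \<i>) / sin (of_real pi * ((1 - \<i>) * of_real r)))"
  define P where "P = (\<lambda>r. \<integral>v. rs_half_kernel v * exp (2 * of_real pi * (1 + \<i>) * slant (1 / 2) v * of_real (- r)) \<partial>lborel)"
  define G where "G = Gamma s * (2 * of_real pi * (1 + \<i>)) powr (- s)"
  have i0: "1 + \<i> \<noteq> 0" by (simp add: complex_eq_iff)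
  have intJ: "integrable lborel (\<lambda>r. mellin_kernel s r * J r)"
    using integrable_rs_ray[OF s, of "- 1"] by (simp add: J_def)
  have intq: "integrable lborel (\<lambda>r. mellin_kernel s r * (q r / (1 - q r)))"
    unfolding q_def by (rule mellin_geometric(1)[OF s])
  have "G * rs_line (1 / 2) s = (1 + \<i>) * (\<integral>r. mellin_kernel s r * P r \<partial>lborel)"
  proof -
    have PD: "(\<integral>v. rs_half_kernel v * exp (2 * of_real pi * (1 + \<i>) * slant (1 / 2) v * of_real (- r)) \<partial>lborel) = P r" for r
      by (simp add: P_def)
    have "(\<integral>r. mellin_kernel s r * P r \<partial>lborel) = G * (rs_line (1 / 2) s / (1 + \<i>))"
      using mellin_mordell_fubini[of s] s unfolding PD G_def by simp
    then show ?thesis using i0 by simp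
  qed
  also have "\<dots> = (\<integral>r. (1 + \<i>) * (mellin_kernel s r * P r) \<partial>lborel)"
    by (rule integral_mult_right_zero[symmetric])
  also have "\<dots> = (\<integral>r. mellin_kernel s r * J r - mellin_kernel s r * (q r / (1 - q r)) \<partial>lborel)"
  proof (rule Bochner_Integration.integral_cong[OF refl])
    fix r
    show "(1 + \<i>) * (mellin_kernel s r * P r) = mellin_kernel s r * J r - mellin_kernel s r * (q r / (1 - q r))"
    proof (cases "r > 0")
      case True
      have "(1 + \<i>) * P r = - q r / (1 - q r) + J r"
        unfolding P_def q_def J_def by (rule mordell_on_ray[OF True])
      then have "mellin_kernel s r * ((1 + \<i>) * P r) = mellin_kernel s r * (- q r / (1 - q r) + J r)" by simp
      then show ?thesis by (simp add: algebra_simps)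
    qed (simp add: mellin_kernel_def)
  qed
  also have "\<dots> = (\<integral>r. mellin_kernel s r * J r \<partial>lborel) - (\<integral>r. mellin_kernel s r * (q r / (1 - q r)) \<partial>lborel)"
    by (rule Bochner_Integration.integral_diff[OF intJ intq])
  also have "(\<integral>r. mellin_kernel s r * (q r / (1 - q r)) \<partial>lborel) = G * (\<Sum>n. 1 / of_nat (Suc n) powr s)"
    unfolding q_def G_def by (rule mellin_geometric(2)[OF s])
  also have "(\<integral>r. mellin_kernel s r * J r \<partial>lborel) = - cnj (rs_ray (cnj s))"
    by (simp add: cnj_rs_ray J_def)
  finally show ?thesis unfolding G_def[symmetric] by (simp add: algebra_simps)
qed

section \<open>The functional equation and the continuation of zeta\<close>

lemma rs_line_eq_half:
  assumes a: "0 < a" "a < 1 / 2"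
  shows "rs_line a w = rs_line (1 / 2) w"
proof -
  define f where "f = (\<lambda>x::complex. x powr (- w) * exp (\<i> * of_real pi * x\<^sup>2) / (2 * \<i>) / sin (of_real pi * x))"
  obtain C where C: "\<And>x. 0 \<le> Re x - Im x \<Longrightarrow> Re x - Im x \<le> 1 \<Longrightarrow> 1 / 2 \<le> \<bar>Im x\<bar>
    \<Longrightarrow> norm (x powr (- w) * exp (\<i> * of_real pi * x\<^sup>2)) \<le> C * exp (- 2 * (Im x)\<^sup>2)"
    using rs_kernel_bound[of 1 "- w"] by auto
  have "(\<integral>v. f (slant (1 / 2) v) \<partial>lborel) = (\<integral>v. f (slant a v) \<partial>lborel)"
  proof (rule slant_shift_holomorphic)
    show "f holomorphic_on {x. 0 < Re x - Im x \<and> Re x - Im x < 1}"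
      unfolding f_def
    proof (intro holomorphic_on_divide holomorphic_on_mult)
      show "(\<lambda>x. x powr (- w)) holomorphic_on {x. 0 < Re x - Im x \<and> Re x - Im x < 1}"
        using slant_not_nonpos by (intro holomorphic_intros) auto
      fix x assume x: "x \<in> {x. 0 < Re x - Im x \<and> Re x - Im x < 1}"
      then have "x \<noteq> 0" by auto
      then show "sin (of_real pi * x) \<noteq> 0" using x by (intro sin_slant_nonzero[of 0]) auto
    qed (auto intro!: holomorphic_intros)
    fix x assume x: "a \<le> Re x - Im x" "Re x - Im x \<le> 1 / 2" "1 / 2 \<le> \<bar>Im x\<bar>"
    have "norm (x powr (- w) * exp (\<i> * of_real pi * x\<^sup>2)) / 2 / norm (sin (of_real pi * x)) \<le> norm (x powr (- w) * exp (\<i> * of_real pi * x\<^sup>2)) / 1 / 1"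
      using norm_sin_pi_ge_1[OF x(3)] by (intro frac_le) auto
    also have "\<dots> \<le> C * exp (- 2 * (Im x)\<^sup>2)" using C[of x] x a by simp
    finally show "norm (f x) \<le> C * exp (- 2 * (Im x)\<^sup>2)"
      unfolding f_def norm_divide by simp
  qed (use a in auto)
  then show ?thesis unfolding rs_line_def f_def by simp
qed

text \<open>Lets one factor \<open>x\<close> of the power cancel the pole of 1 / sin at 0, uniformly
  for lines that approach 0. Close to the real axis Jordan's inequality treats the real part; once
  \<bar>Im x\<bar> exceeds 1 / 4 the imaginary part alone suffices.\<close>

lemma norm_le_norm_sin_pi:
  assumes "0 \<le> Re x - Im x" "Re x - Im x \<le> 1 / 4" "\<bar>Im x\<bar> \<le> 1 / 2"
  shows "norm x \<le> norm (sin (of_real pi * x))"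
proof (cases "\<bar>Im x\<bar> \<le> 1 / 4")
  case True
  then have re: "\<bar>Re x\<bar> \<le> 1 / 2" using assms by (auto simp: abs_le_iff)
  have "\<bar>Re x\<bar> \<le> \<bar>sin (pi * Re x)\<bar>"
  proof -
    have "2 * \<bar>Re x\<bar> \<le> sin (pi * \<bar>Re x\<bar>)"
      using sin_pi_half_mult_ge[of "2 * \<bar>Re x\<bar>"] re by simp
    then show ?thesis by (cases "Re x \<ge> 0") auto
  qed
  then have "(Re x)\<^sup>2 \<le> (sin (pi * Re x))\<^sup>2" by (simp add: abs_le_square_iff)
  moreover have "(Im x)\<^sup>2 \<le> (sinh (pi * Im x))\<^sup>2"
  proof -
    have "\<bar>Im x\<bar> \<le> \<bar>pi * Im x\<bar>" using pi_gt3 by (simp add: abs_mult mult_le_cancel_right1)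
    also have "\<dots> \<le> \<bar>sinh (pi * Im x)\<bar>"
      using real_le_abs_sinh[of "pi * Im x"] by (simp add: sinh_field_def exp_minus)
    finally show ?thesis by (simp add: abs_le_square_iff)
  qed
  ultimately have "(norm x)\<^sup>2 \<le> (norm (sin (of_real pi * x)))\<^sup>2"
    unfolding norm_sin_squared_sinh by (simp add: cmod_power2)
  then show ?thesis by (rule power2_le_imp_le) auto
next
  case False
  have "norm x \<le> 3 * \<bar>Im x\<bar>" using norm_le_slant[of x] assms False by linarith
  also have "\<dots> \<le> pi * \<bar>Im x\<bar>" using pi_gt3 by (intro mult_right_mono) auto
  also have "\<dots> \<le> norm (sin (of_real pi * x))"
    using norm_sin_ge_Im[of "of_real pi * x"] by (simp add: abs_mult)
  finally show ?thesis .
qed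

text \<open>Supplies the majorant for moving the line into the pole at 0. After 1 / sin has consumed
  one factor of the power, \<bar>x\<bar>^(Re s - 2) remains, and it is bounded near 0 only for Re s
  \<ge> 2.\<close>

lemma rs_kernel_uniform_bound:
  assumes s: "2 \<le> Re s"
  obtains C where "\<And>x. 0 < Re x - Im x \<Longrightarrow> Re x - Im x \<le> 1 / 4
    \<Longrightarrow> norm (x powr (s - 1) * exp (\<i> * of_real pi * x\<^sup>2) / (2 * \<i>) / sin (of_real pi * x)) \<le> C * exp (- (Im x)\<^sup>2)"
proof -
  obtain C where C: "\<And>x. 0 \<le> Re x - Im x \<Longrightarrow> Re x - Im x \<le> 1 \<Longrightarrow> 1 / 2 \<le> \<bar>Im x\<bar>
    \<Longrightarrow> norm (x powr (s - 1) * exp (\<i> * of_real pi * x\<^sup>2)) \<le> C * exp (- 2 * (Im x)\<^sup>2)"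
    using rs_kernel_bound[of 1 "s - 1"] by auto
  define D where "D = 2 powr (Re s - 2) * exp (\<bar>Im s\<bar> * pi) * exp (pi + 1)"
  show ?thesis
  proof (rule that[of "\<bar>C\<bar> + D"])
    fix x :: complex assume x: "0 < Re x - Im x" "Re x - Im x \<le> 1 / 4"
    have x0: "x \<noteq> 0" using x by auto
    have nn: "norm (x powr (s - 1) * exp (\<i> * of_real pi * x\<^sup>2) / (2 * \<i>) / sin (of_real pi * x))
       = norm (x powr (s - 1)) * norm (exp (\<i> * of_real pi * x\<^sup>2)) / 2 / norm (sin (of_real pi * x))"
      by (simp add: norm_divide norm_mult)
    have e0: "0 < exp (- (Im x)\<^sup>2)" by simp
    show "norm (x powr (s - 1) * exp (\<i> * of_real pi * x\<^sup>2) / (2 * \<i>) / sin (of_real pi * x)) \<le> (\<bar>C\<bar> + D) * exp (- (Im x)\<^sup>2)"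
    proof (cases "\<bar>Im x\<bar> \<le> 1 / 2")
      case False
      have "norm (x powr (s - 1)) * norm (exp (\<i> * of_real pi * x\<^sup>2)) / 2 / norm (sin (of_real pi * x))
        \<le> norm (x powr (s - 1)) * norm (exp (\<i> * of_real pi * x\<^sup>2)) / 1 / 1"
        using norm_sin_pi_ge_1[of x] False by (intro frac_le) auto
      also have "\<dots> \<le> C * exp (- 2 * (Im x)\<^sup>2)" using C[of x] x False by (simp add: norm_mult)
      also have "\<dots> \<le> \<bar>C\<bar> * exp (- (Im x)\<^sup>2)" by (intro mult_mono) auto
      also have "\<dots> \<le> (\<bar>C\<bar> + D) * exp (- (Im x)\<^sup>2)" by (intro mult_right_mono) (auto simp: D_def)
      finally show ?thesis unfolding nn .
    next
      case True
      have nx: "norm x \<le> 2" using norm_le_slant[of x] x True by linarith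
      have n0: "norm x > 0" using x0 by simp
      have p: "norm (x powr (s - 1)) \<le> norm x powr (Re s - 1) * exp (\<bar>Im s\<bar> * pi)"
      proof -
        have "- Im s * Im (ln x) \<le> \<bar>Im s\<bar> * \<bar>Im (ln x)\<bar>"
          by (metis abs_ge_self abs_minus_cancel abs_mult mult_minus_left)
        also have "\<dots> \<le> \<bar>Im s\<bar> * pi"
          using mpi_less_Im_Ln[OF x0] Im_Ln_le_pi[OF x0] by (intro mult_left_mono) auto
        finally have "exp (- Im s * Im (ln x)) \<le> exp (\<bar>Im s\<bar> * pi)" by simp
        then show ?thesis unfolding norm_powr_complex using x0
          by (intro mult_mono) (auto simp: Arg_eq_Im_Ln)
      qed
      have g: "norm (exp (\<i> * of_real pi * x\<^sup>2)) \<le> exp pi"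
      proof -
        have "- ((Re x - Im x) * Im x) \<le> 1 / 4 * (1 / 2)"
          using x True mult_mono[of "Re x - Im x" "1 / 4" "- Im x" "1 / 2"]
          by (cases "Im x \<ge> 0") (auto simp: abs_le_iff intro: order_trans[of _ 0])
        then have "2 * pi * (- ((Re x - Im x) * Im x)) \<le> 2 * pi * (1 / 4 * (1 / 2))"
          by (intro mult_left_mono) auto
        then have "- 2 * pi * (Re x - Im x) * Im x - 2 * pi * (Im x)\<^sup>2 \<le> 2 * pi * (1 / 4 * (1 / 2)) - 0"
          by (intro diff_mono) (auto simp: mult.assoc)
        also have "\<dots> \<le> pi" by simp
        finally show ?thesis unfolding norm_exp_pi_i_square by simp
      qed
      have "norm (x powr (s - 1)) * norm (exp (\<i> * of_real pi * x\<^sup>2)) / 2 / norm (sin (of_real pi * x))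
        \<le> (norm x powr (Re s - 1) * exp (\<bar>Im s\<bar> * pi)) * exp pi / 1 / norm x"
        using norm_le_norm_sin_pi[of x] x True p g n0 by (intro frac_le mult_mono) auto
      also have "\<dots> = norm x powr (Re s - 2) * exp (\<bar>Im s\<bar> * pi) * exp pi"
        using n0 powr_add[of "norm x" "Re s - 2" 1] by (simp add: field_simps)
      also have "\<dots> \<le> 2 powr (Re s - 2) * exp (\<bar>Im s\<bar> * pi) * exp pi"
        using nx s by (intro mult_right_mono powr_mono2) auto
      also have "\<dots> = 2 powr (Re s - 2) * exp (\<bar>Im s\<bar> * pi) * exp (pi + 1) * exp (- 1)"
        by (simp add: exp_add exp_minus)
      also have "\<dots> \<le> D * exp (- (Im x)\<^sup>2)"
      proof -
        have "(Im x)\<^sup>2 \<le> 1\<^sup>2" using True by (intro abs_le_square_iff[THEN iffD1]) auto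
        then show ?thesis unfolding D_def by (intro mult_left_mono) auto
      qed
      also have "\<dots> \<le> (\<bar>C\<bar> + D) * exp (- (Im x)\<^sup>2)" by (intro mult_right_mono) auto
      finally show ?thesis unfolding nn .
    qed
  qed
qed

lemma slant_0: "slant 0 v = (1 + \<i>) * of_real v"
  by (simp add: slant_def)

text \<open>The line through \<open>1 / 2\<close> may be moved to the line through \<open>0\<close>, which splits into two rays.\<close>

proposition rs_line_eq_rs_ray:
  assumes s: "2 \<le> Re s"
  shows "rs_line (1 / 2) (1 - s) = ((1 + \<i>) powr s + (- 1 - \<i>) powr s) * rs_ray s"
proof -
  define G where "G = (\<lambda>a v. slant a v powr (s - 1) * exp (\<i> * of_real pi * (slant a v)\<^sup>2) / (2 * \<i>) / sin (of_real pi * slant a v))"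
  define K where "K = (\<lambda>r::real. mellin_kernel s r * (exp (of_real (- 2 * pi * r\<^sup>2)) / (2 * \<i>) / sin (of_real pi * ((1 + \<i>) * of_real r))))"
  \<comment> \<open>Lines that tend to 0 within the range (0, 1 / 4] of the majorant.\<close>
  define an where "an = (\<lambda>n::nat. 1 / (real n + 4))"
  obtain C where C: "\<And>x. 0 < Re x - Im x \<Longrightarrow> Re x - Im x \<le> 1 / 4
    \<Longrightarrow> norm (x powr (s - 1) * exp (\<i> * of_real pi * x\<^sup>2) / (2 * \<i>) / sin (of_real pi * x)) \<le> C * exp (- (Im x)\<^sup>2)"
    using rs_kernel_uniform_bound[OF s] by auto
  have an: "0 < an n" "an n \<le> 1 / 4" for n by (auto simp: an_def field_simps)
  have rs: "rs_line a (1 - s) = (1 + \<i>) * (\<integral>v. G a v \<partial>lborel)" for a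
    unfolding rs_line_def G_def by simp
  have meas: "G a \<in> borel_measurable borel" if "a > 0" "a \<le> 1 / 4" for a
  proof (rule borel_measurable_continuous_onI)
    have "slant a v \<notin> \<real>\<^sub>\<le>\<^sub>0" for v using that by (intro slant_not_nonpos) auto
    moreover have "sin (of_real pi * slant a v) \<noteq> 0" for v
      using that by (intro sin_slant_nonzero[of 0]) (auto simp: complex_eq_iff)
    moreover have pw: "slant a v powr (s - 1) = exp ((s - 1) * ln (slant a v))" for v
    proof -
      have "slant a v \<noteq> 0" using that by (auto simp: complex_eq_iff)
      then show ?thesis by (simp add: powr_def)
    qed
    ultimately show "continuous_on UNIV (G a)"
      unfolding G_def pw by (intro continuous_intros; simp)
  qed
  have G0p: "G 0 v = (1 + \<i>) powr (s - 1) * K v" if "v > 0" for v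
  proof -
    have sq: "\<i> * of_real pi * (slant 0 v)\<^sup>2 = of_real (- 2 * pi * v\<^sup>2)"
      by (simp add: slant_0 complex_eq_iff power2_eq_square)
    have pw: "slant 0 v powr (s - 1) = of_real v powr (s - 1) * (1 + \<i>) powr (s - 1)"
      using powr_times_real_left[of "of_real v" "1 + \<i>" "s - 1"] that by (simp add: slant_0 mult.commute)
    show ?thesis unfolding G_def K_def sq pw mellin_kernel_def using that by (simp add: slant_0 mult_ac)
  qed
  have G0n: "G 0 (- v) = - ((- 1 - \<i>) powr (s - 1) * K v)" if "v > 0" for v
  proof -
    have sq: "\<i> * of_real pi * (slant 0 (- v))\<^sup>2 = of_real (- 2 * pi * v\<^sup>2)"
      by (simp add: slant_0 complex_eq_iff power2_eq_square)
    have sl: "slant 0 (- v) = of_real v * (- 1 - \<i>)" by (simp add: slant_0 algebra_simps)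
    have pw: "slant 0 (- v) powr (s - 1) = of_real v powr (s - 1) * (- 1 - \<i>) powr (s - 1)"
      unfolding sl using powr_times_real_left[of "of_real v" "- 1 - \<i>" "s - 1"] that by simp
    have sn: "sin (of_real pi * slant 0 (- v)) = - sin (of_real pi * ((1 + \<i>) * of_real v))"
      unfolding sin_minus[symmetric] by (rule arg_cong[of _ _ sin]) (simp add: slant_0)
    show ?thesis unfolding G_def K_def sq pw sn mellin_kernel_def using that by (simp add: mult_ac)
  qed
  have intK: "integrable lborel K"
    unfolding K_def using integrable_rs_ray[of s 1] s by simp
  have lim: "(\<lambda>n. G (an n) v) \<longlonglongrightarrow> G 0 v" if "v \<noteq> 0" for v
  proof -
    have nz: "slant 0 v \<notin> \<real>\<^sub>\<le>\<^sub>0" using that by (auto simp: complex_nonpos_Reals_iff)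
    have sn: "sin (of_real pi * slant 0 v) \<noteq> 0"
      using norm_sin_ge_Im[of "of_real pi * slant 0 v"] that by auto
    have "an \<longlonglongrightarrow> 0" unfolding an_def by real_asymp
    then have "(\<lambda>n. slant (an n) v) \<longlonglongrightarrow> slant 0 v"
      unfolding slant_def by (intro tendsto_intros)
    then show ?thesis unfolding G_def using nz sn by (intro tendsto_intros) auto
  qed
  define H where "H = (\<lambda>v. (1 + \<i>) powr (s - 1) * K v + - ((- 1 - \<i>) powr (s - 1) * K (- v)))"
  have G0: "G 0 v = H v" if "v \<noteq> 0" for v
  proof (cases "v > 0")
    case True
    then have "K (- v) = 0" by (simp add: K_def mellin_kernel_def)
    then show ?thesis using G0p[OF True] by (simp add: H_def)
  next
    case False
    then have "K v = 0" by (simp add: K_def mellin_kernel_def)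
    then show ?thesis using G0n[of "- v"] False that by (simp add: H_def)
  qed
  have intK': "integrable lborel (\<lambda>v. K (- v))"
    using lborel_integrable_real_affine[OF intK, of "- 1" 0] by simp
  have intH: "integrable lborel H" unfolding H_def using intK intK' by simp
  have "(\<lambda>n. \<integral>v. G (an n) v \<partial>lborel) \<longlonglongrightarrow> (\<integral>v. H v \<partial>lborel)"
  proof (rule integral_dominated_convergence)
    show "H \<in> borel_measurable lborel" using intH by simp
    show "G (an n) \<in> borel_measurable lborel" for n using meas an by simp
    show "integrable lborel (\<lambda>v. C * exp (- v\<^sup>2))" using integrable_gaussian by simp
    show "AE v in lborel. (\<lambda>n. G (an n) v) \<longlonglongrightarrow> H v"
      using AE_lborel_singleton[of 0] by eventually_elim (use lim G0 in auto)
    show "AE v in lborel. norm (G (an n) v) \<le> C * exp (- v\<^sup>2)" for n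
      using C[of "slant (an n) v" for v] an[of n] unfolding G_def by (intro AE_I2) auto
  qed
  moreover have "(\<integral>v. G (an n) v \<partial>lborel) = (\<integral>v. G (1 / 2) v \<partial>lborel)" for n
  proof -
    have "1 + \<i> \<noteq> 0" by (simp add: complex_eq_iff)
    moreover have "an n < 1 / 2" using an(2)[of n] by linarith
    ultimately show ?thesis using rs_line_eq_half[of "an n" "1 - s"] an(1)[of n] unfolding rs by simp
  qed
  ultimately have "(\<integral>v. G (1 / 2) v \<partial>lborel) = (\<integral>v. H v \<partial>lborel)"
    by (simp add: LIMSEQ_const_iff)
  also have "\<dots> = (1 + \<i>) powr (s - 1) * rs_ray s - (- 1 - \<i>) powr (s - 1) * rs_ray s"
  proof -
    have "(\<integral>v. K (- v) \<partial>lborel) = (\<integral>v. K v \<partial>lborel)"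
      using lborel_integral_real_affine[of "- 1" K 0] by simp
    moreover have "(\<integral>v. K v \<partial>lborel) = rs_ray s" by (simp only: rs_ray_def K_def)
    ultimately show ?thesis unfolding H_def using intK intK' by simp
  qed
  finally have "rs_line (1 / 2) (1 - s) = (1 + \<i>) * ((1 + \<i>) powr (s - 1) * rs_ray s - (- 1 - \<i>) powr (s - 1) * rs_ray s)"
    unfolding rs by simp
  \<comment> \<open>The left ray enters with a minus sign because the sine is odd; writing 1 + \<i>
    = - (- 1 - \<i>) turns it into the plus sign of the claim.\<close>
  moreover have "(1 + \<i>) powr s = (1 + \<i>) * (1 + \<i>) powr (s - 1)" "(- 1 - \<i>) powr s = (- 1 - \<i>) * (- 1 - \<i>) powr (s - 1)"
    by (simp_all add: powr_diff complex_eq_iff[of "1 + \<i>" 0] complex_eq_iff[of "- 1 - \<i>" 0])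
  ultimately show ?thesis by (simp only:) (simp add: algebra_simps)
qed

section \<open>The factor of the functional equation\<close>

lemma ln_diagonal:
  "ln (1 + \<i>) = of_real (ln (sqrt 2)) + \<i> * of_real (pi / 4)"
  "ln (1 - \<i>) = of_real (ln (sqrt 2)) + \<i> * of_real (- pi / 4)"
  "ln (- 1 + \<i>) = of_real (ln (sqrt 2)) + \<i> * of_real (3 * pi / 4)"
proof -
  have e: "exp (of_real (ln (sqrt 2)) + \<i> * of_real x) = of_real (sqrt 2) * cis x" for x
    by (simp add: exp_add cis_conv_exp exp_of_real)
  have c: "cos (3 * pi / 4) = - (sqrt 2 / 2)" "sin (3 * pi / 4) = sqrt 2 / 2"
    using cos_diff[of pi "pi / 4"] sin_diff[of pi "pi / 4"] by (simp_all add: cos_45 sin_45 field_simps)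
  have minus_pi_4: "- (pi / 4) \<le> pi" using pi_gt_zero by linarith
  show "ln (1 + \<i>) = of_real (ln (sqrt 2)) + \<i> * of_real (pi / 4)"
    by (rule Ln_unique; (simp only: e)?) (simp_all only: complex_eq_iff, simp_all add: cos_45 sin_45)
  show "ln (1 - \<i>) = of_real (ln (sqrt 2)) + \<i> * of_real (- pi / 4)"
    by (rule Ln_unique; (simp only: e)?) (simp_all only: complex_eq_iff, simp_all add: cos_45 sin_45 minus_pi_4)
  show "ln (- 1 + \<i>) = of_real (ln (sqrt 2)) + \<i> * of_real (3 * pi / 4)"
    by (rule Ln_unique; (simp only: e)?) (simp_all only: complex_eq_iff, simp_all add: c)
qed

text \<open>Relative to the direction 1 + \<i> the two conjugated rays have the arguments - pi / 2
  and pi / 2; their powers add up to the cosine of the functional equation.\<close>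

lemma diagonal_powr_sum:
  "((1 - \<i>) powr s + (- 1 + \<i>) powr s) * (2 * of_real pi * (1 + \<i>)) powr (- s)
     = (2 * of_real pi) powr (- s) * (2 * cos (of_real pi * s / 2))"
proof -
  have nz: "1 - \<i> \<noteq> 0" "- 1 + \<i> \<noteq> 0" "1 + \<i> \<noteq> 0" by (simp_all add: complex_eq_iff)
  define L where "L = complex_of_real (ln (sqrt 2))"
  have p: "(1 - \<i>) powr s = exp (s * (L + \<i> * of_real (- pi / 4)))"
    "(- 1 + \<i>) powr s = exp (s * (L + \<i> * of_real (3 * pi / 4)))"
    "(1 + \<i>) powr (- s) = exp (- s * (L + \<i> * of_real (pi / 4)))"
    using nz by (simp_all only: powr_def if_False ln_diagonal L_def)
  have "((1 - \<i>) powr s + (- 1 + \<i>) powr s) * (1 + \<i>) powr (- s) = exp (- (\<i> * (of_real pi * s / 2))) + exp (\<i> * (of_real pi * s / 2))"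
    unfolding p distrib_right exp_add[symmetric]
    by (intro arg_cong2[of _ _ _ _ "(+)"] arg_cong[of _ _ exp]) (simp_all add: field_simps)
  also have "\<dots> = 2 * cos (of_real pi * s / 2)"
    by (simp add: cos_exp_eq)
  finally have "((1 - \<i>) powr s + (- 1 + \<i>) powr s) * (1 + \<i>) powr (- s) = 2 * cos (of_real pi * s / 2)" .
  moreover have "(2 * of_real pi * (1 + \<i>)) powr (- s) = (2 * of_real pi) powr (- s) * (1 + \<i>) powr (- s)"
    using powr_times_real_left[of "2 * of_real pi" "1 + \<i>" "- s"] by simp
  ultimately show ?thesis by (simp add: mult_ac)
qed

text \<open>Eliminates the ray integral between \<open>rs_line_plus_zeta\<close> and the conjugate
  of \<open>rs_line_eq_rs_ray\<close>.\<close>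

lemma zeta_series_rs_line:
  assumes s: "2 < Re s"
  shows "2 * cos (of_real pi * s / 2) * (2 * of_real pi) powr (- s) * Gamma s * ((\<Sum>n. 1 / of_nat (Suc n) powr s) + rs_line (1 / 2) s)
     = - cnj (rs_line (1 / 2) (cnj (1 - s)))"
proof -
  define R where "R = cnj (rs_ray (cnj s))"
  define Z where "Z = (\<Sum>n. 1 / of_nat (Suc n) powr s) + rs_line (1 / 2) s"
  have 1: "Gamma s * (2 * of_real pi * (1 + \<i>)) powr (- s) * Z = - R"
    using rs_line_plus_zeta[of s] s by (simp add: R_def Z_def add.commute)
  have "cnj (rs_line (1 / 2) (1 - cnj s)) = cnj (((1 + \<i>) powr (cnj s) + (- 1 - \<i>) powr (cnj s)) * rs_ray (cnj s))"
    using s by (subst rs_line_eq_rs_ray) auto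
  also have "\<dots> = ((1 - \<i>) powr s + (- 1 + \<i>) powr s) * R"
  proof -
    have "cnj ((1 + \<i>) powr (cnj s)) = (1 - \<i>) powr s" "cnj ((- 1 - \<i>) powr (cnj s)) = (- 1 + \<i>) powr s"
      by (subst cnj_powr; simp)+
    then show ?thesis by (simp add: R_def)
  qed
  finally have 2: "cnj (rs_line (1 / 2) (cnj (1 - s))) = ((1 - \<i>) powr s + (- 1 + \<i>) powr s) * R" by simp
  have "- cnj (rs_line (1 / 2) (cnj (1 - s))) = ((1 - \<i>) powr s + (- 1 + \<i>) powr s) * (Gamma s * (2 * of_real pi * (1 + \<i>)) powr (- s) * Z)"
    unfolding 1 2 by simp
  also have "\<dots> = ((1 - \<i>) powr s + (- 1 + \<i>) powr s) * (2 * of_real pi * (1 + \<i>)) powr (- s) * (Gamma s * Z)"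
    by (simp only: mult_ac)
  also have "\<dots> = 2 * cos (of_real pi * s / 2) * (2 * of_real pi) powr (- s) * Gamma s * Z"
    unfolding diagonal_powr_sum by (simp only: mult_ac)
  finally show ?thesis unfolding Z_def by simp
qed

text \<open>The \<chi> of \<zeta>(s) = \<chi>(s) \<zeta>(1 - s) in its symmetric form, which on the
  critical line is a quotient of conjugate Gamma values. With \<open>rGamma\<close>, which is
  entire, the only singularities come from \<open>Gamma ((1 - s) / 2)\<close>.\<close>

definition zeta_chi :: "complex \<Rightarrow> complex" where
  "zeta_chi s = of_real pi powr (s - 1 / 2) * Gamma ((1 - s) / 2) * rGamma (s / 2)"

lemma not_nonpos_Int_half:
  assumes "Re s < 3" "s \<noteq> 1"
  shows "(1 - s) / 2 \<notin> \<int>\<^sub>\<le>\<^sub>0"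
proof
  assume "(1 - s) / 2 \<in> \<int>\<^sub>\<le>\<^sub>0"
  then obtain n where n: "(1 - s) / 2 = - of_nat n" by (auto elim!: nonpos_Ints_cases')
  then have s: "s = 1 + 2 * of_nat n" by (simp add: field_simps)
  then have "real n < 1" using assms(1) by simp
  then show False using s assms(2) by simp
qed

lemma pos_not_nonpos_Int: "0 < Re s \<Longrightarrow> s \<notin> \<int>\<^sub>\<le>\<^sub>0" for s :: complex
  by (auto elim!: nonpos_Ints_cases')

text \<open>Legendre duplication splits Gamma (s) into the values at s / 2 and (s + 1) / 2, and
  reflection at (s + 1) / 2 produces the cosine. The strip lies between the poles s = 1 and s = 3 of
  Gamma ((1 - s) / 2).\<close>

lemma zeta_chi_mult:
  assumes s: "1 < Re s" "Re s < 3"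
  shows "zeta_chi s * (2 * cos (of_real pi * s / 2) * (2 * of_real pi) powr (- s) * Gamma s) = 1"
proof -
  have np: "s / 2 \<notin> \<int>\<^sub>\<le>\<^sub>0" "s / 2 + 1 / 2 \<notin> \<int>\<^sub>\<le>\<^sub>0" "(1 - s) / 2 \<notin> \<int>\<^sub>\<le>\<^sub>0"
  proof -
    have "s \<noteq> 1" using s by auto
    then show "(1 - s) / 2 \<notin> \<int>\<^sub>\<le>\<^sub>0" using s by (intro not_nonpos_Int_half)
  qed (use s in \<open>auto intro!: pos_not_nonpos_Int\<close>)
  define G1 G2 G3 where "G1 = Gamma (s / 2)" and "G2 = Gamma (s / 2 + 1 / 2)" and "G3 = Gamma ((1 - s) / 2)"
  define c where "c = cos (of_real pi * s / 2)"
  have nz: "G1 \<noteq> 0" "G2 \<noteq> 0" "G3 \<noteq> 0"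
    using np by (auto simp: G1_def G2_def G3_def Gamma_eq_zero_iff)
  have rG: "rGamma (s / 2) = 1 / G1" unfolding G1_def rGamma_inverse_Gamma by (rule inverse_eq_divide)
  have leg: "G1 * G2 = exp ((1 - s) * of_real (ln 2)) * of_real (sqrt pi) * Gamma s"
    using Gamma_legendre_duplication[OF np(1,2)] by (simp add: G1_def G2_def)
  have "G2 * G3 = of_real pi / sin (of_real pi * (s / 2 + 1 / 2))"
    using Gamma_reflection_complex[of "s / 2 + 1 / 2"] by (simp add: G2_def G3_def diff_divide_distrib)
  also have "sin (of_real pi * (s / 2 + 1 / 2)) = c"
    using sin_cos_eq[of "of_real pi * (s / 2 + 1 / 2)"] cos_minus[of "of_real pi * s / 2"]
    by (simp add: c_def algebra_simps)
  finally have refl: "G2 * G3 = of_real pi / c" .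
  then have c0: "c \<noteq> 0" using nz by auto
  have pw: "of_real pi powr (s - 1 / 2) = exp ((s - 1 / 2) * of_real (ln pi))"
    "(2 * of_real pi) powr (- s) = exp (- s * (of_real (ln 2) + of_real (ln pi)))"
    using Ln_of_real[of "2 * pi"] by (simp_all add: powr_def Ln_of_real ln_mult)
  have sp: "of_real (sqrt pi) = exp (of_real (ln pi) / 2 :: complex)"
  proof -
    have "sqrt pi = exp (ln pi / 2)" by (simp add: powr_half_sqrt[symmetric] powr_def)
    then show ?thesis by (simp add: exp_of_real[symmetric])
  qed
  have pi_e: "complex_of_real pi = exp (of_real (ln pi))" by (simp add: exp_of_real)
  have two: "(2 :: complex) = exp (of_real (ln 2))" by (simp add: exp_of_real)
  define l2 lp where "l2 = complex_of_real (ln 2)" and "lp = complex_of_real (ln pi)"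
  have "exp ((1 - s) * l2) * exp (lp / 2) * Gamma s * (G3 * c) = G1 * (G2 * G3 * c)"
    using leg unfolding sp l2_def lp_def by simp
  also have "G2 * G3 * c = exp lp" using refl c0 pi_e by (simp add: lp_def)
  finally have "exp ((1 - s) * l2) * exp (lp / 2) * Gamma s * (G3 * c) / exp ((1 - s) * l2) / exp (lp / 2)
      = G1 * exp lp / exp ((1 - s) * l2) / exp (lp / 2)" by (simp only:)
  then have "Gamma s * G3 * c = G1 * exp (lp - (1 - s) * l2 - lp / 2)"
    by (simp only: exp_diff) (simp add: mult.assoc)
  moreover have "zeta_chi s * (2 * cos (of_real pi * s / 2) * (2 * of_real pi) powr (- s) * Gamma s)
      = exp ((s - 1 / 2) * lp) * exp l2 * exp (- s * (l2 + lp)) * (Gamma s * G3 * c) / G1"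
    unfolding zeta_chi_def rG pw l2_def lp_def c_def[symmetric] G3_def[symmetric]
    by (subst two) (simp only: mult_ac times_divide_eq_right times_divide_eq_left mult_1)
  moreover define E where "E = lp - (1 - s) * l2 - lp / 2"
  ultimately have "zeta_chi s * (2 * cos (of_real pi * s / 2) * (2 * of_real pi) powr (- s) * Gamma s)
      = exp ((s - 1 / 2) * lp) * exp l2 * exp (- s * (l2 + lp)) * (G1 * exp E) / G1"
    by (simp only:)
  also have "\<dots> = exp ((s - 1 / 2) * lp) * exp l2 * exp (- s * (l2 + lp)) * exp E"
    using nz by simp
  also have "\<dots> = exp ((s - 1 / 2) * lp + l2 + - s * (l2 + lp) + E)"
    by (simp only: exp_add)
  also have "(s - 1 / 2) * lp + l2 + - s * (l2 + lp) + E = 0"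
    by (simp add: E_def field_simps)
  finally show ?thesis by simp
qed

section \<open>Continuation of the Dirichlet series\<close>

definition zeta_rs :: "complex \<Rightarrow> complex" where
  "zeta_rs s = - rs_line (1 / 2) s - zeta_chi s * cnj (rs_line (1 / 2) (cnj (1 - s)))"

definition zeta_series :: "complex \<Rightarrow> complex" where
  "zeta_series s = (\<Sum>n. 1 / of_nat (Suc n) powr s)"

text \<open>The lower bound 2 stems from the convergence of the ray integral, the upper bound 3 from
  the pole of \<chi>.\<close>

lemma zeta_series_eq_zeta_rs:
  assumes s: "2 < Re s" "Re s < 3"
  shows "zeta_series s = zeta_rs s"
proof -
  define D where "D = 2 * cos (of_real pi * s / 2) * (2 * of_real pi) powr (- s) * Gamma s"
  have "zeta_chi s * D = 1" using zeta_chi_mult[of s] s by (simp add: D_def)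
  moreover have "D * (zeta_series s + rs_line (1 / 2) s) = - cnj (rs_line (1 / 2) (cnj (1 - s)))"
    using zeta_series_rs_line[of s] s by (simp add: D_def zeta_series_def)
  ultimately have "zeta_series s + rs_line (1 / 2) s = zeta_chi s * - cnj (rs_line (1 / 2) (cnj (1 - s)))"
    by (metis mult.assoc mult_1)
  then have "zeta_series s = zeta_chi s * - cnj (rs_line (1 / 2) (cnj (1 - s))) - rs_line (1 / 2) s"
    by (simp only: eq_diff_eq)
  then show ?thesis by (simp add: zeta_rs_def)
qed

lemma holomorphic_cnj_compose_cnj:
  assumes "f holomorphic_on UNIV"
  shows "(\<lambda>z. cnj (f (cnj z))) holomorphic_on UNIV"
proof -
  have "(\<lambda>z. cnj (f (cnj z))) field_differentiable at z" for z
  proof -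
    obtain D where "(f has_field_derivative D) (at (cnj z))"
      using assms by (auto simp: holomorphic_on_def field_differentiable_def)
    from has_field_derivative_cnj_cnj[OF this]
    show ?thesis by (auto simp: o_def field_differentiable_def)
  qed
  then show ?thesis by (simp add: holomorphic_on_def)
qed

lemma zeta_rs_holomorphic: "zeta_rs holomorphic_on {s. Re s < 3} - {1}"
proof -
  have "(\<lambda>z. cnj (rs_line (1 / 2) (cnj z))) holomorphic_on UNIV"
    by (rule holomorphic_cnj_compose_cnj[OF rs_line_holomorphic])
  then have "(\<lambda>z. cnj (rs_line (1 / 2) (cnj z))) \<circ> (\<lambda>s. 1 - s) holomorphic_on {s. Re s < 3} - {1}"
    by (rule holomorphic_on_compose_gen[rotated]) (auto intro!: holomorphic_intros)
  then have 1: "(\<lambda>s. cnj (rs_line (1 / 2) (cnj (1 - s)))) holomorphic_on {s. Re s < 3} - {1}"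
    by (simp add: o_def)
  have 2: "zeta_chi holomorphic_on {s. Re s < 3} - {1}"
    unfolding zeta_chi_def using not_nonpos_Int_half
    by (intro holomorphic_intros) auto
  show ?thesis unfolding zeta_rs_def
    by (intro holomorphic_on_diff holomorphic_on_minus holomorphic_on_mult 1 2
        holomorphic_on_subset[OF rs_line_holomorphic]) auto
qed

lemma zeta_series_holomorphic: "zeta_series holomorphic_on {s. 1 < Re s}"
proof (rule holomorphic_uniform_sequence[where f = "\<lambda>n s. \<Sum>k<n. 1 / of_nat (Suc k) powr s"])
  show "open {s. 1 < Re s}" by (rule open_halfspace_Re_gt)
  show "(\<lambda>s. \<Sum>k<n. 1 / of_nat (Suc k) powr s) holomorphic_on {s. 1 < Re s}" for n
    by (intro holomorphic_intros) (auto simp del: of_nat_Suc)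
  fix x assume x: "x \<in> {s. 1 < Re s}"
  define d where "d = (Re x - 1) / 2"
  have d: "d > 0" using x by (simp add: d_def)
  have re: "Re y \<ge> 1 + d" if "y \<in> cball x d" for y
  proof -
    have "\<bar>Re (x - y)\<bar> \<le> d" using that abs_Re_le_cmod[of "x - y"] by (simp add: dist_norm)
    then have "Re x - d \<le> Re y" by simp
    then show ?thesis by (simp add: d_def field_simps)
  qed
  have "uniform_limit (cball x d) (\<lambda>n s. \<Sum>k<n. 1 / of_nat (Suc k) powr s) zeta_series sequentially"
    unfolding zeta_series_def
  proof (rule Weierstrass_m_test)
    show "summable (\<lambda>k. norm (1 / of_nat (Suc k) powr (of_real (1 + d) :: complex)))"
      using d by (intro summable_norm_zeta_series) auto
    fix k y assume y: "y \<in> cball x d"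
    have "real (Suc k) powr (1 + d) \<le> real (Suc k) powr Re y"
      using re[OF y] by (intro powr_mono) auto
    then show "norm (1 / of_nat (Suc k) powr y) \<le> norm (1 / of_nat (Suc k) powr (of_real (1 + d) :: complex))"
      by (simp add: norm_divide norm_powr_real_powr divide_left_mono del: of_nat_Suc)
  qed
  then show "\<exists>d. 0 < d \<and> cball x d \<subseteq> {s. 1 < Re s} \<and> uniform_limit (cball x d) (\<lambda>n s. \<Sum>k<n. 1 / of_nat (Suc k) powr s) zeta_series sequentially"
    using d re by (intro exI[of _ d]) force
qed

text \<open>The series lives on Re s > 1, Riemann's formula on Re s < 3 without 1. Their agreement
  on the strip 2 < Re s < 3 spreads to the whole overlap by the identity theorem, so the case
  distinction is holomorphic.\<close>

lemma is_zeta_continuation_glue: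
  "is_zeta_continuation (\<lambda>s. if 1 < Re s then zeta_series s else zeta_rs s)" (is "is_zeta_continuation ?f")
proof -
  have eq: "zeta_series s - zeta_rs s = 0" if "1 < Re s" "Re s < 3" for s
  proof (rule analytic_continuation_open[of "{s. 2 < Re s} \<inter> {s. Re s < 3}" "{s. 1 < Re s} \<inter> {s. Re s < 3}"
      "\<lambda>z. zeta_series z - zeta_rs z" "\<lambda>_. 0"])
    show "open ({s. 2 < Re s} \<inter> {s. Re s < 3})" "open ({s. 1 < Re s} \<inter> {s. Re s < 3})"
      by (intro open_Int open_halfspace_Re_gt open_halfspace_Re_lt)+
    show "connected ({s. 1 < Re s} \<inter> {s. Re s < 3})"
      by (intro convex_connected convex_Int convex_halfspace_Re_gt convex_halfspace_Re_lt)
    have "Complex (5 / 2) 0 \<in> {s. 2 < Re s} \<inter> {s. Re s < 3}" by simp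
    then show "{s. 2 < Re s} \<inter> {s. Re s < 3} \<noteq> {}" by blast
    show "(\<lambda>z. zeta_series z - zeta_rs z) holomorphic_on {s. 1 < Re s} \<inter> {s. Re s < 3}"
      by (intro holomorphic_on_diff holomorphic_on_subset[OF zeta_series_holomorphic]
          holomorphic_on_subset[OF zeta_rs_holomorphic]) auto
  qed (use that zeta_series_eq_zeta_rs in auto)
  have "?f holomorphic_on {s. 1 < Re s} \<union> ({s. Re s < 3} - {1})"
  proof (rule holomorphic_on_Un)
    show "?f holomorphic_on {s. 1 < Re s}"
      using zeta_series_holomorphic by (rule holomorphic_transform) auto
    show "?f holomorphic_on {s. Re s < 3} - {1}"
      using zeta_rs_holomorphic by (rule holomorphic_transform) (use eq in auto)
    show "open {s. 1 < Re s}" by (rule open_halfspace_Re_gt)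
    show "open ({s. Re s < 3} - {1})" by (intro open_Diff open_halfspace_Re_lt) auto
  qed
  moreover have "{s. 1 < Re s} \<union> ({s. Re s < 3} - {1}) = - {1}" by auto
  moreover have "(\<lambda>n. 1 / of_nat (Suc n) powr s) sums zeta_series s" if "1 < Re s" for s
    unfolding zeta_series_def
    using summable_norm_cancel[OF summable_norm_zeta_series[OF that]] by (rule summable_sums)
  ultimately show ?thesis unfolding is_zeta_continuation_def by auto
qed

lemma riemann_zeta_eq_zeta_rs:
  assumes "Re s \<le> 1" "s \<noteq> 1"
  shows "riemann_zeta s = zeta_rs s"
proof -
  have "is_zeta_continuation riemann_zeta"
    unfolding riemann_zeta_def using is_zeta_continuation_glue by (rule someI[where P = is_zeta_continuation])
  from is_zeta_continuation_unique[OF this is_zeta_continuation_glue assms(2)] assms(1)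
  show ?thesis by simp
qed

section \<open>Hardy's function on the critical line\<close>

text \<open>For s = 1/2 + \<i> t the numbers s / 2 and (1 - s) / 2 are conjugate, so the quotient of
  the Gamma values is exp (- 2 \<i> Im (ln_Gamma (s / 2))).\<close>

lemma zeta_chi_critical_line:
  "exp (\<i> * of_real (rs_theta t)) * zeta_chi (1 / 2 + \<i> * of_real t) = exp (- \<i> * of_real (rs_theta t))"
proof -
  define z where "z = 1 / 4 + \<i> * complex_of_real (t / 2)"
  define g where "g = ln_Gamma z"
  have zn: "z \<notin> \<int>\<^sub>\<le>\<^sub>0" by (intro pos_not_nonpos_Int) (simp add: z_def)
  have G: "Gamma z = exp g" using zn by (simp add: g_def Gamma_complex_altdef)
  have "(1 - (1 / 2 + \<i> * of_real t)) / 2 = cnj z" by (simp add: z_def complex_eq_iff)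
  then have G1: "Gamma ((1 - (1 / 2 + \<i> * of_real t)) / 2) = exp (cnj g)"
    using G by (simp add: exp_cnj flip: cnj_Gamma)
  have "(1 / 2 + \<i> * of_real t) / 2 = z" by (simp add: z_def complex_eq_iff)
  then have G2: "rGamma ((1 / 2 + \<i> * of_real t) / 2) = exp (- g)"
    using G by (simp add: rGamma_inverse_Gamma exp_minus)
  have "complex_of_real pi powr (1 / 2 + \<i> * of_real t - 1 / 2) = exp (\<i> * of_real t * of_real (ln pi))"
    by (simp add: powr_def Ln_of_real)
  then have "exp (\<i> * of_real (rs_theta t)) * zeta_chi (1 / 2 + \<i> * of_real t)
     = exp (\<i> * of_real (rs_theta t) + (\<i> * of_real t * of_real (ln pi) + cnj g + - g))"
    unfolding zeta_chi_def G1 G2 by (simp only: exp_add)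
  also have "\<i> * of_real (rs_theta t) + (\<i> * of_real t * of_real (ln pi) + cnj g + - g) = - \<i> * of_real (rs_theta t)"
    by (simp add: complex_eq_iff rs_theta_def g_def z_def field_simps)
  finally show ?thesis .
qed

text \<open>As cnj (1 - s) = s on the critical line, the factor exp (\<i> \<theta>) makes the two
  terms of \<zeta> conjugate to each other. The formula is exact for every \<open>N\<close>; only
  the later choice of \<open>N\<close> makes the line integral small.\<close>

theorem hardy_Z_riemann_siegel:
  "hardy_Z t = of_real (2 * Re (exp (\<i> * of_real (rs_theta t)) *
     ((\<Sum>n = 1..N. of_nat n powr (- (1 / 2 + \<i> * of_real t))) - rs_line (real N + 1 / 2) (1 / 2 + \<i> * of_real t))))"
proof -
  define s where "s = 1 / 2 + \<i> * complex_of_real t"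
  define e where "e = exp (\<i> * complex_of_real (rs_theta t))"
  define B where "B = - rs_line (1 / 2) s"
  have cs: "cnj (1 - s) = s" by (simp add: s_def complex_eq_iff)
  have s1: "s \<noteq> 1" "Re s \<le> 1" by (auto simp: s_def complex_eq_iff)
  have "riemann_zeta s = B + zeta_chi s * cnj B"
    unfolding B_def riemann_zeta_eq_zeta_rs[OF s1(2,1)] zeta_rs_def cs complex_cnj_minus mult_minus_right
    by (rule diff_conv_add_uminus)
  have "hardy_Z t = e * B + e * zeta_chi s * cnj B"
  proof -
    have "hardy_Z t = e * riemann_zeta s" by (simp only: hardy_Z_def e_def s_def)
    then show ?thesis using \<open>riemann_zeta s = B + zeta_chi s * cnj B\<close> by (simp add: distrib_left)
  qed
  also have "e * zeta_chi s = cnj e"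
    using zeta_chi_critical_line[of t] by (simp add: e_def s_def exp_cnj)
  also have "e * B + cnj e * cnj B = of_real (2 * Re (e * B))"
    by (simp add: complex_eq_iff)
  also have "B = (\<Sum>n = 1..N. of_nat n powr (- s)) - rs_line (real N + 1 / 2) s"
    unfolding B_def by (rule rs_line_half_conv)
  finally show ?thesis unfolding e_def s_def .
qed

section \<open>The approximate functional equation\<close>

lemma has_real_derivative_Arg_slant:
  assumes "a > 0"
  shows "((\<lambda>v. Im (ln (slant a v))) has_real_derivative a / ((a + v)\<^sup>2 + v\<^sup>2)) (at v)"
proof -
  have nz: "slant a v \<notin> \<real>\<^sub>\<le>\<^sub>0" using assms by (intro slant_not_nonpos) auto
  have "(slant a has_vector_derivative (1 + \<i>)) (at v)"
    unfolding slant_def[abs_def] has_vector_derivative_def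
    by (auto intro!: derivative_eq_intros simp: scaleR_conv_of_real)
  moreover have "(ln has_field_derivative inverse (slant a v)) (at (slant a v))"
    using nz by (rule has_field_derivative_Ln)
  ultimately have "((ln \<circ> slant a) has_vector_derivative (1 + \<i>) * inverse (slant a v)) (at v)"
    by (rule field_vector_diff_chain_at)
  then have "((\<lambda>v. Im ((ln \<circ> slant a) v)) has_vector_derivative Im ((1 + \<i>) * inverse (slant a v))) (at v)"
    by (rule bounded_linear.has_vector_derivative[OF bounded_linear_Im])
  moreover have "Im ((1 + \<i>) * inverse (slant a v)) = a / ((a + v)\<^sup>2 + v\<^sup>2)"
    unfolding divide_inverse[symmetric] by (simp add: Im_divide)
  ultimately show ?thesis
    by (simp add: has_real_derivative_iff_has_vector_derivative o_def)
qed

text \<open>On the line of direction \<open>1 + \<i>\<close> through a point close to the saddle \<open>\<alpha>\<close> the integrand decays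
  like a Gaussian, up to a factor \<open>exp (O(v))\<close> that comes from missing the saddle by a bounded amount.\<close>

lemma saddle_exponent_bound:
  fixes a \<alpha> v :: real
  assumes a: "1 \<le> a" and \<alpha>: "\<bar>a - \<alpha>\<bar> \<le> 3" "0 \<le> \<alpha>"
  shows "2 * pi * \<alpha>\<^sup>2 * Im (ln (slant a v)) - 2 * pi * a * v - 2 * pi * v\<^sup>2 \<le> 2 * pi * (30 * \<bar>v\<bar> - v\<^sup>2 / 2)"
proof -
  define D where "D = (\<lambda>v. (a + v)\<^sup>2 + v\<^sup>2)"
  define \<phi> where "\<phi> = (\<lambda>v. 2 * pi * \<alpha>\<^sup>2 * Im (ln (slant a v)) - 2 * pi * a * v - 2 * pi * v\<^sup>2)"
  define \<phi>' where "\<phi>' = (\<lambda>v. 2 * pi * (\<alpha>\<^sup>2 * a / D v - a - 2 * v))"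
  have D: "a\<^sup>2 / 2 \<le> D v" for v
  proof -
    have "0 \<le> (a + 2 * v)\<^sup>2" by simp
    then show ?thesis by (simp add: D_def power2_eq_square algebra_simps)
  qed
  have a2: "0 < a\<^sup>2 / 2" using a by simp
  have D0: "0 < D v" for v using D[of v] a2 by linarith
  have der: "(\<phi> has_real_derivative \<phi>' v) (at v)" for v
  proof -
    define A where "A = (\<lambda>v. Im (ln (slant a v)))"
    have "(A has_real_derivative a / D v) (at v)"
      unfolding A_def D_def using a by (intro has_real_derivative_Arg_slant) auto
    then have "((\<lambda>v. 2 * pi * \<alpha>\<^sup>2 * A v - 2 * pi * a * v - 2 * pi * v\<^sup>2) has_real_derivative \<phi>' v) (at v)"
      unfolding \<phi>'_def by (auto intro!: derivative_eq_intros simp: algebra_simps)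
    then show ?thesis by (simp only: \<phi>_def A_def)
  qed
  \<comment> \<open>The derivative is split into \<open>e\<close>, which vanishes when the line
    passes through the saddle, and a restoring term - 2 v q with q \<ge> 1/2. From \<bar>a -
    \<alpha>\<bar> \<le> 3 and \<alpha> + a \<le> 5 a one gets \<bar>e\<bar> \<le> 15 a^2 / D \<le>
    30.\<close>
  define e where "e = (\<lambda>v. a * (\<alpha>\<^sup>2 - a\<^sup>2) / D v)"
  define q where "q = (\<lambda>v. 1 + a * (a + v) / D v)"
  have dec: "\<alpha>\<^sup>2 * a / D v - a - 2 * v = e v - 2 * v * q v" for v
  proof -
    have "a = a * D v / D v" using D0[of v] by simp
    moreover have "D v = a\<^sup>2 + 2 * a * v + 2 * v\<^sup>2" by (simp add: D_def power2_eq_square algebra_simps)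
    then have "a * D v = a * a\<^sup>2 + 2 * v * (a * (a + v))" by (simp add: power2_eq_square algebra_simps)
    ultimately have "a = (a * a\<^sup>2 + 2 * v * (a * (a + v))) / D v" by simp
    then show ?thesis unfolding e_def q_def
      by (simp add: add_divide_distrib diff_divide_distrib algebra_simps)
  qed
  have e: "\<bar>e v\<bar> \<le> 30" for v
  proof -
    have "\<bar>\<alpha>\<^sup>2 - a\<^sup>2\<bar> = \<bar>a - \<alpha>\<bar> * (\<alpha> + a)"
      using a \<alpha> by (simp add: power2_eq_square square_diff_square_factored abs_mult abs_minus_commute)
    also have "\<dots> \<le> 3 * (5 * a)" using a \<alpha> by (intro mult_mono) auto
    finally have "\<bar>a * (\<alpha>\<^sup>2 - a\<^sup>2)\<bar> \<le> a * (15 * a)" using a by (simp add: abs_mult)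
    also have "\<dots> \<le> 30 * D v" using D[of v] by (simp add: power2_eq_square)
    finally show ?thesis unfolding e_def using D0[of v] by (simp add: abs_divide divide_le_eq)
  qed
  have q: "1 / 2 \<le> q v" for v
  proof -
    have "D v + 2 * (a * (a + v)) = 2 * (v + a)\<^sup>2 + a\<^sup>2" by (simp add: D_def power2_eq_square algebra_simps)
    then have "0 \<le> D v + 2 * (a * (a + v))" by simp
    then have "- (1 / 2) \<le> a * (a + v) / D v" using D0[of v] by (simp add: field_simps)
    then show ?thesis unfolding q_def by linarith
  qed
  have \<phi>0: "\<phi> 0 = 0"
  proof -
    have "slant a 0 = of_real a" by (simp add: slant_def)
    then show ?thesis using a by (simp add: \<phi>_def Ln_of_real)
  qed
  show ?thesis
  proof (cases "v \<ge> 0")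
    case True
    have "\<phi> v - 2 * pi * (30 * v - v\<^sup>2 / 2) \<le> \<phi> 0 - 2 * pi * (30 * 0 - 0\<^sup>2 / 2)"
    proof (rule DERIV_nonpos_imp_nonincreasing[OF True])
      fix x assume x: "0 \<le> x" "x \<le> v"
      have "e x - 2 * x * q x \<le> 30 - x"
        using e[of x] mult_left_mono[OF q[of x], of "2 * x"] x by auto
      then have "2 * pi * (e x - 2 * x * q x) \<le> 2 * pi * (30 - x)" by (intro mult_left_mono) auto
      then have "\<phi>' x - 2 * pi * (30 - x) \<le> 0" unfolding \<phi>'_def dec by simp
      moreover have "((\<lambda>v. \<phi> v - 2 * pi * (30 * v - v\<^sup>2 / 2)) has_real_derivative \<phi>' x - 2 * pi * (30 - x)) (at x)"
        by (auto intro!: derivative_eq_intros der)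
      ultimately show "\<exists>y. ((\<lambda>v. \<phi> v - 2 * pi * (30 * v - v\<^sup>2 / 2)) has_real_derivative y) (at x) \<and> y \<le> 0" by blast
    qed
    then have "\<phi> v \<le> 2 * pi * (30 * \<bar>v\<bar> - v\<^sup>2 / 2)" using True \<phi>0 by simp
    then show ?thesis by (simp only: \<phi>_def)
  next
    case False
    then have v: "v \<le> 0" by simp
    have "\<phi> v - 2 * pi * (- 30 * v - v\<^sup>2 / 2) \<le> \<phi> 0 - 2 * pi * (- 30 * 0 - 0\<^sup>2 / 2)"
    proof (rule DERIV_nonneg_imp_nondecreasing[OF v])
      fix x assume x: "v \<le> x" "x \<le> 0"
      have "- 30 - x \<le> e x - 2 * x * q x"
        using e[of x] mult_left_mono[OF q[of x], of "- 2 * x"] x by auto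
      then have "2 * pi * (- 30 - x) \<le> 2 * pi * (e x - 2 * x * q x)" by (intro mult_left_mono) auto
      then have "0 \<le> \<phi>' x - 2 * pi * (- 30 - x)" unfolding \<phi>'_def dec by simp
      moreover have "((\<lambda>v. \<phi> v - 2 * pi * (- 30 * v - v\<^sup>2 / 2)) has_real_derivative \<phi>' x - 2 * pi * (- 30 - x)) (at x)"
        by (auto intro!: derivative_eq_intros der)
      ultimately show "\<exists>y. ((\<lambda>v. \<phi> v - 2 * pi * (- 30 * v - v\<^sup>2 / 2)) has_real_derivative y) (at x) \<and> 0 \<le> y" by blast
    qed
    then have "\<phi> v \<le> 2 * pi * (30 * \<bar>v\<bar> - v\<^sup>2 / 2)" using v \<phi>0 by simp
    then show ?thesis by (simp only: \<phi>_def)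
  qed
qed

text \<open>With t = 2 pi \<alpha>^2 the modulus of x^(-s) is \<bar>x\<bar>^(-1/2) exp (2 pi
  \<alpha>^2 arg x), whose exponential is governed by \<open>saddle_exponent_bound\<close>. The
  algebraic factor is harmless because the line keeps at least the distance a / 2 from 0.\<close>

lemma norm_rs_line_le:
  fixes t :: real and N :: nat
  assumes N: "1 \<le> N" and t: "0 \<le> t" "\<bar>real N + 1 / 2 - sqrt (t / (2 * pi))\<bar> \<le> 3"
  shows "norm (rs_line (real N + 1 / 2) (1 / 2 + \<i> * of_real t))
     \<le> 2 * sqrt pi * exp ((60 * pi)\<^sup>2 / 4) * ((real N + 1 / 2) / 2) powr (- 1 / 2)"
proof -
  define a where "a = real N + 1 / 2"
  define \<alpha> where "\<alpha> = sqrt (t / (2 * pi))"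
  define s where "s = 1 / 2 + \<i> * complex_of_real t"
  define f where "f = (\<lambda>v. slant a v powr (- s) * exp (\<i> * of_real pi * (slant a v)\<^sup>2) / (2 * \<i>) / sin (of_real pi * slant a v))"
  define K where "K = exp ((60 * pi)\<^sup>2 / 4) * (a / 2) powr (- 1 / 2)"
  have a1: "1 \<le> a" using N by (simp add: a_def)
  have \<alpha>2: "2 * pi * \<alpha>\<^sup>2 = t" using t by (simp add: \<alpha>_def)
  have \<alpha>: "\<bar>a - \<alpha>\<bar> \<le> 3" "0 \<le> \<alpha>" using t by (auto simp: a_def \<alpha>_def)
  have bound: "norm (f v) \<le> K * exp (- v\<^sup>2)" for v
  proof -
    define x where "x = slant a v"
    have x: "Re x = a + v" "Im x = v" by (auto simp: x_def)
    have nx: "a / 2 \<le> norm x"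
    proof (rule power2_le_imp_le)
      have "0 \<le> (a + 2 * v)\<^sup>2 + a\<^sup>2 / 2" by simp
      then show "(a / 2)\<^sup>2 \<le> (norm x)\<^sup>2" unfolding cmod_power2 x
        by (simp add: power2_eq_square algebra_simps)
    qed simp
    have x0: "x \<noteq> 0" using nx a1 by auto
    have "1 \<le> norm (sin (of_real pi * x))" using norm_sin_half_line[of N v] by (simp add: x_def a_def)
    then have "norm (f v) \<le> norm (x powr (- s)) * norm (exp (\<i> * of_real pi * x\<^sup>2)) / 1 / 1"
      unfolding f_def x_def[symmetric] norm_divide norm_mult by (intro frac_le) auto
    also have "norm (x powr (- s)) = norm x powr (- 1 / 2) * exp (t * Im (ln x))"
      using x0 by (simp add: norm_powr_complex s_def Arg_eq_Im_Ln)
    also have "norm (exp (\<i> * of_real pi * x\<^sup>2)) = exp (- 2 * pi * a * v - 2 * pi * v\<^sup>2)"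
      unfolding norm_exp_pi_i_square x by simp
    also have "norm x powr (- 1 / 2) * exp (t * Im (ln x)) * exp (- 2 * pi * a * v - 2 * pi * v\<^sup>2) / 1 / 1
       = norm x powr (- 1 / 2) * exp (2 * pi * \<alpha>\<^sup>2 * Im (ln (slant a v)) - 2 * pi * a * v - 2 * pi * v\<^sup>2)"
      unfolding \<alpha>2 x_def by (simp add: mult.assoc flip: exp_add)
    also have "\<dots> \<le> (a / 2) powr (- 1 / 2) * exp (2 * pi * (30 * \<bar>v\<bar> - v\<^sup>2 / 2))"
      using nx a1 saddle_exponent_bound[OF a1 \<alpha>] by (intro mult_mono powr_mono2') auto
    also have "\<dots> \<le> (a / 2) powr (- 1 / 2) * (exp ((60 * pi)\<^sup>2 / 4) * exp (- v\<^sup>2))"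
    proof (intro mult_left_mono)
      have "2 * v\<^sup>2 \<le> pi * v\<^sup>2" using pi_gt3 by (intro mult_right_mono) auto
      then have "exp (2 * pi * (30 * \<bar>v\<bar> - v\<^sup>2 / 2)) \<le> exp (60 * pi * \<bar>v\<bar> - 2 * v\<^sup>2)"
        by (simp add: algebra_simps)
      also have "\<dots> \<le> exp ((60 * pi)\<^sup>2 / 4) * exp (- v\<^sup>2)" by (rule exp_linear_le_gaussian)
      finally show "exp (2 * pi * (30 * \<bar>v\<bar> - v\<^sup>2 / 2)) \<le> exp ((60 * pi)\<^sup>2 / 4) * exp (- v\<^sup>2)" .
    qed simp
    finally show ?thesis by (simp add: K_def mult_ac)
  qed
  have K0: "0 \<le> K" by (simp add: K_def)
  have "norm (\<integral>v. f v \<partial>lborel) \<le> (\<integral>v. K * exp (- v\<^sup>2) \<partial>lborel)"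
  proof (cases "integrable lborel f")
    case True
    then show ?thesis using bound integrable_gaussian
      by (intro Bochner_Integration.integral_norm_bound_integral) auto
  next
    \<comment> \<open>The integral of a non-integrable function is 0 by convention, so the bound
      holds in this case too.\<close>
    case False
    then show ?thesis using K0 by (simp add: not_integrable_integral_eq)
  qed
  also have "\<dots> = K * sqrt pi"
    using has_bochner_integral_gaussian by (simp add: has_bochner_integral_integral_eq)
  finally have I: "norm (\<integral>v. f v \<partial>lborel) \<le> K * sqrt pi" .
  have "norm (1 + \<i>) \<le> 2" using norm_triangle_ineq[of 1 \<i>] by simp
  then have "norm (rs_line a s) \<le> 2 * (K * sqrt pi)"
    unfolding rs_line_def norm_mult f_def[symmetric] using I by (intro mult_mono) auto
  then show ?thesis by (simp add: K_def a_def s_def mult_ac)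
qed

text \<open>The bounded freedom in \<open>N\<close> allows one and the same \<open>N\<close> for all points of a short interval.\<close>

theorem hardy_Z_approx:
  obtains C where "0 < C" "\<And>t N. 300 \<le> t \<Longrightarrow> \<bar>real N + 1 / 2 - sqrt (t / (2 * pi))\<bar> \<le> 3 \<Longrightarrow>
    norm (hardy_Z t - of_real (2 * Re (exp (\<i> * of_real (rs_theta t)) *
      (\<Sum>n = 1..N. of_nat n powr (- (1 / 2 + \<i> * of_real t)))))) \<le> C * t powr (- 1 / 4)"
proof
  define C0 where "C0 = 2 * sqrt pi * exp ((60 * pi)\<^sup>2 / 4)"
  define C where "C = 2 * C0 * (1 / (4 * sqrt (2 * pi))) powr (- 1 / 2)"
  have C0: "C0 > 0" by (simp add: C0_def)
  show "0 < C" using C0 by (simp add: C_def)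
  fix t :: real and N :: nat
  assume t: "300 \<le> t" and N: "\<bar>real N + 1 / 2 - sqrt (t / (2 * pi))\<bar> \<le> 3"
  define a where "a = real N + 1 / 2"
  define \<alpha> where "\<alpha> = sqrt (t / (2 * pi))"
  define s where "s = 1 / 2 + \<i> * complex_of_real t"
  define e where "e = exp (\<i> * complex_of_real (rs_theta t))"
  define S where "S = (\<Sum>n = 1..N. of_nat n powr (- s))"
  \<comment> \<open>The threshold 300 exceeds 36 * 8 > 36 * 2 pi. Then \<alpha> \<ge> 6, hence
    \<alpha> - 3 \<ge> \<alpha> / 2, so the permitted deviation of \<open>N\<close> keeps the line
    at height comparable to \<alpha>.\<close>
  have "6\<^sup>2 * (2 * pi) \<le> t" using t pi_less_4 by simp
  then have "6\<^sup>2 \<le> t / (2 * pi)" by (simp add: field_simps)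
  then have \<alpha>6: "6 \<le> \<alpha>" unfolding \<alpha>_def by (intro real_le_rsqrt)
  have a\<alpha>: "\<alpha> / 2 \<le> a" using N \<alpha>6 unfolding a_def \<alpha>_def by linarith
  have N1: "1 \<le> N" using N \<alpha>6 unfolding \<alpha>_def by linarith
  have e1: "norm e = 1" by (simp add: e_def)
  have "hardy_Z t - of_real (2 * Re (e * S)) = - of_real (2 * Re (e * rs_line a s))"
    unfolding hardy_Z_riemann_siegel[of t N] s_def[symmetric] e_def[symmetric] S_def[symmetric] a_def[symmetric]
    by (simp add: right_diff_distrib)
  then have "norm (hardy_Z t - of_real (2 * Re (e * S))) = \<bar>2 * Re (e * rs_line a s)\<bar>"
    by (simp only: norm_minus_cancel norm_of_real)
  also have "\<dots> = 2 * \<bar>Re (e * rs_line a s)\<bar>" by (simp only: abs_mult abs_numeral)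
  also have "\<dots> \<le> 2 * norm (e * rs_line a s)" by (intro mult_left_mono abs_Re_le_cmod) simp
  also have "\<dots> = 2 * norm (rs_line a s)" by (simp add: norm_mult e1)
  also have "\<dots> \<le> 2 * (C0 * (a / 2) powr (- 1 / 2))"
    using norm_rs_line_le[OF N1 _ N] t by (simp add: C0_def a_def s_def)
  also have "\<dots> \<le> 2 * (C0 * (\<alpha> / 4) powr (- 1 / 2))"
    using a\<alpha> \<alpha>6 C0 by (intro mult_left_mono powr_mono2') auto
  also have "\<alpha> / 4 = (1 / (4 * sqrt (2 * pi))) * t powr (1 / 2)"
    using t by (simp add: \<alpha>_def real_sqrt_divide powr_half_sqrt)
  also have "2 * (C0 * ((1 / (4 * sqrt (2 * pi))) * t powr (1 / 2)) powr (- 1 / 2)) = C * t powr (- 1 / 4)"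
  proof -
    have pp: "(c * t powr (1 / 2)) powr (- 1 / 2) = c powr (- 1 / 2) * t powr (- 1 / 4)" if "0 \<le> c" for c
      using that t by (simp add: powr_mult powr_powr)
    have "((1 / (4 * sqrt (2 * pi))) * t powr (1 / 2)) powr (- 1 / 2) = (1 / (4 * sqrt (2 * pi))) powr (- 1 / 2) * t powr (- 1 / 4)"
      by (rule pp) simp
    then show ?thesis by (simp only: C_def mult.assoc)
  qed
  finally show "norm (hardy_Z t - of_real (2 * Re (exp (\<i> * of_real (rs_theta t)) *
      (\<Sum>n = 1..N. of_nat n powr (- (1 / 2 + \<i> * of_real t)))))) \<le> C * t powr (- 1 / 4)"
    by (simp only: e_def S_def s_def)
qed

section \<open>The Riemann--Siegel theta function and Gram points\<close>

text \<open>With p = n + y one has 2 (n^2 + y^2) \<ge> p^2 \<ge> p (p - 1), which bounds each term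
  by a telescoping difference.\<close>

lemma sum_inverse_square_le:
  fixes y :: real
  assumes y: "2 \<le> y"
  shows "(\<Sum>n<m. 1 / ((real n)\<^sup>2 + y\<^sup>2)) \<le> 4 / y"
proof -
  have "(\<Sum>n<m. 1 / ((real n)\<^sup>2 + y\<^sup>2)) \<le> (\<Sum>n<m. 2 / (real n + y - 1) - 2 / (real (Suc n) + y - 1))"
  proof (rule sum_mono)
    fix n
    define p where "p = real n + y"
    have p: "2 \<le> p" using y by (simp add: p_def)
    have "0 \<le> (real n - y)\<^sup>2" by simp
    then have "p\<^sup>2 \<le> 2 * ((real n)\<^sup>2 + y\<^sup>2)" by (simp add: p_def power2_eq_square algebra_simps)
    moreover have "(p - 1) * p \<le> p\<^sup>2" using p by (simp add: power2_eq_square algebra_simps)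
    ultimately have le: "(p - 1) * p \<le> 2 * ((real n)\<^sup>2 + y\<^sup>2)" by linarith
    have pos: "0 < (p - 1) * p" using p by (intro mult_pos_pos) auto
    have "1 / ((real n)\<^sup>2 + y\<^sup>2) = 2 / (2 * ((real n)\<^sup>2 + y\<^sup>2))"
    proof -
      have "1 / X = 2 / (2 * X)" for X :: real by simp
      then show ?thesis .
    qed
    also have "\<dots> \<le> 2 / ((p - 1) * p)" using le pos by (intro divide_left_mono mult_pos_pos[of "(p - 1) * p"]) auto
    also have "\<dots> = 2 / (p - 1) - 2 / p" using p by (simp add: field_simps)
    finally show "1 / ((real n)\<^sup>2 + y\<^sup>2) \<le> 2 / (real n + y - 1) - 2 / (real (Suc n) + y - 1)"
      by (simp add: p_def algebra_simps)
  qed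
  also have "\<dots> = 2 / (y - 1) - 2 / (real m + y - 1)"
    by (subst sum_lessThan_telescope') simp
  also have "\<dots> \<le> 2 / (y - 1)" using y by simp
  also have "\<dots> \<le> 4 / y" using y by (simp add: field_simps)
  finally show ?thesis .
qed

text \<open>The Digamma series is compared with the telescoping sum of \<open>ln (1 + 1 / (z + n))\<close>.\<close>

lemma Re_Digamma_approx:
  fixes y :: real
  assumes y: "2 \<le> \<bar>y\<bar>"
  shows "\<bar>Re (Digamma (1 / 4 + \<i> * of_real y)) - ln \<bar>y\<bar>\<bar> \<le> 9 / \<bar>y\<bar>"
proof -
  define z where "z = 1 / 4 + \<i> * complex_of_real y"
  define w where "w = (\<lambda>n::nat. 1 / (z + of_nat n))"
  have nz: "z + of_nat n \<noteq> 0" for n using y by (auto simp: z_def complex_eq_iff)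
  have nsq: "(real n)\<^sup>2 + y\<^sup>2 \<le> (norm (z + of_nat n))\<^sup>2" for n
  proof -
    have "(norm (z + of_nat n))\<^sup>2 = (1 / 4 + real n)\<^sup>2 + y\<^sup>2" by (simp add: cmod_power2 z_def)
    moreover have "(real n)\<^sup>2 \<le> (1 / 4 + real n)\<^sup>2" by (intro power_mono) auto
    ultimately show ?thesis by linarith
  qed
  have wsq: "(norm (w n))\<^sup>2 \<le> 1 / ((real n)\<^sup>2 + \<bar>y\<bar>\<^sup>2)" for n
  proof -
    have "0 < (real n)\<^sup>2 + y\<^sup>2" using y by (intro add_nonneg_pos) auto
    then have "1 / (norm (z + of_nat n))\<^sup>2 \<le> 1 / ((real n)\<^sup>2 + y\<^sup>2)"
      using nsq[of n] by (intro divide_left_mono mult_pos_pos) linarith+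
    then show ?thesis by (simp add: w_def norm_divide power_divide)
  qed
  have w2: "norm (w n) \<le> 1 / 2" for n
  proof -
    have "\<bar>y\<bar> \<le> norm (z + of_nat n)" using abs_Im_le_cmod[of "z + of_nat n"] by (simp add: z_def)
    then have "2 \<le> norm (z + of_nat n)" using y by linarith
    then have "1 / norm (z + of_nat n) \<le> 1 / 2" by (intro divide_left_mono) auto
    then show ?thesis by (simp add: w_def norm_divide)
  qed
  \<comment> \<open>Re ln (1 + w) is the increment of ln \<bar>z + n\<bar>, and for \<bar>w\<bar>
    \<le> 1/2 it differs from Re w by at most 2 \<bar>w\<bar>^2, a summable error.\<close>
  have step: "\<bar>Re (w n) - (ln (norm (z + of_nat (Suc n))) - ln (norm (z + of_nat n)))\<bar> \<le> 2 * (1 / ((real n)\<^sup>2 + \<bar>y\<bar>\<^sup>2))" for n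
  proof -
    have e: "1 + w n = (z + of_nat (Suc n)) / (z + of_nat n)" using nz[of n] by (simp add: w_def field_simps)
    have ne: "1 + w n \<noteq> 0" using nz[of n] nz[of "Suc n"] unfolding e by simp
    have "Re (ln (1 + w n)) = ln (norm (z + of_nat (Suc n))) - ln (norm (z + of_nat n))"
      unfolding Re_Ln[OF ne] using nz[of n] nz[of "Suc n"] by (simp add: e norm_divide ln_div del: of_nat_Suc)
    then have "\<bar>Re (w n) - (ln (norm (z + of_nat (Suc n))) - ln (norm (z + of_nat n)))\<bar> = \<bar>Re (ln (1 + w n) - w n)\<bar>"
      by simp
    also have "\<dots> \<le> norm (ln (1 + w n) - w n)" by (rule abs_Re_le_cmod)
    also have "\<dots> \<le> (norm (w n))\<^sup>2 / (1 - norm (w n))"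
      using w2[of n] by (intro Ln_approx_linear) auto
    also have "\<dots> \<le> (norm (w n))\<^sup>2 / (1 / 2)"
      using w2[of n] by (intro divide_left_mono) auto
    also have "\<dots> \<le> 2 * (1 / ((real n)\<^sup>2 + \<bar>y\<bar>\<^sup>2))" using wsq[of n] by simp
    finally show ?thesis .
  qed
  have partial: "\<bar>(\<Sum>n<m. Re (w n)) - (ln (norm (z + of_nat m)) - ln (norm z))\<bar> \<le> 8 / \<bar>y\<bar>" for m
  proof -
    have "(\<Sum>n<m. Re (w n)) - (ln (norm (z + of_nat m)) - ln (norm z))
       = (\<Sum>n<m. Re (w n) - (ln (norm (z + of_nat (Suc n))) - ln (norm (z + of_nat n))))"
      unfolding sum_subtractf[of _ "\<lambda>n. ln (norm (z + of_nat (Suc n))) - ln (norm (z + of_nat n))"]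
      by (subst sum_lessThan_telescope) simp
    also have "\<bar>\<dots>\<bar> \<le> (\<Sum>n<m. 2 * (1 / ((real n)\<^sup>2 + \<bar>y\<bar>\<^sup>2)))"
      by (intro order_trans[OF sum_abs] sum_mono step)
    also have "\<dots> = 2 * (\<Sum>n<m. 1 / ((real n)\<^sup>2 + \<bar>y\<bar>\<^sup>2))" by (simp only: sum_distrib_left)
    also have "\<dots> \<le> 2 * (4 / \<bar>y\<bar>)" using y by (intro mult_left_mono sum_inverse_square_le) auto
    finally show ?thesis by simp
  qed
  have "(\<lambda>m. of_real (ln (real m)) - (\<Sum>n<m. inverse (z + of_nat n))) \<longlonglongrightarrow> Digamma z"
    using y by (intro Digamma_LIMSEQ) (auto simp: z_def complex_eq_iff)
  then have "(\<lambda>m. Re (of_real (ln (real m)) - (\<Sum>n<m. inverse (z + of_nat n)))) \<longlonglongrightarrow> Re (Digamma z)"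
    by (rule tendsto_Re)
  then have L1: "(\<lambda>m. ln (real m) - (\<Sum>n<m. Re (w n))) \<longlonglongrightarrow> Re (Digamma z)"
    by (simp add: w_def inverse_eq_divide)
  have L2: "(\<lambda>m. ln (real m) - (\<Sum>n<m. Re (w n)) - (ln (real m) - ln (norm (z + of_nat m)) + ln (norm z)))
     \<longlonglongrightarrow> Re (Digamma z) - (0 + ln (norm z))"
  proof (intro tendsto_diff L1 tendsto_add tendsto_const)
    have "(\<lambda>m. ln (real m) - ln (sqrt ((1 / 4 + real m)\<^sup>2 + y\<^sup>2))) \<longlonglongrightarrow> 0"
      by real_asymp
    then show "(\<lambda>m. ln (real m) - ln (norm (z + of_nat m))) \<longlonglongrightarrow> 0"
      by (simp add: cmod_def z_def)
  qed
  have "\<bar>Re (Digamma z) - ln (norm z)\<bar> \<le> 8 / \<bar>y\<bar>"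
  proof (rule tendsto_upperbound)
    show "(\<lambda>m. \<bar>ln (real m) - (\<Sum>n<m. Re (w n)) - (ln (real m) - ln (norm (z + of_nat m)) + ln (norm z))\<bar>)
      \<longlonglongrightarrow> \<bar>Re (Digamma z) - ln (norm z)\<bar>"
      using tendsto_rabs[OF L2] by simp
    have "\<bar>ln (real m) - (\<Sum>n<m. Re (w n)) - (ln (real m) - ln (norm (z + of_nat m)) + ln (norm z))\<bar> \<le> 8 / \<bar>y\<bar>" for m
      using partial[of m] by (simp add: abs_le_iff algebra_simps)
    then show "\<forall>\<^sub>F m in sequentially. \<bar>ln (real m) - (\<Sum>n<m. Re (w n)) - (ln (real m) - ln (norm (z + of_nat m)) + ln (norm z))\<bar> \<le> 8 / \<bar>y\<bar>"
      by simp
  qed simp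
  \<comment> \<open>Replacing \<bar>z\<bar> by \<bar>y\<bar> costs the ninth unit of the
    bound.\<close>
  moreover have "\<bar>ln (norm z) - ln \<bar>y\<bar>\<bar> \<le> 1 / \<bar>y\<bar>"
  proof -
    have lo: "\<bar>y\<bar> \<le> norm z" using abs_Im_le_cmod[of z] by (simp add: z_def)
    have hi: "norm z \<le> 1 / 4 + \<bar>y\<bar>" using norm_triangle_ineq[of "1 / 4" "\<i> * complex_of_real y"] by (simp add: z_def norm_mult)
    have "ln (norm z) - ln \<bar>y\<bar> = ln (norm z / \<bar>y\<bar>)" using y lo by (subst ln_div) auto
    also have "\<dots> \<le> norm z / \<bar>y\<bar> - 1" using y lo by (intro ln_le_minus_one divide_pos_pos) auto
    also have "\<dots> \<le> (1 / 4 + \<bar>y\<bar>) / \<bar>y\<bar> - 1" using hi by (intro diff_right_mono divide_right_mono) auto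
    also have "\<dots> \<le> 1 / \<bar>y\<bar>" using y by (simp add: field_simps)
    finally have "ln (norm z) - ln \<bar>y\<bar> \<le> 1 / \<bar>y\<bar>" .
    moreover have "ln \<bar>y\<bar> \<le> ln (norm z)" using y lo by (subst ln_le_cancel_iff) auto
    ultimately show ?thesis by simp
  qed
  ultimately have "\<bar>Re (Digamma z) - ln \<bar>y\<bar>\<bar> \<le> 8 / \<bar>y\<bar> + 1 / \<bar>y\<bar>" by linarith
  then show ?thesis by (simp add: z_def flip: add_divide_distrib)
qed

definition rs_theta_deriv :: "real \<Rightarrow> real" where
  "rs_theta_deriv t = (Re (Digamma (1 / 4 + \<i> * of_real (t / 2))) - ln pi) / 2"

lemma rs_theta_has_derivative: "(rs_theta has_real_derivative rs_theta_deriv t) (at t)"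
proof -
  define z where "z = (\<lambda>t. 1 / 4 + \<i> * complex_of_real (t / 2))"
  have nz: "z t \<notin> \<real>\<^sub>\<le>\<^sub>0" by (auto simp: z_def complex_nonpos_Reals_iff)
  have "(z has_vector_derivative \<i> / 2) (at t)"
    unfolding z_def has_vector_derivative_def
    by (auto intro!: derivative_eq_intros simp: scaleR_conv_of_real)
  moreover have "(ln_Gamma has_field_derivative Digamma (z t)) (at (z t))"
    using nz by (intro has_field_derivative_ln_Gamma_complex)
  ultimately have "((ln_Gamma \<circ> z) has_vector_derivative (\<i> / 2) * Digamma (z t)) (at t)"
    by (rule field_vector_diff_chain_at)
  then have "((\<lambda>t. Im ((ln_Gamma \<circ> z) t)) has_vector_derivative Im ((\<i> / 2) * Digamma (z t))) (at t)"
    by (rule bounded_linear.has_vector_derivative[OF bounded_linear_Im])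
  then have d: "((\<lambda>t. Im (ln_Gamma (z t))) has_real_derivative Re (Digamma (z t)) / 2) (at t)"
    by (simp add: has_real_derivative_iff_has_vector_derivative o_def)
  define g where "g = (\<lambda>t. Im (ln_Gamma (z t)))"
  have "((\<lambda>t. - (t / 2) * ln pi + g t) has_real_derivative rs_theta_deriv t) (at t)"
    using d unfolding g_def[symmetric] rs_theta_deriv_def z_def[symmetric]
    by (auto intro!: derivative_eq_intros simp: z_def field_simps)
  moreover have "rs_theta = (\<lambda>t. - (t / 2) * ln pi + g t)"
    by (simp add: fun_eq_iff rs_theta_def g_def z_def)
  ultimately show ?thesis by simp
qed

lemma rs_theta_deriv_approx:
  assumes t: "4 \<le> \<bar>t\<bar>"
  shows "\<bar>rs_theta_deriv t - ln (\<bar>t\<bar> / (2 * pi)) / 2\<bar> \<le> 9 / \<bar>t\<bar>"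
proof -
  have "\<bar>Re (Digamma (1 / 4 + \<i> * of_real (t / 2))) - ln \<bar>t / 2\<bar>\<bar> \<le> 9 / \<bar>t / 2\<bar>"
    using t by (intro Re_Digamma_approx) auto
  moreover have ln_eq: "ln (\<bar>t\<bar> / (2 * pi)) = ln \<bar>t / 2\<bar> - ln pi"
    using t by (simp add: ln_div ln_mult)
  moreover have "2 * ((R - p) / 2 - (L - p) / 2) = R - L" for R L p :: real by (simp add: field_simps)
  then have "2 * (rs_theta_deriv t - ln (\<bar>t\<bar> / (2 * pi)) / 2) = Re (Digamma (1 / 4 + \<i> * of_real (t / 2))) - ln \<bar>t / 2\<bar>"
    unfolding rs_theta_deriv_def ln_eq .
  ultimately have "\<bar>2 * (rs_theta_deriv t - ln (\<bar>t\<bar> / (2 * pi)) / 2)\<bar> \<le> 2 * (9 / \<bar>t\<bar>)"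
    by simp
  then show ?thesis by (simp only: abs_mult abs_numeral) simp
qed

text \<open>The choice of 300 rests on e^3 \<le> 27 \<le> 300 / 8: half the logarithm is at least
  3/2, and the error 9 / 300 leaves more than 1. Negative \<open>t\<close> are included because
  \<theta> has to reach arbitrarily small values on the left.\<close>

lemma rs_theta_deriv_ge_1:
  assumes t: "300 \<le> \<bar>t\<bar>"
  shows "1 \<le> rs_theta_deriv t"
proof -
  have "exp 3 = (exp 1 :: real) ^ 3" by (simp flip: exp_of_nat_mult)
  also have "\<dots> \<le> 3 ^ 3" using exp_le by (intro power_mono) auto
  also have "\<dots> \<le> \<bar>t\<bar> / (2 * pi)"
  proof -
    have "27 * (2 * pi) \<le> 27 * 8" using pi_less_4 by simp
    then show ?thesis using t by (simp add: field_simps)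
  qed
  finally have "3 \<le> ln (\<bar>t\<bar> / (2 * pi))" using t by (subst ln_ge_iff) (auto intro!: divide_pos_pos)
  moreover have "9 / \<bar>t\<bar> \<le> 9 / 300" using t by (intro divide_left_mono) auto
  ultimately show ?thesis using rs_theta_deriv_approx[of t] t by auto
qed

lemma rs_theta_increment:
  assumes "s \<le> t" "300 \<le> s \<or> t \<le> - 300"
  shows "t - s \<le> rs_theta t - rs_theta s"
proof (cases "s = t")
  case False
  then have "s < t" using assms by simp
  then obtain x where x: "s < x" "x < t" "rs_theta t - rs_theta s = (t - s) * rs_theta_deriv x"
    using MVT2[of s t rs_theta rs_theta_deriv] rs_theta_has_derivative by auto
  have "1 \<le> rs_theta_deriv x" using x assms by (intro rs_theta_deriv_ge_1) auto
  then have "(t - s) * 1 \<le> (t - s) * rs_theta_deriv x" using \<open>s < t\<close> by (intro mult_left_mono) auto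
  then show ?thesis using x by simp
qed simp

section \<open>Existence and location of Gram points\<close>

lemma isCont_rs_theta: "isCont rs_theta t"
  using rs_theta_has_derivative by (rule DERIV_isCont)

lemma rs_theta_eq_bounded: "rs_theta t = x \<Longrightarrow> t \<le> 300 + \<bar>x - rs_theta 300\<bar>"
  using rs_theta_increment[of 300 t] by (cases "t \<le> 300") auto

text \<open>Slope at least 1 outside (-300, 300) forces a solution between \<open>l\<close> and
  \<open>u\<close> and puts all solutions below \<open>u\<close>. From one solution \<open>s\<close>
  on, they form a compact set, which has a maximum.\<close>

lemma Greatest_rs_theta_exists: "\<exists>m. rs_theta m = x \<and> (\<forall>t. rs_theta t = x \<longrightarrow> t \<le> m)"
proof -
  define u where "u = 300 + \<bar>x - rs_theta 300\<bar>"
  define l where "l = - 300 - \<bar>x - rs_theta (- 300)\<bar>"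
  have "rs_theta l \<le> x" using rs_theta_increment[of l "- 300"] by (auto simp: l_def abs_if split: if_splits)
  moreover have "x \<le> rs_theta u" using rs_theta_increment[of 300 u] by (auto simp: u_def abs_if split: if_splits)
  moreover have "l \<le> u" by (simp add: l_def u_def)
  ultimately obtain s where s: "l \<le> s" "s \<le> u" "rs_theta s = x"
    using IVT[of rs_theta l x u] isCont_rs_theta by auto
  define S where "S = {s..u} \<inter> rs_theta -` {x}"
  have "continuous_on {s..u} rs_theta" using continuous_on_rs_theta continuous_on_subset by blast
  then have "closed S" unfolding S_def by (intro continuous_closed_preimage) auto
  then have "compact ({s..u} \<inter> S)" by (intro compact_Int_closed compact_Icc)
  then have "compact S" by (simp add: S_def Int_assoc[symmetric])
  moreover have "s \<in> S" using s by (simp add: S_def)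
  ultimately obtain m where m: "m \<in> S" "\<forall>t\<in>S. t \<le> m" using compact_attains_sup[of S] by auto
  have "t \<le> m" if "rs_theta t = x" for t
  proof (cases "s \<le> t")
    case True
    then have "t \<in> S" using rs_theta_eq_bounded[OF that] that by (simp add: S_def u_def)
    then show ?thesis using m by auto
  next
    case False
    then show ?thesis using m \<open>s \<in> S\<close> by force
  qed
  then show ?thesis using m by (auto simp: S_def)
qed

lemma rs_theta_gram_pt: "rs_theta (gram_pt \<nu> \<tau>) = pi * of_int \<nu> + \<tau>"
proof -
  obtain m where m: "rs_theta m = pi * of_int \<nu> + \<tau>" "\<And>t. rs_theta t = pi * of_int \<nu> + \<tau> \<Longrightarrow> t \<le> m"
    using Greatest_rs_theta_exists[of "pi * of_int \<nu> + \<tau>"] by auto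
  then have "gram_pt \<nu> \<tau> = m" unfolding gram_pt_def by (intro Greatest_equality) auto
  then show ?thesis using m by simp
qed

text \<open>Beyond 300 the function \<theta> increases strictly, so a solution found there is
  automatically the greatest one.\<close>

lemma gram_pt_eqI:
  assumes t: "300 \<le> t" "rs_theta t = pi * of_int \<nu> + \<tau>"
  shows "gram_pt \<nu> \<tau> = t"
  unfolding gram_pt_def
proof (rule Greatest_equality)
  fix s assume "rs_theta s = pi * of_int \<nu> + \<tau>"
  then show "s \<le> t" using rs_theta_increment[of t s] t by (cases "s \<le> t") auto
qed (use t in auto)

lemma gram_pt_in_interval:
  assumes "300 \<le> a" "a \<le> b" "rs_theta a \<le> pi * of_int \<nu> + \<tau>" "pi * of_int \<nu> + \<tau> \<le> rs_theta b"
  shows "gram_pt \<nu> \<tau> \<in> {a..b}"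
proof -
  obtain s where "a \<le> s" "s \<le> b" "rs_theta s = pi * of_int \<nu> + \<tau>"
    using IVT[of rs_theta a "pi * of_int \<nu> + \<tau>" b] isCont_rs_theta assms by auto
  then show ?thesis using gram_pt_eqI[of s \<nu> \<tau>] assms by auto
qed

lemma gram_index_set:
  assumes "300 \<le> a" "a \<le> b"
  shows "{\<nu>. a \<le> gram_pt \<nu> 0 \<and> gram_pt \<nu> 0 \<le> b} = {\<lceil>rs_theta a / pi\<rceil>..\<lfloor>rs_theta b / pi\<rfloor>}"
proof (intro set_eqI)
  fix \<nu> :: int
  have "a \<le> gram_pt \<nu> 0 \<and> gram_pt \<nu> 0 \<le> b \<longleftrightarrow> rs_theta a \<le> pi * of_int \<nu> \<and> pi * of_int \<nu> \<le> rs_theta b"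
  proof
    assume g: "a \<le> gram_pt \<nu> 0 \<and> gram_pt \<nu> 0 \<le> b"
    then show "rs_theta a \<le> pi * of_int \<nu> \<and> pi * of_int \<nu> \<le> rs_theta b"
      using rs_theta_increment[of a "gram_pt \<nu> 0"] rs_theta_increment[of "gram_pt \<nu> 0" b] assms rs_theta_gram_pt[of \<nu> 0]
      by auto
  next
    assume "rs_theta a \<le> pi * of_int \<nu> \<and> pi * of_int \<nu> \<le> rs_theta b"
    then show "a \<le> gram_pt \<nu> 0 \<and> gram_pt \<nu> 0 \<le> b"
      using gram_pt_in_interval[of a b \<nu> 0] assms by auto
  qed
  also have "\<dots> \<longleftrightarrow> rs_theta a / pi \<le> of_int \<nu> \<and> of_int \<nu> \<le> rs_theta b / pi"
    by (simp add: divide_le_eq le_divide_eq mult.commute)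
  finally show "\<nu> \<in> {\<nu>. a \<le> gram_pt \<nu> 0 \<and> gram_pt \<nu> 0 \<le> b} \<longleftrightarrow> \<nu> \<in> {\<lceil>rs_theta a / pi\<rceil>..\<lfloor>rs_theta b / pi\<rfloor>}"
    by (simp add: ceiling_le_iff le_floor_iff)
qed

section \<open>Sums over Gram points\<close>

lemma norm_iexp_minus_1_le: "norm (exp (\<i> * of_real x) - 1) \<le> \<bar>x\<bar>" for x :: real
  using iexp_approx1[of x 0] by simp

lemma norm_iexp_minus_1_minus_le: "norm (exp (\<i> * of_real x) - 1 - \<i> * of_real x) \<le> x\<^sup>2 / 2" for x :: real
  using iexp_approx1[of x 1] by (simp add: algebra_simps power2_eq_square)

lemma norm_iexp_diff_le: "norm (exp (\<i> * of_real x) - exp (\<i> * of_real y)) \<le> \<bar>x - y\<bar>" for x y :: real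
proof -
  have "exp (\<i> * of_real x) - exp (\<i> * of_real y) = exp (\<i> * of_real y) * (exp (\<i> * of_real (x - y)) - 1)"
    by (simp add: right_diff_distrib flip: exp_add)
  then have "norm (exp (\<i> * of_real x) - exp (\<i> * of_real y)) = norm (exp (\<i> * of_real (x - y)) - 1)"
    by (simp add: norm_mult)
  then show ?thesis using norm_iexp_minus_1_le[of "x - y"] by simp
qed

text \<open>The chord has length 2 sin (pi x / 2), to which Jordan's inequality applies.\<close>

lemma norm_iexp_pi_minus_1_ge:
  assumes "0 \<le> x" "x \<le> 1"
  shows "2 * x \<le> norm (exp (\<i> * of_real (pi * x)) - 1)"
proof -
  define y where "y = pi / 2 * x"
  have "exp (\<i> * of_real (pi * x)) = exp (\<i> * of_real y) * exp (\<i> * of_real y)"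
    unfolding exp_add[symmetric] by (rule arg_cong[of _ _ exp]) (simp add: y_def)
  moreover have "exp (\<i> * of_real y) * exp (- (\<i> * of_real y)) = 1" by (simp flip: exp_add)
  ultimately have "exp (\<i> * of_real (pi * x)) - 1 = exp (\<i> * of_real y) * (exp (\<i> * of_real y) - exp (- (\<i> * of_real y)))"
    by (simp add: right_diff_distrib)
  also have "exp (\<i> * of_real y) - exp (- (\<i> * of_real y)) = 2 * \<i> * sin (of_real y)"
    by (simp add: sin_exp_eq)
  finally have "norm (exp (\<i> * of_real (pi * x)) - 1) = 2 * \<bar>sin y\<bar>"
    by (simp add: norm_mult sin_of_real del: of_real_mult)
  then show ?thesis using sin_pi_half_mult_ge[OF assms] by (simp add: y_def)
qed

text \<open>What summing the geometric series leaves: exp (\<i> \<tau> x) - 1 times the sum of exp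
  (\<i> pi x j) over j < K is this quotient times exp (\<i> pi x K) - 1. Its singularity at x = 0 is
  removable, with limit \<tau> / pi.\<close>

definition gram_weight :: "real \<Rightarrow> real \<Rightarrow> complex" where
  "gram_weight \<tau> x = (exp (\<i> * of_real (\<tau> * x)) - 1) / (exp (\<i> * of_real (pi * x)) - 1)"

lemma norm_gram_weight_le:
  assumes x: "0 < x" "x \<le> 1" and \<tau>: "\<bar>\<tau>\<bar> \<le> pi"
  shows "norm (gram_weight \<tau> x) \<le> 2"
proof -
  have "norm (exp (\<i> * of_real (\<tau> * x)) - 1) \<le> \<bar>\<tau> * x\<bar>" by (rule norm_iexp_minus_1_le)
  also have "\<dots> \<le> pi * x" using x \<tau> by (simp add: abs_mult mult_right_mono)
  also have "\<dots> \<le> 4 * x" using x pi_less_4 by simp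
  finally have "norm (gram_weight \<tau> x) \<le> (4 * x) / (2 * x)"
    unfolding gram_weight_def norm_divide using x norm_iexp_pi_minus_1_ge[of x]
    by (intro frac_le) auto
  then show ?thesis using x by simp
qed

text \<open>The linear terms of \<open>exp (\<i> \<tau> x) - 1\<close> and \<open>exp (\<i> \<pi> x) - 1\<close> cancel in the numerator of the
  derivative of their quotient, which keeps the derivative bounded at \<open>0\<close>.\<close>

lemma gram_weight_lipschitz:
  assumes x: "0 < x" "x \<le> y" "y \<le> 1" and \<tau>: "\<bar>\<tau>\<bar> \<le> pi"
  shows "norm (gram_weight \<tau> y - gram_weight \<tau> x) \<le> 48 * (y - x)"
proof -
  define D where "D = (\<lambda>z. ((exp (\<i> * of_real (\<tau> * z)) * (\<i> * of_real \<tau>)) * (exp (\<i> * of_real (pi * z)) - 1)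
      - (exp (\<i> * of_real (\<tau> * z)) - 1) * (exp (\<i> * of_real (pi * z)) * (\<i> * of_real pi)))
      / ((exp (\<i> * of_real (pi * z)) - 1) * (exp (\<i> * of_real (pi * z)) - 1)))"
  have der: "(gram_weight \<tau> has_vector_derivative D z) (at z within {x..y})" if z: "z \<in> {x..y}" for z
  proof -
    have nz: "exp (\<i> * of_real (pi * z)) - 1 \<noteq> 0"
      using norm_iexp_pi_minus_1_ge[of z] z x by auto
    define f where "f = (\<lambda>w::complex. (exp (\<i> * (of_real \<tau> * w)) - 1) / (exp (\<i> * (of_real pi * w)) - 1))"
    have "(f has_field_derivative D z) (at (of_real z))"
      unfolding f_def D_def using nz by (auto intro!: derivative_eq_intros simp: mult_ac)
    then have "((\<lambda>z. f (of_real z)) has_vector_derivative D z) (at z within {x..y})"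
      by (rule has_vector_derivative_real_field)
    moreover have "(\<lambda>z. f (of_real z)) = gram_weight \<tau>"
      by (simp add: f_def gram_weight_def fun_eq_iff)
    ultimately show ?thesis by simp
  qed
  have bound: "norm (D z) \<le> 48" if z: "z \<in> {x..y}" for z
  proof -
    define E1 E2 where "E1 = exp (\<i> * complex_of_real (\<tau> * z)) - 1" and "E2 = exp (\<i> * complex_of_real (pi * z)) - 1"
    define r1 r2 where "r1 = E1 - \<i> * complex_of_real (\<tau> * z)" and "r2 = E2 - \<i> * complex_of_real (pi * z)"
    have z0: "0 < z" "z \<le> 1" using z x by auto
    have tz: "\<bar>\<tau> * z\<bar> \<le> pi * z" using \<tau> z0 by (simp add: abs_mult mult_right_mono)
    have n1: "norm E1 \<le> pi * z" using norm_iexp_minus_1_le[of "\<tau> * z"] tz by (simp add: E1_def)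
    have n2: "norm E2 \<le> pi * z" using norm_iexp_minus_1_le[of "pi * z"] z0 by (simp add: E2_def)
    have m1: "norm r1 \<le> (pi * z)\<^sup>2 / 2"
    proof -
      have "norm r1 \<le> (\<tau> * z)\<^sup>2 / 2" using norm_iexp_minus_1_minus_le[of "\<tau> * z"] by (simp add: r1_def E1_def)
      also have "(\<tau> * z)\<^sup>2 \<le> (pi * z)\<^sup>2" using tz by (intro abs_le_square_iff[THEN iffD1]) auto
      finally show ?thesis by simp
    qed
    have m2: "norm r2 \<le> (pi * z)\<^sup>2 / 2"
      using norm_iexp_minus_1_minus_le[of "pi * z"] by (simp add: r2_def E2_def)
    have "D z = ((E1 + 1) * (\<i> * of_real \<tau>) * E2 - E1 * ((E2 + 1) * (\<i> * of_real pi))) / (E2 * E2)"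
      by (simp add: D_def E1_def E2_def)
    also have "(E1 + 1) * (\<i> * of_real \<tau>) * E2 - E1 * ((E2 + 1) * (\<i> * of_real pi))
       = \<i> * (of_real (\<tau> - pi) * (E1 * E2)) + \<i> * (of_real \<tau> * r2 - of_real pi * r1)"
      by (simp add: r1_def r2_def algebra_simps)
    finally have Dz: "D z = (\<i> * (of_real (\<tau> - pi) * (E1 * E2)) + \<i> * (of_real \<tau> * r2 - of_real pi * r1)) / (E2 * E2)" .
    have "norm (\<i> * (of_real (\<tau> - pi) * (E1 * E2)) + \<i> * (of_real \<tau> * r2 - of_real pi * r1))
        \<le> \<bar>\<tau> - pi\<bar> * (norm E1 * norm E2) + (\<bar>\<tau>\<bar> * norm r2 + pi * norm r1)"
    proof -
      have "norm (of_real \<tau> * r2 - of_real pi * r1) \<le> norm (of_real \<tau> * r2) + norm (of_real pi * r1)"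
        by (rule norm_triangle_ineq4)
      then show ?thesis
        using norm_triangle_ineq[of "\<i> * (of_real (\<tau> - pi) * (E1 * E2))" "\<i> * (of_real \<tau> * r2 - of_real pi * r1)"]
        by (simp add: norm_mult del: of_real_diff)
    qed
    also have "\<dots> \<le> (2 * pi) * ((pi * z) * (pi * z)) + (pi * ((pi * z)\<^sup>2 / 2) + pi * ((pi * z)\<^sup>2 / 2))"
    proof (intro add_mono mult_mono n1 n2 m1 m2)
      show "\<bar>\<tau> - pi\<bar> \<le> 2 * pi" using \<tau> by (simp add: abs_le_iff)
    qed (use \<tau> z0 in auto)
    also have "\<dots> = 3 * pi ^ 3 * z\<^sup>2" by (simp add: power2_eq_square power3_eq_cube)
    also have "\<dots> \<le> 3 * 4 ^ 3 * z\<^sup>2"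
      using pi_less_4 by (intro mult_right_mono mult_left_mono power_mono) auto
    finally have num: "norm (\<i> * (of_real (\<tau> - pi) * (E1 * E2)) + \<i> * (of_real \<tau> * r2 - of_real pi * r1)) \<le> 192 * z\<^sup>2" by simp
    have den: "4 * z\<^sup>2 \<le> norm (E2 * E2)"
    proof -
      have "2 * z \<le> norm E2" using norm_iexp_pi_minus_1_ge[of z] z0 by (simp add: E2_def)
      then have "(2 * z) * (2 * z) \<le> norm E2 * norm E2" using z0 by (intro mult_mono) auto
      then show ?thesis by (simp add: norm_mult power2_eq_square)
    qed
    \<comment> \<open>The Lipschitz constant 48 is 192 / 4, where 192 = 3 * 4^3 bounds 3
      pi^3.\<close>
    have "norm (D z) \<le> (192 * z\<^sup>2) / (4 * z\<^sup>2)"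
      unfolding Dz norm_divide using num den z0 by (intro frac_le) auto
    then show ?thesis using z0 by simp
  qed
  have "norm (gram_weight \<tau> y - gram_weight \<tau> x) \<le> 48 * norm (y - x)"
  proof (rule differentiable_bound[of "{x..y}" "gram_weight \<tau>" "\<lambda>z h. h *\<^sub>R D z"])
    show "(gram_weight \<tau> has_derivative (\<lambda>h. h *\<^sub>R D z)) (at z within {x..y})" if "z \<in> {x..y}" for z
      using der[OF that] by (simp add: has_vector_derivative_def)
    show "onorm (\<lambda>h. h *\<^sub>R D z) \<le> 48" if "z \<in> {x..y}" for z
      using bound[OF that] by (intro onorm_le) (simp add: mult.commute[of 48] mult_left_mono)
  qed (use x in auto)
  then show ?thesis using x by simp
qed

section \<open>Partial summation over dyadic blocks\<close>

text \<open>The variation of the complex weight \<open>w\<close> is measured by a real function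
  \<open>h\<close> whose differences telescope, so no total variation has to be summed explicitly.
  The last index of the half-open range is \<open>b - 1\<close>.\<close>

lemma abel_summation_bound:
  fixes c w :: "nat \<Rightarrow> complex"
  assumes ab: "a < b" and S: "\<And>m. a < m \<Longrightarrow> m \<le> b \<Longrightarrow> norm (\<Sum>n = a..<m. c n) \<le> M"
    and w: "\<And>n. a \<le> n \<Longrightarrow> Suc n < b \<Longrightarrow> norm (w n - w (Suc n)) \<le> h n - h (Suc n)"
    and w1: "norm (w (b - 1)) \<le> W"
  shows "norm (\<Sum>n = a..<b. c n * w n) \<le> M * (W + (h a - h (b - 1)))"
proof -
  define C where "C = (\<lambda>m. \<Sum>n = a..<m. c n)"
  have M0: "0 \<le> M" using S[of b] ab norm_ge_zero order_trans by blast
  have abel: "(\<Sum>n = a..<Suc m. c n * w n) = C (Suc m) * w m + (\<Sum>n = a..<m. C (Suc n) * (w n - w (Suc n)))"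
    if "a \<le> m" for m
    using that
  proof (induction m rule: dec_induct)
    case base
    then show ?case by (simp add: C_def)
  next
    case (step m)
    have "(\<Sum>n = a..<Suc (Suc m). c n * w n) = C (Suc m) * w m + (\<Sum>n = a..<m. C (Suc n) * (w n - w (Suc n))) + c (Suc m) * w (Suc m)"
      using step by simp
    moreover have "C (Suc (Suc m)) = C (Suc m) + c (Suc m)" using step by (simp add: C_def)
    ultimately show ?case using step by (simp add: algebra_simps)
  qed
  define m where "m = b - 1"
  have m: "a \<le> m" "b = Suc m" using ab by (auto simp: m_def)
  have "norm (\<Sum>n = a..<b. c n * w n) \<le> norm (C b * w m) + norm (\<Sum>n = a..<m. C (Suc n) * (w n - w (Suc n)))"
    unfolding m(2) abel[OF m(1)] by (rule norm_triangle_ineq)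
  also have "norm (C b * w m) \<le> M * W"
    unfolding norm_mult using S[of b] ab w1 M0 by (intro mult_mono) (auto simp: C_def m_def)
  also have "norm (\<Sum>n = a..<m. C (Suc n) * (w n - w (Suc n))) \<le> (\<Sum>n = a..<m. M * (h n - h (Suc n)))"
  proof (intro order_trans[OF norm_sum] sum_mono)
    fix n assume n: "n \<in> {a..<m}"
    show "norm (C (Suc n) * (w n - w (Suc n))) \<le> M * (h n - h (Suc n))"
      unfolding norm_mult using S[of "Suc n"] w[of n] n m M0 by (intro mult_mono) (auto simp: C_def)
  qed
  also have "\<dots> = M * (h a - h m)"
    unfolding sum_distrib_left[symmetric] using m(1)
    by (subst sum_Suc_diff'[of a m "\<lambda>n. - h n", simplified]) auto
  finally show ?thesis by (simp add: m_def distrib_left)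
qed

text \<open>Cutting at powers of two makes the last piece [2^k, m) with m \<le> 2^(k+1) an
  admissible block, so induction on \<open>k\<close> adds one \<open>B\<close> per doubling.\<close>

lemma dyadic_sum_bound:
  fixes f :: "nat \<Rightarrow> complex"
  assumes block: "\<And>a b. 1 \<le> a \<Longrightarrow> a < b \<Longrightarrow> b \<le> 2 * a \<Longrightarrow> b \<le> L \<Longrightarrow> norm (\<Sum>n = a..<b. f n) \<le> B"
    and B: "0 \<le> B"
  shows "m \<le> 2 ^ k \<Longrightarrow> m \<le> L \<Longrightarrow> norm (\<Sum>n = 1..<m. f n) \<le> real k * B"
proof (induction k arbitrary: m)
  case (Suc k)
  show ?case
  proof (cases "m \<le> 2 ^ k")
    case True
    then have "norm (\<Sum>n = 1..<m. f n) \<le> real k * B" using Suc by simp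
    also have "\<dots> \<le> real (Suc k) * B" using B by (intro mult_right_mono) auto
    finally show ?thesis .
  next
    case False
    have "(\<Sum>n = 1..<m. f n) = (\<Sum>n = 1..<2 ^ k. f n) + (\<Sum>n = 2 ^ k..<m. f n)"
      using False by (intro sum.atLeastLessThan_concat[symmetric]) auto
    then have "norm (\<Sum>n = 1..<m. f n) \<le> norm (\<Sum>n = 1..<2 ^ k. f n) + norm (\<Sum>n = 2 ^ k..<m. f n)"
      using norm_triangle_ineq by simp
    also have "\<dots> \<le> real k * B + B"
      using False Suc by (intro add_mono Suc.IH block) auto
    finally show ?thesis by (simp add: distrib_right)
  qed
qed simp

lemma powr_minus_half: "0 \<le> x \<Longrightarrow> x powr (- 1 / 2) = 1 / sqrt x" for x :: real
proof -
  assume "0 \<le> x"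
  have "x powr (- (1 / 2)) = inverse (x powr (1 / 2))" by (rule powr_minus)
  also have "x powr (1 / 2) = sqrt x" using \<open>0 \<le> x\<close> by (rule powr_half_sqrt)
  finally show ?thesis by (simp add: inverse_eq_divide)
qed

text \<open>Within a block the weight is of size a^(-1/2) and has variation of that order, so
  partial summation cancels the factor sqrt a of the hypothesis and every block costs the same. The
  condition \<open>ln (real N) < \<omega>\<close> keeps all \<open>x n\<close> in (0, 1], where the
  quotient is bounded and Lipschitz.\<close>

lemma weighted_exponential_sum_bound:
  fixes \<Delta> A t \<tau> \<omega> :: real and N k :: nat
  assumes hyp: "\<And>(t::real) (a::nat) (b::nat).
           0 < t \<Longrightarrow> 1 \<le> a \<Longrightarrow> a < b \<Longrightarrow> b \<le> 2 * a \<Longrightarrow> real b \<le> sqrt (t / (2 * pi)) \<Longrightarrow>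
           norm (\<Sum>n = a..<b. of_nat n powr (\<i> * complex_of_real t)) < A * sqrt (real a) * t powr \<Delta>"
    and A: "0 < A" and t: "0 < t" "real (N + 1) \<le> sqrt (t / (2 * pi))"
    and \<tau>: "\<bar>\<tau>\<bar> \<le> pi" and \<omega>: "1 \<le> \<omega>" "ln (real N) < \<omega>" and k: "N + 1 \<le> 2 ^ k"
  shows "norm (\<Sum>n = 1..<N + 1. of_nat n powr (- (\<i> * complex_of_real t)) *
      (of_real (real n powr (- 1 / 2)) * gram_weight \<tau> (1 - ln (real n) / \<omega>))) \<le> real k * (52 * A * t powr \<Delta>)"
proof (rule dyadic_sum_bound[OF _ _ k order_refl])
  show "0 \<le> 52 * A * t powr \<Delta>" using A by simp
  fix a b :: nat assume ab: "1 \<le> a" "a < b" "b \<le> 2 * a" "b \<le> N + 1"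
  define x where "x = (\<lambda>n::nat. 1 - ln (real n) / \<omega>)"
  define w where "w = (\<lambda>n::nat. of_real (real n powr (- 1 / 2)) * gram_weight \<tau> (x n))"
  define ra where "ra = real a powr (- 1 / 2)"
  \<comment> \<open>By the product rule: the Lipschitz constant 48 of the quotient times the largest
    n^(-1/2) in the block, and the bound 2 of the quotient times the variation of n^(-1/2).\<close>
  define h where "h = (\<lambda>n::nat. 48 * ra * x n + 2 * real n powr (- 1 / 2))"
  define M where "M = A * sqrt (real a) * t powr \<Delta>"
  have x: "0 < x n" "x n \<le> 1" if "1 \<le> n" "n \<le> N" for n
  proof -
    have "ln (real n) \<le> ln (real N)" using that by simp
    then have "ln (real n) < \<omega>" using \<omega> by linarith
    then show "0 < x n" using \<omega> by (simp add: x_def)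
    show "x n \<le> 1" using that \<omega> by (simp add: x_def)
  qed
  have xmono: "x (Suc n) \<le> x n" if "1 \<le> n" for n
    using that \<omega> by (simp add: x_def divide_right_mono)
  have rmono: "real n powr (- 1 / 2) \<le> real m powr (- 1 / 2)" if "1 \<le> m" "m \<le> n" for m n :: nat
    using that by (intro powr_mono2') auto
  have "norm (\<Sum>n = a..<b. of_nat n powr (- (\<i> * complex_of_real t)) * w n) \<le> M * (2 * ra + (h a - h (b - 1)))"
  proof (rule abel_summation_bound[OF ab(2)])
    fix m assume m: "a < m" "m \<le> b"
    have "(\<Sum>n = a..<m. of_nat n powr (- (\<i> * complex_of_real t))) = cnj (\<Sum>n = a..<m. of_nat n powr (\<i> * complex_of_real t))"
      unfolding cnj_sum by (intro sum.cong refl) (subst cnj_powr; simp)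
    then have "norm (\<Sum>n = a..<m. of_nat n powr (- (\<i> * complex_of_real t))) = norm (\<Sum>n = a..<m. of_nat n powr (\<i> * complex_of_real t))"
      by (simp only: complex_mod_cnj)
    also have "\<dots> < M" unfolding M_def using ab m t by (intro hyp) auto
    finally show "norm (\<Sum>n = a..<m. of_nat n powr (- (\<i> * complex_of_real t))) \<le> M" by simp
  next
    fix n assume n: "a \<le> n" "Suc n < b"
    have n1: "1 \<le> n" using n ab by simp
    have "w n - w (Suc n) = of_real (real n powr (- 1 / 2)) * (gram_weight \<tau> (x n) - gram_weight \<tau> (x (Suc n)))
       + of_real (real n powr (- 1 / 2) - real (Suc n) powr (- 1 / 2)) * gram_weight \<tau> (x (Suc n))"
      by (simp add: w_def algebra_simps del: of_nat_Suc)
    also have "norm \<dots> \<le> norm (of_real (real n powr (- 1 / 2)) * (gram_weight \<tau> (x n) - gram_weight \<tau> (x (Suc n))))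
       + norm (of_real (real n powr (- 1 / 2) - real (Suc n) powr (- 1 / 2)) * gram_weight \<tau> (x (Suc n)))"
      by (rule norm_triangle_ineq)
    also have "norm (of_real (real n powr (- 1 / 2)) * (gram_weight \<tau> (x n) - gram_weight \<tau> (x (Suc n)))) \<le> ra * (48 * (x n - x (Suc n)))"
      unfolding norm_mult using n ab x xmono \<tau> rmono[of a n]
      by (intro mult_mono gram_weight_lipschitz) (auto simp: ra_def)
    also have "norm (of_real (real n powr (- 1 / 2) - real (Suc n) powr (- 1 / 2)) * gram_weight \<tau> (x (Suc n)))
       \<le> (real n powr (- 1 / 2) - real (Suc n) powr (- 1 / 2)) * 2"
      unfolding norm_mult norm_of_real using n n1 ab x[of "Suc n"] \<tau> rmono[of n "Suc n"]
      by (intro mult_mono norm_gram_weight_le) (auto simp del: of_nat_Suc)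
    finally show "norm (w n - w (Suc n)) \<le> h n - h (Suc n)"
      by (simp add: h_def algebra_simps del: of_nat_Suc)
  next
    have "norm (w (b - 1)) \<le> ra * 2"
      unfolding w_def norm_mult using ab x[of "b - 1"] \<tau> rmono[of a "b - 1"]
      by (intro mult_mono norm_gram_weight_le) (auto simp: ra_def)
    then show "norm (w (b - 1)) \<le> 2 * ra" by simp
  qed
  \<comment> \<open>52 = 2 + 48 + 2: the final weight, the variation of the quotient, and that of
    n^(-1/2). On a block ln n grows by at most 1, hence \<open>x\<close> falls by at most 1 /
    \<omega> \<le> 1.\<close>
  also have "\<dots> \<le> M * (52 * ra)"
  proof (intro mult_left_mono)
    define c where "c = real (b - 1)"
    have c: "0 < c" "c \<le> 2 * real a" using ab by (auto simp: c_def)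
    have a0: "0 < real a" using ab by simp
    have "ln (c / real a) \<le> c / real a - 1"
      using c a0 by (intro ln_le_minus_one divide_pos_pos) auto
    moreover have "c / real a \<le> 2" using c a0 by (simp add: divide_le_eq)
    ultimately have "ln c - ln (real a) \<le> 1" using c a0 by (simp add: ln_div)
    then have "(ln c - ln (real a)) / \<omega> \<le> 1 / \<omega>" using \<omega> by (intro divide_right_mono) auto
    also have "\<dots> \<le> 1" using \<omega> by simp
    finally have "x a - x (b - 1) \<le> 1"
      unfolding x_def c_def by (simp add: diff_divide_distrib)
    then have "48 * ra * (x a - x (b - 1)) \<le> 48 * ra * 1" by (intro mult_left_mono) (auto simp: ra_def)
    moreover have "h a - h (b - 1) = 48 * ra * (x a - x (b - 1)) + 2 * ra - 2 * real (b - 1) powr (- 1 / 2)"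
      by (simp add: h_def ra_def right_diff_distrib)
    ultimately show "2 * ra + (h a - h (b - 1)) \<le> 52 * ra"
      using powr_ge_zero[of "real (b - 1)" "- 1 / 2"] by linarith
    show "0 \<le> M" using A by (simp add: M_def)
  qed
  also have "\<dots> = 52 * A * t powr \<Delta> * (sqrt (real a) * ra)" by (simp add: M_def)
  also have "sqrt (real a) * ra = 1"
    using ab unfolding ra_def by (subst powr_minus_half) auto
  finally show "norm (\<Sum>n = a..<b. of_nat n powr (- (\<i> * complex_of_real t)) *
      (of_real (real n powr (- 1 / 2)) * gram_weight \<tau> (1 - ln (real n) / \<omega>))) \<le> 52 * A * t powr \<Delta>"
    by (simp add: w_def x_def)
qed

section \<open>Linearisation and summation over Gram points\<close>

text \<open>By the mean value theorem only \<theta>' - \<omega> matters; it is at most (H + 8) / T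
  from the drift of the logarithm plus 18 / T from the Digamma asymptotics. The margin 4 makes room
  for the points with \<tau> \<noteq> 0, since \<theta> has slope at least 1 and pi < 4.\<close>

lemma rs_theta_linear_approx:
  fixes T H u s :: real
  defines "\<omega> \<equiv> ln (T / (2 * pi)) / 2"
  assumes T: "1000 \<le> T" and H: "0 \<le> H" and \<omega>: "1 \<le> \<omega>"
    and u: "u \<in> {T - 4..T + H + 4}" and s: "s \<in> {T - 4..T + H + 4}"
  shows "\<bar>u - s - (rs_theta u - rs_theta s) / \<omega>\<bar> \<le> 2 * (H + 13)\<^sup>2 / T"
proof -
  obtain \<xi> where \<xi>: "\<xi> \<in> {T - 4..T + H + 4}" "rs_theta u - rs_theta s = (u - s) * rs_theta_deriv \<xi>"
  proof (cases u s rule: linorder_cases)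
    case less
    then obtain z where "u < z" "z < s" "rs_theta s - rs_theta u = (s - u) * rs_theta_deriv z"
      using MVT2[of u s rs_theta rs_theta_deriv] rs_theta_has_derivative by auto
    then show ?thesis using that[of z] u s by (auto simp: algebra_simps)
  next
    case greater
    then obtain z where "s < z" "z < u" "rs_theta u - rs_theta s = (u - s) * rs_theta_deriv z"
      using MVT2[of s u rs_theta rs_theta_deriv] rs_theta_has_derivative by auto
    then show ?thesis using that[of z] u s by auto
  next
    case equal
    then show ?thesis using that[of u] u by auto
  qed
  have \<xi>0: "\<xi> > 0" "T / 2 \<le> \<xi>" using \<xi> T by auto
  have "ln (\<xi> / (2 * pi)) - ln (T / (2 * pi)) = ln (\<xi> / T)"
    using \<xi>0 T by (simp add: ln_div)
  moreover have "ln (\<xi> / T) \<le> (H + 8) / T"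
  proof -
    have "ln (\<xi> / T) \<le> \<xi> / T - 1" using \<xi>0 T by (intro ln_le_minus_one) auto
    also have "\<dots> \<le> (T + H + 8) / T - 1" using \<xi> T by (intro diff_right_mono divide_right_mono) auto
    also have "\<dots> = (H + 8) / T" using T by (simp add: field_simps)
    finally show ?thesis .
  qed
  moreover have "- ln (\<xi> / T) \<le> (H + 8) / T"
  proof -
    have "- ln (\<xi> / T) = ln (T / \<xi>)" using \<xi>0 T by (simp add: ln_div)
    also have "\<dots> \<le> T / \<xi> - 1" using \<xi>0 T by (intro ln_le_minus_one) auto
    also have "\<dots> = (T - \<xi>) / \<xi>" using \<xi>0 by (simp add: field_simps)
    also have "\<dots> \<le> 4 / (T / 2)" using \<xi> \<xi>0 T by (intro frac_le) auto
    also have "\<dots> \<le> (H + 8) / T" using T H by (simp add: divide_right_mono)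
    finally show ?thesis .
  qed
  ultimately have 1: "\<bar>ln (\<xi> / (2 * pi)) - ln (T / (2 * pi))\<bar> \<le> (H + 8) / T" by linarith
  have "9 / \<xi> \<le> 9 / (T / 2)" using \<xi>0 T by (intro divide_left_mono) auto
  then have 2: "9 / \<xi> \<le> 18 / T" by simp
  have "\<bar>rs_theta_deriv \<xi> - ln (\<xi> / (2 * pi)) / 2\<bar> \<le> 9 / \<xi>"
    using rs_theta_deriv_approx[of \<xi>] \<xi> T by auto
  then have "\<bar>rs_theta_deriv \<xi> - \<omega>\<bar> \<le> (H + 8) / T + 18 / T"
    using 1 2 unfolding \<omega>_def by linarith
  then have d: "\<bar>rs_theta_deriv \<xi> - \<omega>\<bar> \<le> (H + 26) / T" by (simp add: add_divide_distrib)
  have "u - s - (rs_theta u - rs_theta s) / \<omega> = - ((u - s) * (rs_theta_deriv \<xi> - \<omega>) / \<omega>)"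
    unfolding \<xi>(2) using \<omega> by (simp add: field_simps)
  then have "\<bar>u - s - (rs_theta u - rs_theta s) / \<omega>\<bar> = \<bar>u - s\<bar> * \<bar>rs_theta_deriv \<xi> - \<omega>\<bar> / \<omega>"
    using \<omega> by (simp add: abs_mult)
  also have "\<dots> \<le> (H + 8) * ((H + 26) / T) / 1"
    using \<omega> d u s H T by (intro frac_le mult_mono) auto
  also have "\<dots> \<le> 2 * (H + 13)\<^sup>2 / T"
  proof -
    have "(H + 8) * (H + 26) \<le> 2 * (H + 13)\<^sup>2" using H by (simp add: power2_eq_square algebra_simps)
    then show ?thesis using T by (simp add: divide_right_mono)
  qed
  finally show ?thesis .
qed

lemma sum_powr_half_le: "(\<Sum>n = 1..N. real n powr (- 1 / 2)) \<le> 2 * sqrt (real N)"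
proof (induction N)
  case (Suc N)
  have "real (Suc N) powr (- 1 / 2) = 1 / sqrt (real (Suc N))"
    by (rule powr_minus_half) simp
  also have "\<dots> \<le> 2 * (sqrt (real (Suc N)) - sqrt (real N))"
  proof -
    define p q where "p = sqrt (real (Suc N))" and "q = sqrt (real N)"
    have pq: "0 < p" "0 \<le> q" "q \<le> p" "p\<^sup>2 - q\<^sup>2 = 1" by (auto simp: p_def q_def)
    have "1 = (p - q) * (p + q)" using pq(4) by (simp add: power2_eq_square algebra_simps)
    also have "\<dots> \<le> (p - q) * (2 * p)" using pq by (intro mult_left_mono) auto
    finally have "1 / p \<le> 2 * (p - q)" using pq by (simp add: field_simps)
    then show ?thesis by (simp add: p_def q_def)
  qed
  finally show ?case using Suc by simp
qed simp

text \<open>The main sum of the approximate functional equation at the point where \<theta> equals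
  \<theta>1 + \<phi>, with the point itself replaced by its linear approximation t1 + \<phi> /
  \<omega>.\<close>

definition gram_phase_sum :: "nat \<Rightarrow> real \<Rightarrow> real \<Rightarrow> real \<Rightarrow> real \<Rightarrow> complex" where
  "gram_phase_sum N \<omega> \<theta>\<^sub>1 t\<^sub>1 \<phi> =
     (\<Sum>n = 1..N. of_real (real n powr (- 1 / 2)) * exp (\<i> * of_real (\<theta>\<^sub>1 + \<phi> - (t\<^sub>1 + \<phi> / \<omega>) * ln (real n))))"

definition gram_weight_sum :: "nat \<Rightarrow> real \<Rightarrow> real \<Rightarrow> real \<Rightarrow> complex" where
  "gram_weight_sum N \<omega> \<tau> t = (\<Sum>n = 1..<N + 1. of_nat n powr (- (\<i> * of_real t)) *
     (of_real (real n powr (- 1 / 2)) * gram_weight \<tau> (1 - ln (real n) / \<omega>)))"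

text \<open>The phase equals \<theta>1 - t1 ln n + \<phi> x with x = 1 - ln n / \<omega>, so for
  fixed \<open>n\<close> the sum over \<open>j\<close> is geometric with ratio exp (\<i> pi x). Its
  two ends are exponential sums over \<open>n\<close> at the heights t1 + pi K / \<omega> and
  t1.\<close>

lemma gram_phase_sum_diff:
  assumes \<omega>: "0 < \<omega>" "ln (real N) < \<omega>"
  shows "(\<Sum>j<K. gram_phase_sum N \<omega> \<theta>\<^sub>1 t\<^sub>1 (pi * real j + \<tau>) - gram_phase_sum N \<omega> \<theta>\<^sub>1 t\<^sub>1 (pi * real j))
    = exp (\<i> * of_real \<theta>\<^sub>1) * (exp (\<i> * of_real (pi * real K)) * gram_weight_sum N \<omega> \<tau> (t\<^sub>1 + pi * real K / \<omega>)
        - gram_weight_sum N \<omega> \<tau> t\<^sub>1)"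
proof -
  define x where "x = (\<lambda>n::nat. 1 - ln (real n) / \<omega>)"
  have swap_term: "(\<Sum>j<K. of_real (real n powr (- 1 / 2)) * exp (\<i> * of_real (\<theta>\<^sub>1 + (pi * real j + \<tau>) - (t\<^sub>1 + (pi * real j + \<tau>) / \<omega>) * ln (real n)))
       - of_real (real n powr (- 1 / 2)) * exp (\<i> * of_real (\<theta>\<^sub>1 + pi * real j - (t\<^sub>1 + pi * real j / \<omega>) * ln (real n))))
     = exp (\<i> * of_real \<theta>\<^sub>1) * (exp (\<i> * of_real (pi * real K)) * (of_nat n powr (- (\<i> * of_real (t\<^sub>1 + pi * real K / \<omega>))) * (of_real (real n powr (- 1 / 2)) * gram_weight \<tau> (x n)))
        - of_nat n powr (- (\<i> * of_real t\<^sub>1)) * (of_real (real n powr (- 1 / 2)) * gram_weight \<tau> (x n)))"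
    if n: "n \<in> {1..N}" for n
  proof -
    define r where "r = complex_of_real (real n powr (- 1 / 2))"
    define l where "l = ln (real n)"
    define e1 where "e1 = exp (\<i> * complex_of_real \<theta>\<^sub>1)"
    define e2 where "e2 = exp (- (\<i> * complex_of_real (t\<^sub>1 * l)))"
    define q where "q = exp (\<i> * complex_of_real (pi * x n))"
    define g where "g = exp (\<i> * complex_of_real (\<tau> * x n))"
    have "ln (real n) \<le> ln (real N)" using n by simp
    then have "ln (real n) < \<omega>" using \<omega> by linarith
    then have x: "0 < x n" "x n \<le> 1" using \<omega> n by (auto simp: x_def)
    have "2 * x n \<le> norm (q - 1)" using norm_iexp_pi_minus_1_ge[of "x n"] x by (simp add: q_def)
    then have q1: "q \<noteq> 1" using x by auto
    have ph: "\<theta>\<^sub>1 + \<phi> - (t\<^sub>1 + \<phi> / \<omega>) * l = \<theta>\<^sub>1 - t\<^sub>1 * l + \<phi> * x n" for \<phi>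
      using \<omega> by (simp add: x_def l_def field_simps)
    have qj: "exp (\<i> * complex_of_real (pi * real j * x n)) = q ^ j" for j
      unfolding q_def exp_of_nat_mult[symmetric] by (rule arg_cong[of _ _ exp]) simp
    have E: "exp (\<i> * of_real (\<theta>\<^sub>1 + pi * real j - (t\<^sub>1 + pi * real j / \<omega>) * l)) = e1 * e2 * q ^ j" for j
      unfolding ph qj[symmetric] e1_def e2_def exp_add[symmetric] by (rule arg_cong[of _ _ exp]) (simp add: algebra_simps)
    have E\<tau>: "exp (\<i> * of_real (\<theta>\<^sub>1 + (pi * real j + \<tau>) - (t\<^sub>1 + (pi * real j + \<tau>) / \<omega>) * l)) = e1 * e2 * g * q ^ j" for j
      unfolding ph qj[symmetric] e1_def e2_def g_def exp_add[symmetric] by (rule arg_cong[of _ _ exp]) (simp add: algebra_simps)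
    have pw: "of_nat n powr (- (\<i> * of_real t)) = exp (- (\<i> * complex_of_real (t * l)))" for t
      using n by (simp add: powr_def l_def Ln_of_nat mult.assoc)
    \<comment> \<open>The power q^K equals exp (\<i> pi K) n^(- \<i> pi K / \<omega>): the upper end
      of the geometric sum merely moves the height by pi K / \<omega>.\<close>
    have qK: "e2 * q ^ K = exp (\<i> * of_real (pi * real K)) * of_nat n powr (- (\<i> * of_real (t\<^sub>1 + pi * real K / \<omega>)))"
      unfolding pw qj[symmetric] e2_def exp_add[symmetric]
      by (rule arg_cong[of _ _ exp]) (use \<omega> in \<open>simp add: x_def l_def field_simps\<close>)
    have gw: "gram_weight \<tau> (x n) = (g - 1) / (q - 1)" by (simp add: gram_weight_def g_def q_def)
    have "(\<Sum>j<K. r * (e1 * e2 * g * q ^ j) - r * (e1 * e2 * q ^ j)) = (\<Sum>j<K. (r * e1 * e2 * (g - 1)) * q ^ j)"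
      by (simp add: algebra_simps)
    also have "\<dots> = (r * e1 * e2 * (g - 1)) * ((q ^ K - 1) / (q - 1))"
      by (simp only: sum_distrib_left[symmetric] geometric_sum[OF q1])
    also have "\<dots> = e1 * ((e2 * q ^ K) * (r * gram_weight \<tau> (x n)) - e2 * (r * gram_weight \<tau> (x n)))"
      unfolding gw by (simp add: diff_divide_distrib algebra_simps)
    finally show ?thesis
      unfolding qK l_def[symmetric] E E\<tau> r_def[symmetric] e1_def[symmetric]
      by (simp only: e2_def pw[of t\<^sub>1] mult.assoc)
  qed
  have "(\<Sum>j<K. gram_phase_sum N \<omega> \<theta>\<^sub>1 t\<^sub>1 (pi * real j + \<tau>) - gram_phase_sum N \<omega> \<theta>\<^sub>1 t\<^sub>1 (pi * real j))
     = (\<Sum>j<K. \<Sum>n = 1..N. of_real (real n powr (- 1 / 2)) * exp (\<i> * of_real (\<theta>\<^sub>1 + (pi * real j + \<tau>) - (t\<^sub>1 + (pi * real j + \<tau>) / \<omega>) * ln (real n)))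
       - of_real (real n powr (- 1 / 2)) * exp (\<i> * of_real (\<theta>\<^sub>1 + pi * real j - (t\<^sub>1 + pi * real j / \<omega>) * ln (real n))))"
    unfolding gram_phase_sum_def sum_subtractf by (rule refl)
  also have "\<dots> = (\<Sum>n = 1..N. \<Sum>j<K. of_real (real n powr (- 1 / 2)) * exp (\<i> * of_real (\<theta>\<^sub>1 + (pi * real j + \<tau>) - (t\<^sub>1 + (pi * real j + \<tau>) / \<omega>) * ln (real n)))
       - of_real (real n powr (- 1 / 2)) * exp (\<i> * of_real (\<theta>\<^sub>1 + pi * real j - (t\<^sub>1 + pi * real j / \<omega>) * ln (real n))))"
    by (rule sum.swap)
  also have "\<dots> = (\<Sum>n = 1..N. exp (\<i> * of_real \<theta>\<^sub>1) * (exp (\<i> * of_real (pi * real K)) * (of_nat n powr (- (\<i> * of_real (t\<^sub>1 + pi * real K / \<omega>))) * (of_real (real n powr (- 1 / 2)) * gram_weight \<tau> (x n)))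
        - of_nat n powr (- (\<i> * of_real t\<^sub>1)) * (of_real (real n powr (- 1 / 2)) * gram_weight \<tau> (x n))))"
    by (intro sum.cong refl swap_term)
  also have "\<dots> = exp (\<i> * of_real \<theta>\<^sub>1) * (exp (\<i> * of_real (pi * real K)) * (\<Sum>n = 1..N. of_nat n powr (- (\<i> * of_real (t\<^sub>1 + pi * real K / \<omega>))) * (of_real (real n powr (- 1 / 2)) * gram_weight \<tau> (x n)))
        - (\<Sum>n = 1..N. of_nat n powr (- (\<i> * of_real t\<^sub>1)) * (of_real (real n powr (- 1 / 2)) * gram_weight \<tau> (x n))))"
    by (simp only: sum_distrib_left sum_subtractf right_diff_distrib)
  also have "{1..N} = {1..<N + 1}" by auto
  finally show ?thesis unfolding gram_weight_sum_def x_def .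
qed

text \<open>Moving the point by at most \<open>E\<close> turns the phase of the n-th term by at most
  E ln n \<le> E \<omega>, and the coefficients n^(-1/2) sum to at most 2 sqrt N.\<close>

lemma hardy_sum_linearised:
  assumes \<omega>: "0 \<le> \<omega>" "ln (real N) \<le> \<omega>" and E: "\<bar>u - (t\<^sub>1 + \<phi> / \<omega>)\<bar> \<le> E"
    and \<theta>: "rs_theta u = \<theta>\<^sub>1 + \<phi>"
  shows "norm (exp (\<i> * of_real (rs_theta u)) * (\<Sum>n = 1..N. of_nat n powr (- (1 / 2 + \<i> * of_real u)))
      - gram_phase_sum N \<omega> \<theta>\<^sub>1 t\<^sub>1 \<phi>) \<le> 2 * sqrt (real N) * (E * \<omega>)"
proof -
  have "norm (exp (\<i> * of_real (rs_theta u)) * of_nat n powr (- (1 / 2 + \<i> * of_real u))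
     - of_real (real n powr (- 1 / 2)) * exp (\<i> * of_real (\<theta>\<^sub>1 + \<phi> - (t\<^sub>1 + \<phi> / \<omega>) * ln (real n))))
     \<le> real n powr (- 1 / 2) * (E * \<omega>)" if n: "n \<in> {1..N}" for n
  proof -
    define l where "l = ln (real n)"
    have l: "0 \<le> l" "l \<le> \<omega>"
    proof -
      show "0 \<le> l" unfolding l_def using n by simp
      have "l \<le> ln (real N)" unfolding l_def using n by simp
      then show "l \<le> \<omega>" using \<omega> by simp
    qed
    have "of_nat n powr (- (1 / 2 + \<i> * of_real u)) = of_real (real n powr (- 1 / 2)) * exp (- (\<i> * complex_of_real (u * l)))"
    proof -
      have "of_nat n powr (- (1 / 2 + \<i> * of_real u)) = exp (complex_of_real (- 1 / 2 * l) + - (\<i> * complex_of_real (u * l)))"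
      proof -
        have "of_nat n powr w = exp (w * of_real l)" for w :: complex
          using n by (simp add: powr_def l_def Ln_of_nat)
        then show ?thesis by (simp only:) (rule arg_cong[of _ _ exp], simp add: algebra_simps)
      qed
      also have "\<dots> = exp (complex_of_real (- 1 / 2 * l)) * exp (- (\<i> * complex_of_real (u * l)))" by (rule exp_add)
      also have "exp (complex_of_real (- 1 / 2 * l)) = of_real (real n powr (- 1 / 2))"
        unfolding exp_of_real using n by (simp add: powr_def l_def)
      finally show ?thesis .
    qed
    then have "exp (\<i> * of_real (rs_theta u)) * of_nat n powr (- (1 / 2 + \<i> * of_real u))
       = of_real (real n powr (- 1 / 2)) * (exp (\<i> * of_real (rs_theta u)) * exp (- (\<i> * complex_of_real (u * l))))"
      by (simp only: mult.left_commute)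
    also have "exp (\<i> * of_real (rs_theta u)) * exp (- (\<i> * complex_of_real (u * l))) = exp (\<i> * of_real (\<theta>\<^sub>1 + \<phi> - u * l))"
      unfolding exp_add[symmetric] \<theta> by (rule arg_cong[of _ _ exp]) (simp add: algebra_simps)
    finally have "exp (\<i> * of_real (rs_theta u)) * of_nat n powr (- (1 / 2 + \<i> * of_real u))
        - of_real (real n powr (- 1 / 2)) * exp (\<i> * of_real (\<theta>\<^sub>1 + \<phi> - (t\<^sub>1 + \<phi> / \<omega>) * ln (real n)))
       = of_real (real n powr (- 1 / 2)) * (exp (\<i> * of_real (\<theta>\<^sub>1 + \<phi> - u * l)) - exp (\<i> * of_real (\<theta>\<^sub>1 + \<phi> - (t\<^sub>1 + \<phi> / \<omega>) * l)))"
      by (simp only: l_def right_diff_distrib)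
    also have "norm \<dots> = real n powr (- 1 / 2) * norm (exp (\<i> * of_real (\<theta>\<^sub>1 + \<phi> - u * l)) - exp (\<i> * of_real (\<theta>\<^sub>1 + \<phi> - (t\<^sub>1 + \<phi> / \<omega>) * l)))"
      unfolding norm_mult norm_of_real by simp
    also have "\<dots> \<le> real n powr (- 1 / 2) * (E * \<omega>)"
    proof (intro mult_left_mono)
      have "norm (exp (\<i> * of_real (\<theta>\<^sub>1 + \<phi> - u * l)) - exp (\<i> * of_real (\<theta>\<^sub>1 + \<phi> - (t\<^sub>1 + \<phi> / \<omega>) * l)))
         \<le> \<bar>(\<theta>\<^sub>1 + \<phi> - u * l) - (\<theta>\<^sub>1 + \<phi> - (t\<^sub>1 + \<phi> / \<omega>) * l)\<bar>"
        by (rule norm_iexp_diff_le)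
      also have "(\<theta>\<^sub>1 + \<phi> - u * l) - (\<theta>\<^sub>1 + \<phi> - (t\<^sub>1 + \<phi> / \<omega>) * l) = - ((u - (t\<^sub>1 + \<phi> / \<omega>)) * l)"
        by (simp add: algebra_simps)
      also have "\<bar>- ((u - (t\<^sub>1 + \<phi> / \<omega>)) * l)\<bar> = \<bar>u - (t\<^sub>1 + \<phi> / \<omega>)\<bar> * l" using l by (simp add: abs_mult)
      also have "\<dots> \<le> E * \<omega>" using E l by (intro mult_mono) auto
      finally show "norm (exp (\<i> * of_real (\<theta>\<^sub>1 + \<phi> - u * l)) - exp (\<i> * of_real (\<theta>\<^sub>1 + \<phi> - (t\<^sub>1 + \<phi> / \<omega>) * l))) \<le> E * \<omega>" .
    qed simp
    finally show ?thesis .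
  qed
  then have "(\<Sum>n = 1..N. norm (exp (\<i> * of_real (rs_theta u)) * of_nat n powr (- (1 / 2 + \<i> * of_real u))
     - of_real (real n powr (- 1 / 2)) * exp (\<i> * of_real (\<theta>\<^sub>1 + \<phi> - (t\<^sub>1 + \<phi> / \<omega>) * ln (real n)))))
     \<le> (\<Sum>n = 1..N. real n powr (- 1 / 2) * (E * \<omega>))"
    by (rule sum_mono)
  also have "\<dots> = (\<Sum>n = 1..N. real n powr (- 1 / 2)) * (E * \<omega>)" by (simp only: sum_distrib_right)
  also have "\<dots> \<le> 2 * sqrt (real N) * (E * \<omega>)"
    using E \<omega> by (intro mult_right_mono sum_powr_half_le) auto
  finally show ?thesis
    unfolding gram_phase_sum_def sum_distrib_left sum_subtractf[symmetric]
    by (rule order_trans[OF norm_sum])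
qed

text \<open>With Q = T^(1/4) there are at most 3 Q \<omega> points, each with an error 2 C / Q + 4 Q
  E \<omega>, where E = O(1 / Q^2). For the two sums together this gives the 12 C \<omega> and 9408
  \<omega>^2 of the bound. The remaining 1248 A = 4 * 3 * 104 A comes from the two ends of the
  geometric sums, doubled by Z = 2 Re (...), with at most 3 ln T dyadic blocks each.\<close>

lemma gram_sum_diff_bound:
  fixes \<Delta> A C T H \<tau> :: real
  assumes hyp: "\<And>(t::real) (a::nat) (b::nat).
           0 < t \<Longrightarrow> 1 \<le> a \<Longrightarrow> a < b \<Longrightarrow> b \<le> 2 * a \<Longrightarrow> real b \<le> sqrt (t / (2 * pi)) \<Longrightarrow>
           norm (\<Sum>n = a..<b. of_nat n powr (\<i> * complex_of_real t)) < A * sqrt (real a) * t powr \<Delta>"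
    and A: "0 < A" and \<Delta>: "0 < \<Delta>" "\<Delta> \<le> 1"
    and C: "0 < C" "\<And>t N. 300 \<le> t \<Longrightarrow> \<bar>real N + 1 / 2 - sqrt (t / (2 * pi))\<bar> \<le> 3 \<Longrightarrow>
    norm (hardy_Z t - of_real (2 * Re (exp (\<i> * of_real (rs_theta t)) *
      (\<Sum>n = 1..N. of_nat n powr (- (1 / 2 + \<i> * of_real t)))))) \<le> C * t powr (- 1 / 4)"
    and T: "160000 \<le> T" and H: "0 < H" "H \<le> T powr (1 / 4)" and \<tau>: "\<bar>\<tau>\<bar> \<le> pi"
  shows "norm (gram_sum \<tau> T H - gram_sum 0 T H) \<le> (12 * C + 9408 / \<Delta> + 1248 * A) * (T powr \<Delta> * ln T)"
proof -
  define Q where "Q = T powr (1 / 4)"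
  define \<omega> where "\<omega> = ln (T / (2 * pi)) / 2"
  define E where "E = 2 * (H + 13)\<^sup>2 / T"
  define s0 where "s0 = sqrt ((T - 4) / (2 * pi))"
  \<comment> \<open>One less than the integer part: all points u in question satisfy s0 \<le> sqrt
    (u / (2 pi)) \<le> s0 + 1, a range inside [N + 1, N + 3]. So this \<open>N\<close> is within the
    tolerance 3 for all of them, and N + 1 does not exceed the limit of the hypothesis.\<close>
  define N where "N = nat \<lfloor>s0\<rfloor> - 1"
  define k where "k = nat \<lceil>log 2 T\<rceil>"
  define V where "V = {\<nu>. T \<le> gram_pt \<nu> 0 \<and> gram_pt \<nu> 0 \<le> T + H}"
  have pi8: "2 * pi \<le> 8" "6 \<le> 2 * pi" using pi_less_4 pi_gt3 by auto
  have Q4: "Q ^ 4 = T" using T by (simp add: Q_def powr_power)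
  have Q0: "0 < Q" using T by (simp add: Q_def)
  \<comment> \<open>The threshold 160000 is 20^4.\<close>
  have Q20: "20 \<le> Q"
  proof (rule ccontr)
    assume "\<not> 20 \<le> Q"
    then have "Q ^ 4 < 20 ^ 4" using Q0 by (intro power_strict_mono) auto
    then show False using Q4 T by simp
  qed
  have Q2: "(Q\<^sup>2)\<^sup>2 = T" using Q4 by (simp flip: power_mult)
  have Q400: "400 \<le> Q\<^sup>2" using power_mono[OF Q20, of 2] by simp
  have HQ: "H \<le> Q" using H by (simp add: Q_def)
  have QT: "Q \<le> T"
  proof -
    have "Q * 1 \<le> Q * Q ^ 3" using Q20 by (intro mult_left_mono one_le_power) auto
    also have "\<dots> = T" unfolding Q4[symmetric] by (simp add: power_numeral_reduce)
    finally show ?thesis by simp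
  qed
  have lnT: "1 \<le> ln T"
  proof -
    have "exp 1 \<le> T" using exp_le T by linarith
    then show ?thesis using T by (subst ln_ge_iff) auto
  qed
  have \<omega>1: "1 \<le> \<omega>"
  proof -
    have "exp 2 = (exp 1 :: real) ^ 2" by (simp flip: exp_of_nat_mult)
    also have "\<dots> \<le> 3 ^ 2" using exp_le by (intro power_mono) auto
    also have "\<dots> \<le> T / (2 * pi)" using T pi8 by (simp add: le_divide_eq)
    finally have "2 \<le> ln (T / (2 * pi))" using T by (subst ln_ge_iff) auto
    then show ?thesis by (simp add: \<omega>_def)
  qed
  have \<omega>T: "\<omega> \<le> ln T"
  proof -
    have "T / (2 * pi) \<le> T / 1" using T pi8 by (intro divide_left_mono) auto
    then have "ln (T / (2 * pi)) \<le> ln T" using T by simp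
    then show ?thesis using lnT by (simp add: \<omega>_def)
  qed
  have E0: "0 \<le> E" using T by (simp add: E_def)
  \<comment> \<open>H + 13 \<le> 14 Q and 392 = 2 * 14^2.\<close>
  have EQ: "E \<le> 392 / Q\<^sup>2"
  proof -
    have "(H + 13)\<^sup>2 \<le> (14 * Q)\<^sup>2" using H HQ Q20 by (intro power_mono) auto
    then have "E \<le> 2 * (14 * Q)\<^sup>2 / T" unfolding E_def using T by (intro divide_right_mono) auto
    also have "\<dots> = 392 / Q\<^sup>2" unfolding Q2[symmetric] using Q0 by (simp add: power2_eq_square field_simps)
    finally show ?thesis .
  qed
  have E1: "E \<le> 1"
  proof -
    have "392 / Q\<^sup>2 \<le> 1" using Q400 by (simp add: divide_le_eq)
    then show ?thesis using EQ by linarith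
  qed
  have s0Q: "Q\<^sup>2 / 4 \<le> s0"
    unfolding s0_def
  proof (rule real_le_rsqrt)
    have "(Q\<^sup>2 / 4)\<^sup>2 = (T / 2) / 8" using Q2 by (simp add: power_divide)
    also have "\<dots> \<le> (T - 4) / (2 * pi)" using T pi8 by (intro frac_le) auto
    finally show "(Q\<^sup>2 / 4)\<^sup>2 \<le> (T - 4) / (2 * pi)" .
  qed
  have s0sq: "s0\<^sup>2 = (T - 4) / (2 * pi)" using T by (simp add: s0_def)
  have s0T: "s0 \<le> sqrt (T / (2 * pi))" unfolding s0_def by (intro real_sqrt_le_mono divide_right_mono) auto
  have s0Q2: "s0 \<le> Q\<^sup>2"
  proof -
    have "s0\<^sup>2 \<le> (Q\<^sup>2)\<^sup>2" unfolding s0sq Q2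
    proof -
      have "(T - 4) / (2 * pi) \<le> T / 1" using T pi8 by (intro frac_le) auto
      then show "(T - 4) / (2 * pi) \<le> T" by simp
    qed
    then show ?thesis by (rule power2_le_imp_le) simp
  qed
  have s0100: "100 \<le> s0" using s0Q Q400 by linarith
  have fl: "100 \<le> \<lfloor>s0\<rfloor>" using s0100 by (simp add: le_floor_iff)
  have "int (nat z - 1) + 1 = z" if "100 \<le> z" for z :: int using that by arith
  then have "int N + 1 = \<lfloor>s0\<rfloor>" using fl by (simp only: N_def)
  then have N1: "real N + 1 = of_int \<lfloor>s0\<rfloor>" by (metis of_int_1 of_int_add of_int_of_nat_eq)
  have N: "real N + 1 \<le> s0" "s0 < real N + 2" unfolding N1 using floor_correct[of s0] N1 by linarith+
  have N99: "1 \<le> N" using N s0100 by linarith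
  have lnN: "ln (real N) < \<omega>"
  proof -
    have "real N < sqrt (T / (2 * pi))" using N s0T by linarith
    then have "ln (real N) < ln (sqrt (T / (2 * pi)))" using N99 T by (subst ln_less_cancel_iff) auto
    then show ?thesis using T by (simp add: ln_sqrt \<omega>_def)
  qed
  have sqN: "sqrt (real N) \<le> Q"
    using N s0Q2 Q0 by (intro real_le_lsqrt) auto
  have k: "N + 1 \<le> 2 ^ k" "real k \<le> 3 * ln T"
  proof -
    have lg: "log 2 T = ln T / ln 2" by (simp add: log_def)
    have lg0: "0 < log 2 T" using T by simp
    have "T = 2 powr (log 2 T)" using T by simp
    also have "\<dots> \<le> 2 powr (real k)" using lg0 by (intro powr_mono) (auto simp: k_def)
    also have "\<dots> = 2 ^ k" by (simp add: powr_realpow)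
    finally have "T \<le> 2 ^ k" .
    moreover have "s0 \<le> T"
    proof -
      have "Q\<^sup>2 * 1 \<le> Q\<^sup>2 * Q\<^sup>2" using Q400 by (intro mult_left_mono) auto
      then show ?thesis using s0Q2 Q2 by (simp add: power2_eq_square)
    qed
    ultimately have "real (N + 1) \<le> real (2 ^ k)" using N by simp
    then show "N + 1 \<le> 2 ^ k" by (simp only: of_nat_le_iff)
    have "real k = of_int \<lceil>log 2 T\<rceil>" using lg0 by (simp add: k_def)
    also have "\<dots> \<le> log 2 T + 1" by (rule of_int_ceiling_le_add_one)
    also have "log 2 T \<le> 2 * ln T"
    proof -
      have "1 / 2 \<le> ln (2 :: real)" using ln2_ge_two_thirds by simp
      then have "ln T / ln 2 \<le> ln T / (1 / 2)" using lnT by (intro divide_left_mono) auto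
      then show ?thesis by (simp add: lg)
    qed
    finally show "real k \<le> 3 * ln T" using lnT by linarith
  qed
  have Vset: "V = {\<lceil>rs_theta T / pi\<rceil>..\<lfloor>rs_theta (T + H) / pi\<rfloor>}"
    unfolding V_def using T H by (intro gram_index_set) auto
  have gs: "gram_sum \<tau>' T H = (\<Sum>\<nu>\<in>V. hardy_Z (gram_pt \<nu> \<tau>'))" for \<tau>'
    by (simp add: gram_sum_def V_def)
  have rhs: "0 \<le> (12 * C + 9408 / \<Delta> + 1248 * A) * (T powr \<Delta> * ln T)"
    using C A \<Delta> lnT by simp
  show ?thesis
  proof (cases "V = {}")
    case True
    then show ?thesis using rhs by (simp add: gs)
  next
    case False
    define \<nu>1 where "\<nu>1 = \<lceil>rs_theta T / pi\<rceil>"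
    define \<nu>2 where "\<nu>2 = \<lfloor>rs_theta (T + H) / pi\<rfloor>"
    define K where "K = nat (\<nu>2 - \<nu>1 + 1)"
    have V: "V = {\<nu>1..\<nu>2}" by (simp add: Vset \<nu>1_def \<nu>2_def)
    have \<nu>: "\<nu>1 \<le> \<nu>2" using False V by simp
    have sumV: "(\<Sum>\<nu>\<in>V. f \<nu>) = (\<Sum>j<K. f (\<nu>1 + int j))" for f :: "int \<Rightarrow> complex"
      unfolding V
      by (rule sum.reindex_bij_witness[of _ "\<lambda>j. \<nu>1 + int j" "\<lambda>\<nu>. nat (\<nu> - \<nu>1)"]) (auto simp: K_def)
    have inV: "\<nu>1 + int j \<in> V" if "j < K" for j using that by (auto simp: V K_def)
    define t1 where "t1 = gram_pt \<nu>1 0"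
    define \<theta>1 where "\<theta>1 = pi * of_int \<nu>1"
    have "\<nu>1 \<in> V" unfolding V using \<nu> by simp
    then have t1: "T \<le> t1" "t1 \<le> T + H" by (simp_all add: V_def t1_def)
    have \<theta>t1: "rs_theta t1 = \<theta>1" using rs_theta_gram_pt[of \<nu>1 0] by (simp add: t1_def \<theta>1_def)
    \<comment> \<open>Changing \<theta> by at most pi < 4 moves the point by less than 4, as the
      slope is at least 1.\<close>
    have loc: "gram_pt \<nu> \<tau>' \<in> {T - 4..T + H + 4}" if "\<nu> \<in> V" "\<bar>\<tau>'\<bar> \<le> pi" for \<nu> \<tau>'
    proof (rule gram_pt_in_interval)
      have g: "T \<le> gram_pt \<nu> 0" "gram_pt \<nu> 0 \<le> T + H" using that by (auto simp: V_def)
      have "rs_theta (gram_pt \<nu> 0) = pi * of_int \<nu>" using rs_theta_gram_pt[of \<nu> 0] by simp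
      moreover have "4 \<le> rs_theta T - rs_theta (T - 4)" using rs_theta_increment[of "T - 4" T] T by auto
      moreover have "4 \<le> rs_theta (T + H + 4) - rs_theta (T + H)" using rs_theta_increment[of "T + H" "T + H + 4"] T H by auto
      moreover have "rs_theta T \<le> rs_theta (gram_pt \<nu> 0)" using rs_theta_increment[of T "gram_pt \<nu> 0"] g T by auto
      moreover have "rs_theta (gram_pt \<nu> 0) \<le> rs_theta (T + H)" using rs_theta_increment[of "gram_pt \<nu> 0" "T + H"] g T by auto
      ultimately show "rs_theta (T - 4) \<le> pi * of_int \<nu> + \<tau>'" "pi * of_int \<nu> + \<tau>' \<le> rs_theta (T + H + 4)"
        using that(2) pi_less_4 by linarith+
    qed (use T H in auto)
    have lin: "\<bar>gram_pt (\<nu>1 + int j) \<tau>' - (t1 + (pi * real j + \<tau>') / \<omega>)\<bar> \<le> E"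
      if "j < K" "\<bar>\<tau>'\<bar> \<le> pi" for j \<tau>'
    proof -
      define u where "u = gram_pt (\<nu>1 + int j) \<tau>'"
      have u: "u \<in> {T - 4..T + H + 4}" unfolding u_def using that by (intro loc inV) auto
      have "rs_theta u - rs_theta t1 = pi * real j + \<tau>'"
        unfolding u_def rs_theta_gram_pt \<theta>t1 \<theta>1_def by (simp add: algebra_simps)
      then show ?thesis
        using rs_theta_linear_approx[of T H u t1] T H u t1 \<omega>1 unfolding u_def[symmetric] E_def \<omega>_def
        by (simp add: algebra_simps)
    qed
    have K1: "1 \<le> K" using \<nu> by (simp add: K_def)
    have \<omega>0: "0 < \<omega>" using \<omega>1 by simp
    have Kb: "pi * (real K - 1) / \<omega> \<le> H + 1"
    proof -
      have "\<nu>1 + int (K - 1) \<in> V" using K1 by (intro inV) auto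
      then have "gram_pt (\<nu>1 + int (K - 1)) 0 \<le> T + H" by (simp add: V_def)
      moreover have "\<bar>gram_pt (\<nu>1 + int (K - 1)) 0 - (t1 + (pi * real (K - 1) + 0) / \<omega>)\<bar> \<le> E"
        using K1 by (intro lin) auto
      ultimately show ?thesis using E1 t1 K1 by (simp add: of_nat_diff)
    qed
    \<comment> \<open>The K points have spacing about pi / \<omega> and fit into an interval of
      length H + 1, the 1 allowing for the linearisation error.\<close>
    have K3: "real K \<le> 3 * Q * \<omega>"
    proof -
      have "pi * (real K - 1) \<le> (H + 1) * \<omega>" using Kb \<omega>0 by (simp add: divide_le_eq)
      moreover have "1 * (real K - 1) \<le> pi * (real K - 1)" using pi_gt3 K1 by (intro mult_right_mono) auto
      ultimately have "1 * (real K - 1) \<le> (H + 1) * \<omega>" by (rule order_trans[rotated])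
      then have "real K \<le> (H + 1) * \<omega> + 1 * 1" by simp
      also have "\<dots> \<le> (H + 1) * \<omega> + 1 * \<omega>" using \<omega>1 by simp
      also have "\<dots> = (H + 2) * \<omega>" by (simp add: algebra_simps)
      also have "\<dots> \<le> (3 * Q) * \<omega>" using HQ Q20 \<omega>0 by (intro mult_right_mono) auto
      finally show ?thesis by simp
    qed
    define Y where "Y = (\<lambda>\<tau>' j. gram_phase_sum N \<omega> \<theta>1 t1 (pi * real j + \<tau>'))"
    define B where "B = 2 * C / Q + 4 * Q * E * \<omega>"
    have point: "norm (hardy_Z (gram_pt (\<nu>1 + int j) \<tau>') - of_real (2 * Re (Y \<tau>' j))) \<le> B"
      if j: "j < K" and \<tau>': "\<bar>\<tau>'\<bar> \<le> pi" for j \<tau>'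
    proof -
      define u where "u = gram_pt (\<nu>1 + int j) \<tau>'"
      define X where "X = exp (\<i> * of_real (rs_theta u)) * (\<Sum>n = 1..N. of_nat n powr (- (1 / 2 + \<i> * complex_of_real u)))"
      have u: "T - 4 \<le> u" "u \<le> T + H + 4" using loc[OF inV[OF j] \<tau>'] by (auto simp: u_def)
      have su: "s0 \<le> sqrt (u / (2 * pi))"
        unfolding s0_def using u by (intro real_sqrt_le_mono divide_right_mono) auto
      have su': "sqrt (u / (2 * pi)) \<le> s0 + 1"
      proof (rule real_le_lsqrt)
        have "u / (2 * pi) \<le> (T - 4 + (H + 8)) / (2 * pi)" using u by (intro divide_right_mono) auto
        also have "\<dots> = s0\<^sup>2 + (H + 8) / (2 * pi)" unfolding s0sq by (rule add_divide_distrib)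
        also have "(H + 8) / (2 * pi) \<le> (H + 8) / 1" using H pi8 by (intro divide_left_mono) auto
        also have "(H + 8) / 1 \<le> 2 * s0"
        proof -
          have "H + 8 \<le> Q * 2" using HQ Q20 by simp
          also have "\<dots> \<le> Q * (Q / 2)" using Q20 by (intro mult_left_mono) auto
          also have "\<dots> = 2 * (Q\<^sup>2 / 4)" by (simp add: power2_eq_square)
          also have "\<dots> \<le> 2 * s0" using s0Q by (intro mult_left_mono) auto
          finally show ?thesis by simp
        qed
        finally show "u / (2 * pi) \<le> (s0 + 1)\<^sup>2" by (simp add: power2_eq_square algebra_simps)
      qed (use u T s0100 in auto)
      have "norm (hardy_Z u - of_real (2 * Re X)) \<le> C * u powr (- 1 / 4)"
        unfolding X_def using u T N su su' by (intro C) auto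
      also have "\<dots> \<le> C * (2 / Q)"
      proof (intro mult_left_mono)
        have "u powr (- 1 / 4) \<le> ((Q / 2) ^ 4) powr (- 1 / 4)"
          using u T Q0 Q4 by (intro powr_mono2') (auto simp: power_divide)
        also have "(Q / 2) ^ 4 = (Q / 2) powr 4" using Q0 by (subst powr_numeral) auto
        also have "((Q / 2) powr 4) powr (- 1 / 4) = (Q / 2) powr (- 1)" unfolding powr_powr by simp
        also have "\<dots> = 2 / Q" unfolding powr_minus_divide using Q0 by simp
        finally show "u powr (- 1 / 4) \<le> 2 / Q" .
      qed (use C in auto)
      also have "C * (2 / Q) = 2 * C / Q" by simp
      finally have 1: "norm (hardy_Z u - of_real (2 * Re X)) \<le> 2 * C / Q" .
      have "rs_theta u = \<theta>1 + (pi * real j + \<tau>')"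
        unfolding u_def rs_theta_gram_pt \<theta>1_def by (simp add: algebra_simps)
      then have "norm (X - Y \<tau>' j) \<le> 2 * sqrt (real N) * (E * \<omega>)"
        unfolding X_def Y_def using \<omega>0 lnN lin[OF j \<tau>'] by (intro hardy_sum_linearised) (auto simp: u_def)
      also have "\<dots> \<le> 2 * Q * (E * \<omega>)" using sqN E0 \<omega>0 by (intro mult_right_mono) auto
      finally have 2: "norm (X - Y \<tau>' j) \<le> 2 * Q * (E * \<omega>)" .
      have "norm (complex_of_real (2 * Re X) - of_real (2 * Re (Y \<tau>' j))) = 2 * \<bar>Re (X - Y \<tau>' j)\<bar>"
      proof -
        have "complex_of_real (2 * Re X) - of_real (2 * Re (Y \<tau>' j)) = of_real (2 * Re (X - Y \<tau>' j))" by simp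
        then show ?thesis by (simp only: norm_of_real abs_mult abs_numeral)
      qed
      also have "\<dots> \<le> 2 * norm (X - Y \<tau>' j)" by (intro mult_left_mono abs_Re_le_cmod) auto
      also have "\<dots> \<le> 2 * (2 * Q * (E * \<omega>))" using 2 by (intro mult_left_mono) auto
      also have "\<dots> = 4 * Q * E * \<omega>" by simp
      finally have 3: "norm (complex_of_real (2 * Re X) - of_real (2 * Re (Y \<tau>' j))) \<le> 4 * Q * E * \<omega>" .
      have "norm (hardy_Z u - of_real (2 * Re (Y \<tau>' j))) \<le> 2 * C / Q + 4 * Q * E * \<omega>"
        using norm_diff_triangle_le[OF 1 3] .
      then show ?thesis by (simp add: u_def B_def)
    qed
    \<comment> \<open>104 = 2 * 52, because t^\<Delta> \<le> (2 T)^\<Delta> \<le> 2 T^\<Delta> for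
      \<Delta> \<le> 1.\<close>
    have W: "norm (gram_weight_sum N \<omega> \<tau> t) \<le> real k * (104 * A * T powr \<Delta>)" if t: "T \<le> t" "t \<le> 2 * T" for t
    proof -
      have "norm (gram_weight_sum N \<omega> \<tau> t) \<le> real k * (52 * A * t powr \<Delta>)"
        unfolding gram_weight_sum_def
      proof (rule weighted_exponential_sum_bound[OF hyp A])
        have "sqrt (T / (2 * pi)) \<le> sqrt (t / (2 * pi))" using t by (intro real_sqrt_le_mono divide_right_mono) auto
        then show "real (N + 1) \<le> sqrt (t / (2 * pi))"
          unfolding of_nat_add of_nat_1 using N(1) s0T by linarith
      qed (use t T \<tau> \<omega>1 lnN k in auto)
      also have "\<dots> \<le> real k * (52 * A * (2 * T powr \<Delta>))"
      proof (intro mult_left_mono)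
        have "t powr \<Delta> \<le> (2 * T) powr \<Delta>" using t T \<Delta> by (intro powr_mono2) auto
        also have "\<dots> = 2 powr \<Delta> * T powr \<Delta>" using T by (simp add: powr_mult)
        also have "\<dots> \<le> 2 * T powr \<Delta>"
          using powr_mono[of \<Delta> 1 2] \<Delta> by (intro mult_right_mono) auto
        finally show "t powr \<Delta> \<le> 2 * T powr \<Delta>" .
      qed (use A in auto)
      finally show ?thesis by simp
    qed
    define t2 where "t2 = t1 + pi * real K / \<omega>"
    \<comment> \<open>\<open>t2\<close> lies one step beyond the last point of the progression and
      may exceed T + H, but it stays below 2 T.\<close>
    have t2: "T \<le> t2" "t2 \<le> 2 * T"
    proof -
      have "0 \<le> pi * real K / \<omega>" using \<omega>0 by (intro divide_nonneg_pos) auto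
      then show "T \<le> t2" unfolding t2_def using t1(1) by linarith
      have "pi * real K / \<omega> = pi * (real K - 1) / \<omega> + pi / \<omega>" by (simp add: right_diff_distrib diff_divide_distrib)
      moreover have "pi / \<omega> \<le> 4 / 1" using \<omega>1 pi_less_4 by (intro frac_le) auto
      moreover have "3 * Q \<le> Q * Q ^ 3"
      proof -
        have "3 \<le> Q ^ 3" using Q20 self_le_power[of Q 3] by simp
        then have "Q * 3 \<le> Q * Q ^ 3" using Q0 by (intro mult_left_mono) auto
        then show ?thesis by (simp add: mult.commute)
      qed
      then have "3 * Q \<le> T" unfolding Q4[symmetric] by (simp add: power_numeral_reduce)
      ultimately show "t2 \<le> 2 * T" unfolding t2_def using Kb t1 HQ Q20 by linarith
    qed
    have "norm (\<Sum>j<K. Y \<tau> j - Y 0 j) \<le> 2 * (real k * (104 * A * T powr \<Delta>))"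
    proof -
      have "(\<Sum>j<K. Y \<tau> j - Y 0 j) = exp (\<i> * of_real \<theta>1) * (exp (\<i> * of_real (pi * real K)) * gram_weight_sum N \<omega> \<tau> t2 - gram_weight_sum N \<omega> \<tau> t1)"
        using gram_phase_sum_diff[OF \<omega>0 lnN, of \<theta>1 t1 \<tau> K] by (simp add: Y_def t2_def)
      then have "norm (\<Sum>j<K. Y \<tau> j - Y 0 j) = norm (exp (\<i> * of_real (pi * real K)) * gram_weight_sum N \<omega> \<tau> t2 - gram_weight_sum N \<omega> \<tau> t1)"
        by (simp only: norm_mult norm_exp_i_times mult_1)
      also have "\<dots> \<le> norm (exp (\<i> * of_real (pi * real K)) * gram_weight_sum N \<omega> \<tau> t2) + norm (gram_weight_sum N \<omega> \<tau> t1)"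
        by (rule norm_triangle_ineq4)
      also have "norm (exp (\<i> * of_real (pi * real K)) * gram_weight_sum N \<omega> \<tau> t2) = norm (gram_weight_sum N \<omega> \<tau> t2)"
        by (simp only: norm_mult norm_exp_i_times mult_1)
      also have "norm (gram_weight_sum N \<omega> \<tau> t2) + norm (gram_weight_sum N \<omega> \<tau> t1) \<le> 2 * (real k * (104 * A * T powr \<Delta>))"
        using W[OF t2] W[of t1] t1 HQ QT by linarith
      finally show ?thesis .
    qed
    then have main: "norm (complex_of_real (2 * Re (\<Sum>j<K. Y \<tau> j - Y 0 j))) \<le> 4 * (real k * (104 * A * T powr \<Delta>))"
      using abs_Re_le_cmod[of "\<Sum>j<K. Y \<tau> j - Y 0 j"] by (simp only: norm_of_real abs_mult abs_numeral)
    define D where "D = (\<lambda>\<tau>' j. hardy_Z (gram_pt (\<nu>1 + int j) \<tau>') - of_real (2 * Re (Y \<tau>' j)))"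
    have diff: "gram_sum \<tau> T H - gram_sum 0 T H = (\<Sum>j<K. D \<tau> j) - (\<Sum>j<K. D 0 j) + of_real (2 * Re (\<Sum>j<K. Y \<tau> j - Y 0 j))"
      unfolding gs sumV D_def by (simp add: sum_subtractf sum_distrib_left algebra_simps)
    have "norm (a - b + c) \<le> norm a + norm b + norm c" for a b c :: complex
      using norm_triangle_ineq[of "a - b" c] norm_triangle_ineq4[of a b] by linarith
    then have "norm (gram_sum \<tau> T H - gram_sum 0 T H)
       \<le> norm (\<Sum>j<K. D \<tau> j) + norm (\<Sum>j<K. D 0 j) + norm (complex_of_real (2 * Re (\<Sum>j<K. Y \<tau> j - Y 0 j)))"
      unfolding diff .
    moreover have "norm (\<Sum>j<K. D \<tau> j) + norm (\<Sum>j<K. D 0 j) + norm (complex_of_real (2 * Re (\<Sum>j<K. Y \<tau> j - Y 0 j))) \<le> real K * B + real K * B + 4 * (real k * (104 * A * T powr \<Delta>))"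
    proof (intro add_mono main)
      have "norm (\<Sum>j<K. D \<tau>' j) \<le> real K * B" if "\<bar>\<tau>'\<bar> \<le> pi" for \<tau>'
      proof -
        have "norm (\<Sum>j<K. D \<tau>' j) \<le> of_nat (card {..<K}) * B"
          by (rule sum_norm_bound) (use point[OF _ that] in \<open>auto simp: D_def\<close>)
        then show ?thesis by simp
      qed
      then show "norm (\<Sum>j<K. D \<tau> j) \<le> real K * B" "norm (\<Sum>j<K. D 0 j) \<le> real K * B"
        using \<tau> by auto
    qed
    moreover have "real K * B + real K * B \<le> 12 * C * \<omega> + 9408 * \<omega>\<^sup>2"
    proof -
      have "B \<le> 2 * C / Q + 4 * Q * (392 / Q\<^sup>2) * \<omega>"
        unfolding B_def using EQ Q0 \<omega>0 by (intro add_mono mult_right_mono mult_left_mono) auto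
      also have "\<dots> = (2 * C + 1568 * \<omega>) / Q"
        using Q0 by (simp add: power2_eq_square field_simps)
      finally have B: "B \<le> (2 * C + 1568 * \<omega>) / Q" .
      have "real K * B \<le> (3 * Q * \<omega>) * ((2 * C + 1568 * \<omega>) / Q)"
        using K3 B \<omega>0 Q0 E0 C by (intro mult_mono) (auto simp: B_def)
      also have "\<dots> = 6 * C * \<omega> + 4704 * \<omega>\<^sup>2"
        using Q0 by (simp add: power2_eq_square field_simps)
      finally show ?thesis by linarith
    qed
    moreover have "12 * C * \<omega> + 9408 * \<omega>\<^sup>2 \<le> 12 * C * (T powr \<Delta> * ln T) + 9408 * (T powr \<Delta> / \<Delta> * ln T)"
    proof (intro add_mono mult_left_mono)
      have "1 \<le> T powr \<Delta>" using T \<Delta> by (intro ge_one_powr_ge_zero) auto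
      then have "1 * ln T \<le> T powr \<Delta> * ln T" using lnT by (intro mult_right_mono) auto
      then show "\<omega> \<le> T powr \<Delta> * ln T" using \<omega>T by simp
      \<comment> \<open>One of the two logarithms is traded for T^\<Delta> / \<Delta>; this is the
        origin of the term with 1 / \<Delta> in the constant.\<close>
      have "\<omega>\<^sup>2 \<le> ln T * ln T" unfolding power2_eq_square using \<omega>T \<omega>0 lnT by (intro mult_mono) auto
      also have "\<dots> \<le> T powr \<Delta> / \<Delta> * ln T"
        using T \<Delta> lnT by (intro mult_right_mono ln_powr_bound) auto
      finally show "\<omega>\<^sup>2 \<le> T powr \<Delta> / \<Delta> * ln T" .
    qed (use C in auto)
    moreover have "4 * (real k * (104 * A * T powr \<Delta>)) \<le> 4 * ((3 * ln T) * (104 * A * T powr \<Delta>))"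
      using k A by (intro mult_left_mono mult_right_mono) auto
    moreover have "12 * C * (T powr \<Delta> * ln T) + 9408 * (T powr \<Delta> / \<Delta> * ln T) + 4 * ((3 * ln T) * (104 * A * T powr \<Delta>))
       = (12 * C + 9408 / \<Delta> + 1248 * A) * (T powr \<Delta> * ln T)"
      by (simp add: algebra_simps)
    ultimately show ?thesis by linarith
  qed
qed

theorem theorem1:
  fixes \<epsilon> \<Delta> A :: real
  assumes "0 < \<epsilon>" and "\<epsilon> \<le> 1 / 12"
    and "0 < \<Delta>" and "\<Delta> \<le> 1 / 6"
    and "0 < A"
    and "\<And>(t::real) (a::nat) (b::nat).
           0 < t \<Longrightarrow> 1 \<le> a \<Longrightarrow> a < b \<Longrightarrow> b \<le> 2 * a \<Longrightarrow> real b \<le> sqrt (t / (2 * pi)) \<Longrightarrow>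
           norm (\<Sum>n = a..<b. of_nat n powr (\<i> * complex_of_real t))
             < A * sqrt (real a) * t powr \<Delta>"
  shows "\<exists>C T0. \<forall>T \<ge> T0. \<forall>H. 0 < H \<and> H \<le> T powr (1 / 6 + \<epsilon>) \<longrightarrow>
           (\<forall>\<tau> \<in> {- pi..pi}.
              norm (gram_sum \<tau> T H - gram_sum 0 T H) \<le> C * (T powr \<Delta> * ln T))"
proof -
  obtain C where C: "0 < C" "\<And>t N. 300 \<le> t \<Longrightarrow> \<bar>real N + 1 / 2 - sqrt (t / (2 * pi))\<bar> \<le> 3 \<Longrightarrow>
    norm (hardy_Z t - of_real (2 * Re (exp (\<i> * of_real (rs_theta t)) *
      (\<Sum>n = 1..N. of_nat n powr (- (1 / 2 + \<i> * of_real t)))))) \<le> C * t powr (- 1 / 4)"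
    using hardy_Z_approx by blast
  show ?thesis
  proof (intro exI allI ballI impI)
    fix T H \<tau> :: real
    assume T: "160000 \<le> T" and H: "0 < H \<and> H \<le> T powr (1 / 6 + \<epsilon>)" and \<tau>: "\<tau> \<in> {- pi..pi}"
    \<comment> \<open>1/6 + 1/12 = 1/4, the exponent at which the accumulated errors are still
      powers of ln T.\<close>
    have "T powr (1 / 6 + \<epsilon>) \<le> T powr (1 / 4)" using T assms by (intro powr_mono) auto
    then have H4: "H \<le> T powr (1 / 4)" using H by linarith
    have "0 < H" "\<bar>\<tau>\<bar> \<le> pi" "\<Delta> \<le> 1" using H \<tau> assms(4) by auto
    then show "norm (gram_sum \<tau> T H - gram_sum 0 T H) \<le> (12 * C + 9408 / \<Delta> + 1248 * A) * (T powr \<Delta> * ln T)"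
      using gram_sum_diff_bound[OF assms(6,5,3) _ C T _ H4] by simp
  qed
qed

end
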